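(* Let $\vec\kappa=\langle\kappa_0\le\dots\le\kappa_n\rangle$ be a weakly increasing tuple of cardinals and $-1\le k\le n$ an integer, and suppose $X(\vec\kappa)^-$ admits a $k$-Fubini partition. Then: (1) $H^{k+1}(X(\vec\kappa)^-,\underline{\mathbb{Z}_2})=0$; and (2) for every weakly increasing tuple of cardinals $\vec\lambda=\langle\lambda_0,\dots,\lambda_n\rangle$ with $\lambda_i\le\kappa_i$ for all $i\le n$, there is an injective group homomorphism $H^k(X(\vec\lambda)^-,\underline{\mathbb{Z}_2})\hookrightarrow H^k(X(\vec\kappa)^-,\underline{\mathbb{Z}_2})$.
   Context: For a cardinal $\kappa$, $\alpha(\kappa)=\kappa\sqcup\{\infty\}$ is the one-point compactification of the discrete space $\kappa$. For a weakly increasing tuple $\vec\kappa=\langle\kappa_0,\dots,\kappa_n\rangle$, $X(\vec\kappa)=\prod_{i\le n}\alpha(\kappa_i)$ (product topology) and $X(\vec\kappa)^-=X(\vec\kappa)\setminus\{(\infty,\dots,\infty)\}$. $H^k(Y,\underline{\mathbb{Z}_2})$ is sheaf cohomology with coefficients in the constant sheaf $\mathbb{Z}/2\mathbb{Z}$. Write $n+1=\{0,\dots,n\}$ and $[n+1]^{\ge m}$ for the set of subsets of $\{0,\dots,n\}$ of size at least $m$. For $A\subseteq\{0,\dots,n\}$: $\mathcal{D}_A=\{\vec x\in X(\vec\kappa): x_i\ne\infty \text{ for all } i\in A\}$ (subspace topology); the facet $F_A=\{\vec x\in X(\vec\kappa): x_i\neq\infty \iff i\in A\}$. For $\vec x\in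 F_A$ and a tuple $\vec{\mathcal{E}}=(\mathcal{E}_j)_{j\notin A}$ of finite sets $\mathcal{E}_j\subseteq\kappa_j$, let $\mathcal{N}_A(\vec x,\vec{\mathcal{E}})=\{\vec y\in X(\vec\kappa): y_i=x_i \text{ for all } i\in A,\ \text{and for all } j\notin A,\ y_j=\infty \text{ or } y_j\notin\mathcal{E}_j\}$. A $k$-Fubini partition of $X(\vec\kappa)^-$ is a partition $\langle Y_i:i\le n\rangle$ of $X(\vec\kappa)^-$ into $n+1$ (possibly empty) sets such that for every $A\in[n+1]^{\ge k+1}$: (1) for every $i\notin A$, $Y_i\cap\mathcal{D}_A$ is clopen in $\mathcal{D}_A$; and (2) for every $\vec x\in F_A$ there is a tuple $\vec{\mathcal{E}}=(\mathcal{E}_j)_{j\notin A}$ of finite sets $\mathcal{E}_j\subseteq\kappa_j$ with $\mathcal{N}_A(\vec x,\vec{\mathcal{E}})\subseteq\bigcup_{i\in A}Y_i$. *)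

theory Defs
  imports "HOL-Analysis.Analysis" "HOL-Algebra.Elementary_Groups"
begin

section \<open>Sheaves of abelian groups\<close>

text \<open>
  Groups are written multiplicatively, following HOL-Algebra. The intended meaning of
  \<open>restr F U V\<close> is the restriction map from \<open>sections F U\<close> to \<open>sections F V\<close>, for open
  \<open>V \<subseteq> U\<close>; all data on other arguments, or outside the carriers, is irrelevant.
\<close>

record ('a, 'b) sheaf_data =
  sections :: "'a set \<Rightarrow> 'b monoid"
  restr :: "'a set \<Rightarrow> 'a set \<Rightarrow> 'b \<Rightarrow> 'b"

definition is_presheaf :: "'a topology \<Rightarrow> ('a, 'b) sheaf_data \<Rightarrow> bool" where
  "is_presheaf T F \<longleftrightarrow>
     (\<forall>U. openin T U \<longrightarrow> comm_group (sections F U)) \<and>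
     (\<forall>U V. openin T U \<and> openin T V \<and> V \<subseteq> U \<longrightarrow>
        restr F U V \<in> hom (sections F U) (sections F V)) \<and>
     (\<forall>U. openin T U \<longrightarrow> (\<forall>s \<in> carrier (sections F U). restr F U U s = s)) \<and>
     (\<forall>U V W. openin T U \<and> openin T V \<and> openin T W \<and> W \<subseteq> V \<and> V \<subseteq> U \<longrightarrow>
        (\<forall>s \<in> carrier (sections F U). restr F V W (restr F U V s) = restr F U W s))"

definition is_sheaf :: "'a topology \<Rightarrow> ('a, 'b) sheaf_data \<Rightarrow> bool" where
  "is_sheaf T F \<longleftrightarrow> is_presheaf T F \<and>
     (\<forall>\<U> s. (\<forall>U\<in>\<U>. openin T U \<and> s U \<in> carrier (sections F U)) \<and>
        (\<forall>U\<in>\<U>. \<forall>V\<in>\<U>. restr F U (U \<inter> V) (s U) = restr F V (U \<inter> V) (s V)) \<longrightarrow>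
        (\<exists>!t. t \<in> carrier (sections F (\<Union>\<U>)) \<and> (\<forall>U\<in>\<U>. restr F (\<Union>\<U>) U t = s U)))"

definition sheaf_hom ::
  "'a topology \<Rightarrow> ('a, 'b) sheaf_data \<Rightarrow> ('a, 'c) sheaf_data \<Rightarrow> ('a set \<Rightarrow> 'b \<Rightarrow> 'c) set" where
  "sheaf_hom T F G = {\<phi>.
     (\<forall>U. openin T U \<longrightarrow> \<phi> U \<in> hom (sections F U) (sections G U)) \<and>
     (\<forall>U V. openin T U \<and> openin T V \<and> V \<subseteq> U \<longrightarrow>
        (\<forall>s \<in> carrier (sections F U). \<phi> V (restr F U V s) = restr G U V (\<phi> U s)))}"

definition sheaf_mono ::
  "'a topology \<Rightarrow> ('a, 'b) sheaf_data \<Rightarrow> ('a, 'c) sheaf_data \<Rightarrow> ('a set \<Rightarrow> 'b \<Rightarrow> 'c) set" where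
  "sheaf_mono T F G =
     {\<phi> \<in> sheaf_hom T F G. \<forall>U. openin T U \<longrightarrow> inj_on (\<phi> U) (carrier (sections F U))}"

text \<open>
  The image of a sheaf morphism consists of the sections that locally have preimages.
\<close>

definition in_image_sheaf ::
  "'a topology \<Rightarrow> ('a, 'b) sheaf_data \<Rightarrow> ('a, 'c) sheaf_data \<Rightarrow> ('a set \<Rightarrow> 'b \<Rightarrow> 'c) \<Rightarrow>
   'a set \<Rightarrow> 'c \<Rightarrow> bool" where
  "in_image_sheaf T F G \<phi> U s \<longleftrightarrow>
     (\<forall>x\<in>U. \<exists>V. openin T V \<and> x \<in> V \<and> V \<subseteq> U \<and>
        (\<exists>t \<in> carrier (sections F V). \<phi> V t = restr G U V s))"

definition sheaf_exact ::
  "'a topology \<Rightarrow> ('a, 'b) sheaf_data \<Rightarrow> ('a, 'c) sheaf_data \<Rightarrow> ('a, 'd) sheaf_data \<Rightarrow>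
   ('a set \<Rightarrow> 'b \<Rightarrow> 'c) \<Rightarrow> ('a set \<Rightarrow> 'c \<Rightarrow> 'd) \<Rightarrow> bool" where
  "sheaf_exact T F G H \<phi> \<psi> \<longleftrightarrow>
     (\<forall>U. openin T U \<longrightarrow> (\<forall>s \<in> carrier (sections G U).
        \<psi> U s = \<one>\<^bsub>sections H U\<^esub> \<longleftrightarrow> in_image_sheaf T F G \<phi> U s))"

text \<open>
  The constant sheaf with stalk \<open>A\<close>: locally constant \<open>A\<close>-valued functions.
\<close>

definition constant_sheaf :: "'a topology \<Rightarrow> 'c monoid \<Rightarrow> ('a, 'a \<Rightarrow> 'c) sheaf_data" where
  "constant_sheaf T A =
     \<lparr> sections = (\<lambda>U.
         \<lparr> carrier = {f \<in> extensional U.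
                        continuous_map (subtopology T U) (discrete_topology (carrier A)) f},
           monoid.mult = (\<lambda>f g. \<lambda>x\<in>U. f x \<otimes>\<^bsub>A\<^esub> g x),
           one = (\<lambda>x\<in>U. \<one>\<^bsub>A\<^esub>) \<rparr>),
       restr = (\<lambda>U V f. restrict f V) \<rparr>"


section \<open>Sheaf cohomology as a right derived functor\<close>

text \<open>
  HOL cannot quantify over all types inside a definition, so the extension property is tested
  against sheaves whose sections are drawn from the fixed type \<open>'a \<Rightarrow> int\<close>. This is no loss: by
  the Baer-Grothendieck criterion a sheaf is injective as soon as morphisms into it extend from
  subsheaves of the generators (extensions by zero to the whole space of the constant sheaf of
  integers on an open set), and the sections of these generators are integer-valued functions.
\<close>

definition injective_sheaf :: "'a topology \<Rightarrow> ('a, 'b) sheaf_data \<Rightarrow> bool" where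
  "injective_sheaf T I \<longleftrightarrow> is_sheaf T I \<and>
     (\<forall>(F :: ('a, 'a \<Rightarrow> int) sheaf_data) (G :: ('a, 'a \<Rightarrow> int) sheaf_data) \<iota> f.
        is_sheaf T F \<and> is_sheaf T G \<and> \<iota> \<in> sheaf_mono T F G \<and> f \<in> sheaf_hom T F I \<longrightarrow>
        (\<exists>g \<in> sheaf_hom T G I.
           \<forall>U. openin T U \<longrightarrow> (\<forall>s \<in> carrier (sections F U). g U (\<iota> U s) = f U s)))"

definition injective_resolution ::
  "'a topology \<Rightarrow> ('a, 'c) sheaf_data \<Rightarrow> (nat \<Rightarrow> ('a, 'b) sheaf_data) \<Rightarrow>
   ('a set \<Rightarrow> 'c \<Rightarrow> 'b) \<Rightarrow> (nat \<Rightarrow> 'a set \<Rightarrow> 'b \<Rightarrow> 'b) \<Rightarrow> bool" where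
  "injective_resolution T F I \<epsilon> d \<longleftrightarrow>
     (\<forall>p. injective_sheaf T (I p)) \<and>
     \<epsilon> \<in> sheaf_mono T F (I 0) \<and>
     (\<forall>p. d p \<in> sheaf_hom T (I p) (I (Suc p))) \<and>
     sheaf_exact T F (I 0) (I 1) \<epsilon> (d 0) \<and>
     (\<forall>p. sheaf_exact T (I p) (I (Suc p)) (I (Suc (Suc p))) (d p) (d (Suc p)))"

text \<open>
  Cohomology of the complex of global sections of \<open>I\<close>, which is zero in negative degrees.
\<close>

definition global_coboundaries ::
  "'a topology \<Rightarrow> (nat \<Rightarrow> ('a, 'b) sheaf_data) \<Rightarrow> (nat \<Rightarrow> 'a set \<Rightarrow> 'b \<Rightarrow> 'b) \<Rightarrow> nat \<Rightarrow> 'b set" where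
  "global_coboundaries T I d p =
     (case p of
        0 \<Rightarrow> {\<one>\<^bsub>sections (I 0) (topspace T)\<^esub>}
      | Suc q \<Rightarrow> d q (topspace T) ` carrier (sections (I q) (topspace T)))"

definition global_cohomology ::
  "'a topology \<Rightarrow> (nat \<Rightarrow> ('a, 'b) sheaf_data) \<Rightarrow> (nat \<Rightarrow> 'a set \<Rightarrow> 'b \<Rightarrow> 'b) \<Rightarrow>
   int \<Rightarrow> 'b set monoid" where
  "global_cohomology T I d m =
     (if m < 0 then singleton_group {}
      else let p = nat m; G = (\<lambda>q. sections (I q) (topspace T)) in
        (G p)\<lparr>carrier := kernel (G p) (G (Suc p)) (d p (topspace T))\<rparr>
          Mod global_coboundaries T I d p)"

text \<open>
  \<open>H\<close> is the degree \<open>m\<close> cohomology of \<open>F\<close>, computed from some injective resolution. As usual,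
  \<open>H\<close> is determined by \<open>F\<close> and \<open>m\<close> up to isomorphism only. The type \<open>'b\<close>, in which the sections
  of the resolution live, is a parameter.
\<close>

definition is_sheaf_cohomology ::
  "'a topology \<Rightarrow> ('a, 'c) sheaf_data \<Rightarrow> int \<Rightarrow> 'b set monoid \<Rightarrow> bool" where
  "is_sheaf_cohomology T F m H \<longleftrightarrow>
     (\<exists>I \<epsilon> d. injective_resolution T F I \<epsilon> d \<and> H = global_cohomology T I d m)"


section \<open>Products of one-point compactifications and Fubini partitions\<close>

text \<open>
  The cardinal \<open>\<kappa>\<^sub>i\<close> is represented by a set \<open>K i\<close> of that cardinality; \<open>None\<close> is the point at
  infinity.
\<close>

definition weakly_increasing :: "nat \<Rightarrow> (nat \<Rightarrow> 'k set) \<Rightarrow> bool" where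
  "weakly_increasing n K \<longleftrightarrow> (\<forall>i j. i \<le> j \<and> j \<le> n \<longrightarrow> K i \<lesssim> K j)"

definition X_space :: "nat \<Rightarrow> (nat \<Rightarrow> 'k set) \<Rightarrow> (nat \<Rightarrow> 'k option) topology" where
  "X_space n K =
     product_topology (\<lambda>i. Alexandroff_compactification (discrete_topology (K i))) {..n}"

definition X_minus :: "nat \<Rightarrow> (nat \<Rightarrow> 'k set) \<Rightarrow> (nat \<Rightarrow> 'k option) topology" where
  "X_minus n K = subtopology (X_space n K) (topspace (X_space n K) - {\<lambda>i\<in>{..n}. None})"

definition D_set :: "nat \<Rightarrow> (nat \<Rightarrow> 'k set) \<Rightarrow> nat set \<Rightarrow> (nat \<Rightarrow> 'k option) set" where
  "D_set n K A = {x \<in> topspace (X_space n K). \<forall>i\<in>A. x i \<noteq> None}"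

definition facet :: "nat \<Rightarrow> (nat \<Rightarrow> 'k set) \<Rightarrow> nat set \<Rightarrow> (nat \<Rightarrow> 'k option) set" where
  "facet n K A = {x \<in> topspace (X_space n K). \<forall>i\<le>n. x i \<noteq> None \<longleftrightarrow> i \<in> A}"

definition N_set ::
  "nat \<Rightarrow> (nat \<Rightarrow> 'k set) \<Rightarrow> nat set \<Rightarrow> (nat \<Rightarrow> 'k option) \<Rightarrow> (nat \<Rightarrow> 'k set) \<Rightarrow>
   (nat \<Rightarrow> 'k option) set" where
  "N_set n K A x E = {y \<in> topspace (X_space n K).
     (\<forall>i\<in>A. y i = x i) \<and> (\<forall>j\<in>{..n} - A. y j = None \<or> y j \<notin> Some ` E j)}"

definition Fubini_partition ::
  "int \<Rightarrow> nat \<Rightarrow> (nat \<Rightarrow> 'k set) \<Rightarrow> (nat \<Rightarrow> (nat \<Rightarrow> 'k option) set) \<Rightarrow> bool" where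
  "Fubini_partition k n K Y \<longleftrightarrow>
     (\<Union>i\<le>n. Y i) = topspace (X_minus n K) \<and> disjoint_family_on Y {..n} \<and>
     (\<forall>A. A \<subseteq> {..n} \<and> int (card A) \<ge> k + 1 \<longrightarrow>
        (\<forall>i\<in>{..n} - A.
           openin (subtopology (X_space n K) (D_set n K A)) (Y i \<inter> D_set n K A) \<and>
           closedin (subtopology (X_space n K) (D_set n K A)) (Y i \<inter> D_set n K A)) \<and>
        (\<forall>x \<in> facet n K A. \<exists>E. (\<forall>j\<in>{..n} - A. finite (E j) \<and> E j \<subseteq> K j) \<and>
           N_set n K A x E \<subseteq> (\<Union>i\<in>A. Y i)))"

end

theory Submission
  imports Defs "HOL-Algebra.Product_Groups"
begin

text \<open>
  The sets \<open>D i\<close> of points of \<open>X\<^sup>-\<close> whose coordinate \<open>i \<le> n\<close> is finite form an open cover. All their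
  intersections over nonempty index sets are disjoint unions of compact open sets with a clopen base,
  so every open cover of them has a disjoint open refinement, and exactness of sheaves passes to their
  sections. Since injective sheaves are flasque, the double complex of alternating Cech cochains with
  values in an injective resolution has exact rows and columns, and the cohomology of \<open>X\<^sup>-\<close> is the
  cohomology of the Cech complex of this cover with values in the integers modulo 2.

  A Fubini partition \<open>Y\<close> gives a contraction of that complex in degree \<open>k + 1\<close>: if \<open>c\<close> is a cocycle,
  then \<open>b B x = c (B \<union> {i}) x\<close> for \<open>x \<in> Y i\<close>, \<open>i \<notin> B\<close> (and \<open>0\<close> if \<open>i \<in> B\<close>) defines a continuous
  primitive of \<open>c\<close>, which vanishes wherever \<open>c\<close> does. Hence a cocycle of degree \<open>k\<close> on a subproduct
  extends to the whole product: extend it by zero and correct by the primitive of the resulting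
  coboundary. So restriction to the subproduct is surjective in degree \<open>k\<close>, and it splits because the
  groups have exponent 2. There is no Fubini partition for \<open>k = -1\<close>, because clause (2) with the empty
  index set cannot hold at the point at infinity.
\<close>

section \<open>Presheaves and sheaves\<close>

text \<open>Restriction along the inclusion of the subproduct runs from the large product to the
  small one, opposite to the wanted injection. The coordinatewise retraction, which sends missing
  points to infinity, is no substitute: it can map points of the punctured product to the removed
  point and need not map the sets \<open>D i\<close> of the large product into those of the small
  one, so pulling back along it is not a cochain map. Hence the surjection that is split afterwards.

  The resolutions are arbitrary, with sections in unrelated types and no given maps between them;
  the Cech complex mod 2 is their only common ground. A zigzag through the double complex involves
  choices, so the comparison is kept as a relation that respects products and inverses and matches
  coboundaries. A homomorphism appears only on quotients.

  Indices count the members of an index set, so Cech degree m sits at \<open>Suc m\<close>. Index 0,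
  the empty set, stands for global sections: there the rows are still exact but the columns need not
  be, and that failure is the cohomology to be computed.\<close>

locale presheaf =
  fixes T :: "'a topology" and F :: "('a, 'b) sheaf_data"
  assumes is_presheaf: "is_presheaf T F"
begin

lemma comm_group_sections: "openin T U \<Longrightarrow> comm_group (sections F U)"
  by (rule is_presheaf[unfolded is_presheaf_def, THEN conjunct1, rule_format])

lemma group_sections: "openin T U \<Longrightarrow> group (sections F U)"
  by (rule comm_group.axioms(2)[OF comm_group_sections])

lemma restr_hom:
  "\<lbrakk>openin T U; openin T V; V \<subseteq> U\<rbrakk> \<Longrightarrow> restr F U V \<in> hom (sections F U) (sections F V)"
  using is_presheaf[unfolded is_presheaf_def, THEN conjunct2, THEN conjunct1, rule_format] by simp

lemma restr_closed:
  "\<lbrakk>openin T U; openin T V; V \<subseteq> U; s \<in> carrier (sections F U)\<rbrakk>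
    \<Longrightarrow> restr F U V s \<in> carrier (sections F V)"
  by (rule hom_in_carrier[OF restr_hom])

lemma restr_mult:
  "\<lbrakk>openin T U; openin T V; V \<subseteq> U; s \<in> carrier (sections F U); t \<in> carrier (sections F U)\<rbrakk>
    \<Longrightarrow> restr F U V (s \<otimes>\<^bsub>sections F U\<^esub> t) = restr F U V s \<otimes>\<^bsub>sections F V\<^esub> restr F U V t"
  by (rule hom_mult[OF restr_hom])

lemma restr_one:
  "\<lbrakk>openin T U; openin T V; V \<subseteq> U\<rbrakk> \<Longrightarrow> restr F U V \<one>\<^bsub>sections F U\<^esub> = \<one>\<^bsub>sections F V\<^esub>"
  by (rule hom_one[OF restr_hom]) (auto intro: group_sections)

lemma restr_inv:
  assumes "openin T U" "openin T V" "V \<subseteq> U" "s \<in> carrier (sections F U)"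
  shows "restr F U V (inv\<^bsub>sections F U\<^esub> s) = inv\<^bsub>sections F V\<^esub> (restr F U V s)"
proof -
  interpret group_hom "sections F U" "sections F V" "restr F U V"
    using assms by (simp add: group_hom_def group_hom_axioms_def group_sections restr_hom)
  show ?thesis using assms(4) by simp
qed

lemma restr_id: "\<lbrakk>openin T U; s \<in> carrier (sections F U)\<rbrakk> \<Longrightarrow> restr F U U s = s"
  by (rule is_presheaf[unfolded is_presheaf_def, THEN conjunct2, THEN conjunct2, THEN conjunct1, rule_format])

lemma restr_restr:
  "\<lbrakk>openin T U; openin T V; openin T W; W \<subseteq> V; V \<subseteq> U; s \<in> carrier (sections F U)\<rbrakk>
    \<Longrightarrow> restr F V W (restr F U V s) = restr F U W s"
  using is_presheaf[unfolded is_presheaf_def, THEN conjunct2, THEN conjunct2, THEN conjunct2, rule_format]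
  by simp

end

locale sheaf =
  fixes T :: "'a topology" and F :: "('a, 'b) sheaf_data"
  assumes is_sheaf: "is_sheaf T F"
begin

sublocale presheaf
  using is_sheaf by unfold_locales (auto simp only: is_sheaf_def)

lemma glue:
  assumes "\<And>U. U \<in> \<U> \<Longrightarrow> openin T U" "\<And>U. U \<in> \<U> \<Longrightarrow> s U \<in> carrier (sections F U)"
    and "\<And>U V. \<lbrakk>U \<in> \<U>; V \<in> \<U>\<rbrakk> \<Longrightarrow> restr F U (U \<inter> V) (s U) = restr F V (U \<inter> V) (s V)"
  shows "\<exists>!t. t \<in> carrier (sections F (\<Union>\<U>)) \<and> (\<forall>U\<in>\<U>. restr F (\<Union>\<U>) U t = s U)"
  using is_sheaf assms unfolding is_sheaf_def by metis

text \<open>Glue the restrictions of \<open>s\<close> over all open sets on which the two sections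
  agree: \<open>s\<close> and \<open>t\<close> are both gluings, so uniqueness identifies
  them.\<close>

lemma separated:
  assumes "\<And>x. x \<in> U \<Longrightarrow> \<exists>V. openin T V \<and> x \<in> V \<and> V \<subseteq> U \<and> restr F U V s = restr F U V t"
    and "openin T U" "s \<in> carrier (sections F U)" "t \<in> carrier (sections F U)"
  shows "s = t"
proof -
  define \<U> where "\<U> = {V. openin T V \<and> V \<subseteq> U \<and> restr F U V s = restr F U V t}"
  have U: "\<Union>\<U> = U" using assms(1) by (auto simp: \<U>_def)
  have "\<exists>!u. u \<in> carrier (sections F (\<Union>\<U>)) \<and> (\<forall>V\<in>\<U>. restr F (\<Union>\<U>) V u = restr F U V s)"
  proof (rule glue)
    fix V W assume "V \<in> \<U>" "W \<in> \<U>"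
    then have V: "openin T V" "V \<subseteq> U" and W: "openin T W" "W \<subseteq> U" by (auto simp: \<U>_def)
    then show "restr F V (V \<inter> W) (restr F U V s) = restr F W (V \<inter> W) (restr F U W s)"
      using restr_restr[OF assms(2) V(1) _ _ V(2) assms(3)] restr_restr[OF assms(2) W(1) _ _ W(2) assms(3)]
      openin_Int[OF V(1) W(1)] \<open>V \<in> \<U>\<close> \<open>W \<in> \<U>\<close> by auto
  next
    fix V assume "V \<in> \<U>"
    then have V: "openin T V" "V \<subseteq> U" by (auto simp: \<U>_def)
    then show "restr F U V s \<in> carrier (sections F V)" "openin T V"
      using restr_closed assms(2,3) by blast+
  qed
  then show ?thesis
    using assms(3,4) unfolding U by (auto simp: \<U>_def)
qed

lemma glue_two:
  assumes "openin T U" "openin T V" "s \<in> carrier (sections F U)" "t \<in> carrier (sections F V)"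
    and eq: "restr F U (U \<inter> V) s = restr F V (U \<inter> V) t"
  obtains u where "u \<in> carrier (sections F (U \<union> V))"
    "restr F (U \<union> V) U u = s" "restr F (U \<union> V) V u = t"
proof -
  \<comment> \<open>Gluing data are indexed by the open sets themselves, so for \<open>U = V\<close>
    one value has to serve both; \<open>eq\<close> then forces \<open>s = t\<close>.\<close>
  define r where "r W = (if W = U then s else t)" for W
  have rV: "r V = t"
  proof (cases "U = V")
    case True then show ?thesis using eq assms by (simp add: r_def restr_id)
  qed (auto simp: r_def)
  have rU: "r U = s" by (simp add: r_def)
  have "\<exists>!u. u \<in> carrier (sections F (\<Union>{U, V})) \<and> (\<forall>W\<in>{U, V}. restr F (\<Union>{U, V}) W u = r W)"
    by (rule glue) (use assms rU rV eq in \<open>auto simp: Int_commute\<close>)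
  then show thesis using that rU rV by auto
qed

text \<open>There are no points to test, so separation applies vacuously. This makes compatibility
  automatic for disjoint covers.\<close>

lemma empty_section_unique:
  assumes "s \<in> carrier (sections F {})" "t \<in> carrier (sections F {})"
  shows "s = t"
  by (rule separated) (use assms in auto)

lemma glue_disjoint:
  assumes op: "\<And>U. U \<in> \<U> \<Longrightarrow> openin T U" and cl: "\<And>U. U \<in> \<U> \<Longrightarrow> s U \<in> carrier (sections F U)"
    and "pairwise disjnt \<U>"
  obtains t where "t \<in> carrier (sections F (\<Union>\<U>))" "\<And>U. U \<in> \<U> \<Longrightarrow> restr F (\<Union>\<U>) U t = s U"
proof -
  have "restr F U (U \<inter> V) (s U) = restr F V (U \<inter> V) (s V)" if "U \<in> \<U>" "V \<in> \<U>" for U V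
  proof (cases "U = V")
    case False
    then have e: "U \<inter> V = {}" using assms(3) that by (auto simp: pairwise_def disjnt_def)
    show ?thesis unfolding e
      by (rule empty_section_unique) (use that op cl in \<open>auto intro: restr_closed\<close>)
  qed simp
  then have "\<exists>!t. t \<in> carrier (sections F (\<Union>\<U>)) \<and> (\<forall>U\<in>\<U>. restr F (\<Union>\<U>) U t = s U)"
    by (intro glue op cl)
  then show thesis using that by auto
qed

end

definition flasque :: "'a topology \<Rightarrow> ('a, 'b) sheaf_data \<Rightarrow> bool" where
  "flasque T F \<longleftrightarrow> is_sheaf T F \<and>
     (\<forall>U. openin T U \<longrightarrow> (\<forall>s \<in> carrier (sections F U).
        \<exists>t \<in> carrier (sections F (topspace T)). restr F (topspace T) U t = s))"

lemma flasque_extend: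
  assumes "flasque T F" "openin T U" "openin T V" "U \<subseteq> V" "s \<in> carrier (sections F U)"
  obtains t where "t \<in> carrier (sections F V)" "restr F V U t = s"
proof -
  interpret sheaf T F using assms(1) by unfold_locales (simp add: flasque_def)
  obtain u where u: "u \<in> carrier (sections F (topspace T))" "restr F (topspace T) U u = s"
    using assms(1,2,5) unfolding flasque_def by metis
  have sub: "V \<subseteq> topspace T" using assms(3) by (rule openin_subset)
  show thesis
    by (rule that[of "restr F (topspace T) V u"]) (use u sub assms in \<open>auto simp: restr_closed restr_restr\<close>)
qed

section \<open>Locally constant functions vanishing outside an open set\<close>

text \<open>Local constancy is required on all of \<open>V\<close>, not just on
  \<open>V \<inter> U\<close>, so the support is closed in \<open>V\<close>. This distinguishes
  extension by zero from the direct image.\<close>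

definition loc_sections :: "'a topology \<Rightarrow> 'c monoid \<Rightarrow> 'a set \<Rightarrow> 'a set \<Rightarrow> ('a \<Rightarrow> 'c) set" where
  "loc_sections T A U V = {f \<in> V \<rightarrow>\<^sub>E carrier A.
     (\<forall>x\<in>V. \<exists>W c. openin T W \<and> x \<in> W \<and> W \<subseteq> V \<and> (\<forall>y\<in>W. f y = c)) \<and> (\<forall>x\<in>V - U. f x = \<one>\<^bsub>A\<^esub>)}"

text \<open>The extension by zero to the whole space of the constant sheaf \<open>A\<close> on \<open>U\<close>.\<close>

definition loc_sheaf :: "'a topology \<Rightarrow> 'c monoid \<Rightarrow> 'a set \<Rightarrow> ('a, 'a \<Rightarrow> 'c) sheaf_data" where
  "loc_sheaf T A U =
     \<lparr> sections = (\<lambda>V. \<lparr> carrier = loc_sections T A U V,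
         monoid.mult = (\<lambda>f g. \<lambda>x\<in>V. f x \<otimes>\<^bsub>A\<^esub> g x), one = (\<lambda>x\<in>V. \<one>\<^bsub>A\<^esub>) \<rparr>),
       restr = (\<lambda>V W f. restrict f W) \<rparr>"

lemma loc_sectionsD:
  assumes "f \<in> loc_sections T A U V" "x \<in> V"
  obtains W c where "openin T W" "x \<in> W" "W \<subseteq> V" "\<And>y. y \<in> W \<Longrightarrow> f y = c"
  using assms(1)[unfolded loc_sections_def, simplified, THEN conjunct2, THEN conjunct1, rule_format, OF assms(2)]
  by auto

lemma loc_sections_in_carrier: "\<lbrakk>f \<in> loc_sections T A U V; x \<in> V\<rbrakk> \<Longrightarrow> f x \<in> carrier A"
  and loc_sections_extensional: "f \<in> loc_sections T A U V \<Longrightarrow> f \<in> extensional V"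
  and loc_sections_outside: "\<lbrakk>f \<in> loc_sections T A U V; x \<in> V; x \<notin> U\<rbrakk> \<Longrightarrow> f x = \<one>\<^bsub>A\<^esub>"
  by (auto simp: loc_sections_def PiE_iff)

lemma loc_sectionsI:
  assumes "\<And>x. x \<in> V \<Longrightarrow> \<exists>W c. openin T W \<and> x \<in> W \<and> W \<subseteq> V \<and> (\<forall>y\<in>W. f y = c)"
    and "\<And>x. x \<in> V \<Longrightarrow> f x \<in> carrier A"
    and "\<And>x. \<lbrakk>x \<in> V; x \<notin> U\<rbrakk> \<Longrightarrow> f x = \<one>\<^bsub>A\<^esub>"
  shows "restrict f V \<in> loc_sections T A U V"
proof -
  have "\<exists>W c. openin T W \<and> x \<in> W \<and> W \<subseteq> V \<and> (\<forall>y\<in>W. restrict f V y = c)" if x: "x \<in> V" for x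
  proof -
    obtain W c where "openin T W" "x \<in> W" "W \<subseteq> V" "\<forall>y\<in>W. f y = c"
      using assms(1)[OF x] by blast
    then show ?thesis by (intro exI[of _ W] exI[of _ c]) (simp add: subset_iff)
  qed
  then show ?thesis using assms(2,3) by (simp add: loc_sections_def)
qed

lemma loc_sections_restrict:
  assumes f: "f \<in> loc_sections T A U V" and W: "openin T W" "W \<subseteq> V"
  shows "restrict f W \<in> loc_sections T A U W"
proof (rule loc_sectionsI)
  fix x assume x: "x \<in> W"
  then obtain W' c where "openin T W'" "x \<in> W'" "W' \<subseteq> V" "\<And>y. y \<in> W' \<Longrightarrow> f y = c"
    using loc_sectionsD[OF f] W by (metis subsetD)
  then show "\<exists>W' c. openin T W' \<and> x \<in> W' \<and> W' \<subseteq> W \<and> (\<forall>y\<in>W'. f y = c)"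
    using W x by (intro exI[of _ "W \<inter> W'"] exI[of _ c]) auto
qed (use W loc_sections_in_carrier[OF f] loc_sections_outside[OF f] in auto)

context
  fixes A :: "'c monoid"
  assumes A: "comm_group A"
begin

interpretation A: comm_group A by (rule A)

lemma loc_sections_mult:
  assumes f: "f \<in> loc_sections T A U V" and g: "g \<in> loc_sections T A U V"
  shows "(\<lambda>x\<in>V. f x \<otimes>\<^bsub>A\<^esub> g x) \<in> loc_sections T A U V"
proof (rule loc_sectionsI)
  fix x assume x: "x \<in> V"
  obtain W c where "openin T W" "x \<in> W" "W \<subseteq> V" "\<And>y. y \<in> W \<Longrightarrow> f y = c"
    using loc_sectionsD[OF f x] by metis
  moreover obtain W' c' where "openin T W'" "x \<in> W'" "W' \<subseteq> V" "\<And>y. y \<in> W' \<Longrightarrow> g y = c'"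
    using loc_sectionsD[OF g x] by metis
  ultimately show "\<exists>W c. openin T W \<and> x \<in> W \<and> W \<subseteq> V \<and> (\<forall>y\<in>W. f y \<otimes>\<^bsub>A\<^esub> g y = c)"
    by (intro exI[of _ "W \<inter> W'"] exI[of _ "c \<otimes>\<^bsub>A\<^esub> c'"]) auto
qed (use loc_sections_in_carrier[OF f] loc_sections_in_carrier[OF g]
    loc_sections_outside[OF f] loc_sections_outside[OF g] in simp_all)

lemma loc_sections_inv:
  assumes f: "f \<in> loc_sections T A U V"
  shows "(\<lambda>x\<in>V. inv\<^bsub>A\<^esub> f x) \<in> loc_sections T A U V"
proof (rule loc_sectionsI)
  fix x assume x: "x \<in> V"
  obtain W c where "openin T W" "x \<in> W" "W \<subseteq> V" "\<And>y. y \<in> W \<Longrightarrow> f y = c"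
    using loc_sectionsD[OF f x] by metis
  then show "\<exists>W c. openin T W \<and> x \<in> W \<and> W \<subseteq> V \<and> (\<forall>y\<in>W. inv\<^bsub>A\<^esub> f y = c)"
    by (intro exI[of _ W] exI[of _ "inv\<^bsub>A\<^esub> c"]) auto
qed (use loc_sections_in_carrier[OF f] loc_sections_outside[OF f] in simp_all)

lemma loc_sections_one: "openin T V \<Longrightarrow> (\<lambda>x\<in>V. \<one>\<^bsub>A\<^esub>) \<in> loc_sections T A U V"
  by (rule loc_sectionsI) auto

lemma comm_group_loc_sheaf:
  assumes "openin T V" shows "comm_group (sections (loc_sheaf T A U) V)"
proof (rule comm_groupI)
  fix f assume f: "f \<in> carrier (sections (loc_sheaf T A U) V)"
  then have f': "f \<in> loc_sections T A U V" by (simp add: loc_sheaf_def)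
  show "\<one>\<^bsub>sections (loc_sheaf T A U) V\<^esub> \<otimes>\<^bsub>sections (loc_sheaf T A U) V\<^esub> f = f"
    using loc_sections_extensional[OF f'] loc_sections_in_carrier[OF f']
    by (auto simp: loc_sheaf_def fun_eq_iff extensional_def)
  show "\<exists>g\<in>carrier (sections (loc_sheaf T A U) V).
      g \<otimes>\<^bsub>sections (loc_sheaf T A U) V\<^esub> f = \<one>\<^bsub>sections (loc_sheaf T A U) V\<^esub>"
    using loc_sections_in_carrier[OF f'] loc_sections_inv[OF f']
    by (intro bexI[of _ "\<lambda>x\<in>V. inv\<^bsub>A\<^esub> f x"]) (auto simp: loc_sheaf_def intro!: restrict_ext)
next
  fix f g h
  assume "f \<in> carrier (sections (loc_sheaf T A U) V)" "g \<in> carrier (sections (loc_sheaf T A U) V)"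
  then have f: "f \<in> loc_sections T A U V" and g: "g \<in> loc_sections T A U V" by (simp_all add: loc_sheaf_def)
  show "f \<otimes>\<^bsub>sections (loc_sheaf T A U) V\<^esub> g = g \<otimes>\<^bsub>sections (loc_sheaf T A U) V\<^esub> f"
    using loc_sections_in_carrier[OF f] loc_sections_in_carrier[OF g] A.m_comm
    by (auto simp: loc_sheaf_def intro!: restrict_ext)
  assume "h \<in> carrier (sections (loc_sheaf T A U) V)"
  then have h: "h \<in> loc_sections T A U V" by (simp add: loc_sheaf_def)
  show "f \<otimes>\<^bsub>sections (loc_sheaf T A U) V\<^esub> g \<otimes>\<^bsub>sections (loc_sheaf T A U) V\<^esub> h =
      f \<otimes>\<^bsub>sections (loc_sheaf T A U) V\<^esub> (g \<otimes>\<^bsub>sections (loc_sheaf T A U) V\<^esub> h)"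
    using loc_sections_in_carrier[OF f] loc_sections_in_carrier[OF g] loc_sections_in_carrier[OF h] A.m_assoc
    by (auto simp: loc_sheaf_def intro!: restrict_ext)
qed (use assms in \<open>simp_all add: loc_sheaf_def loc_sections_mult loc_sections_one\<close>)

lemma is_sheaf_loc_sheaf: "is_sheaf T (loc_sheaf T A U)"
proof -
  let ?F = "loc_sheaf T A U"
  have pre: "is_presheaf T ?F"
    unfolding is_presheaf_def
  proof (intro conjI allI impI ballI)
    fix V W assume "openin T V \<and> openin T W \<and> W \<subseteq> V"
    then show "restr ?F V W \<in> hom (sections ?F V) (sections ?F W)"
      by (intro homI) (auto simp: loc_sheaf_def loc_sections_restrict fun_eq_iff)
  next
    fix V s assume "openin T V" "s \<in> carrier (sections ?F V)"
    then show "restr ?F V V s = s"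
      by (simp add: loc_sheaf_def extensional_restrict[OF loc_sections_extensional])
  next
    fix V V' W s assume "openin T V \<and> openin T V' \<and> openin T W \<and> W \<subseteq> V' \<and> V' \<subseteq> V"
      "s \<in> carrier (sections ?F V)"
    then show "restr ?F V' W (restr ?F V V' s) = restr ?F V W s"
      by (auto simp: loc_sheaf_def inf_absorb2)
  qed (rule comm_group_loc_sheaf)
  have glue: "\<exists>!t. t \<in> carrier (sections ?F (\<Union>\<U>)) \<and> (\<forall>V\<in>\<U>. restr ?F (\<Union>\<U>) V t = s V)"
    if op: "\<And>V. V \<in> \<U> \<Longrightarrow> openin T V" and cl': "\<And>V. V \<in> \<U> \<Longrightarrow> s V \<in> carrier (sections ?F V)"
      and eq': "\<And>V W. \<lbrakk>V \<in> \<U>; W \<in> \<U>\<rbrakk> \<Longrightarrow> restr ?F V (V \<inter> W) (s V) = restr ?F W (V \<inter> W) (s W)"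
    for \<U> s
  proof -
    have cl: "\<And>V. V \<in> \<U> \<Longrightarrow> s V \<in> loc_sections T A U V"
      and eq: "\<And>V W. \<lbrakk>V \<in> \<U>; W \<in> \<U>\<rbrakk> \<Longrightarrow> restrict (s V) (V \<inter> W) = restrict (s W) (V \<inter> W)"
      using cl' eq' by (simp_all add: loc_sheaf_def)
    define t where "t = (\<lambda>x\<in>\<Union>\<U>. s (SOME V. V \<in> \<U> \<and> x \<in> V) x)"
    have t: "t x = s V x" if "V \<in> \<U>" "x \<in> V" for V x
    proof -
      define W where "W = (SOME V. V \<in> \<U> \<and> x \<in> V)"
      have "W \<in> \<U> \<and> x \<in> W" unfolding W_def by (rule someI) (use that in auto)
      then show ?thesis using fun_cong[OF eq[of W V], of x] that by (auto simp: t_def W_def)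
    qed
    have "\<exists>W c. openin T W \<and> x \<in> W \<and> W \<subseteq> \<Union>\<U> \<and> (\<forall>y\<in>W. t y = c)" if V: "V \<in> \<U>" "x \<in> V" for x V
    proof -
      obtain W c where "openin T W" "x \<in> W" "W \<subseteq> V" "\<And>y. y \<in> W \<Longrightarrow> s V y = c"
        using loc_sectionsD[OF cl[OF V(1)] V(2)] by metis
      then show ?thesis using t[OF V(1)] V by (intro exI[of _ W] exI[of _ c]) auto
    qed
    moreover have "t x = \<one>\<^bsub>A\<^esub>" if "V \<in> \<U>" "x \<in> V" "x \<notin> U" for x V
      using loc_sections_outside[OF cl[OF that(1)] that(2,3)] t[OF that(1,2)] by simp
    moreover have "t x \<in> carrier A" if "V \<in> \<U>" "x \<in> V" for x V
      using loc_sections_in_carrier[OF cl[OF that(1)] that(2)] t[OF that] by simp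
    ultimately have "restrict t (\<Union>\<U>) \<in> loc_sections T A U (\<Union>\<U>)"
      by (intro loc_sectionsI) blast+
    then have "t \<in> loc_sections T A U (\<Union>\<U>)"
      by (simp add: t_def)
    moreover have "restrict t V = s V" if "V \<in> \<U>" for V
      using t[OF that] loc_sections_extensional[OF cl[OF that]] by (auto simp: fun_eq_iff extensional_def)
    moreover have "u = t"
      if u: "u \<in> loc_sections T A U (\<Union>\<U>)" "\<forall>V\<in>\<U>. restrict u V = s V" for u
    proof
      fix x show "u x = t x"
      proof (cases "x \<in> \<Union>\<U>")
        case True
        then obtain V where V: "V \<in> \<U>" "x \<in> V" by blast
        then have "u x = s V x" using fun_cong[OF u(2)[rule_format, OF V(1)], of x] by simp
        then show ?thesis using t[OF V] by simp
      next
        case False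
        then show ?thesis using loc_sections_extensional[OF u(1)] by (auto simp: t_def extensional_def)
      qed
    qed
    ultimately have "\<exists>!t. t \<in> loc_sections T A U (\<Union>\<U>) \<and> (\<forall>V\<in>\<U>. restrict t V = s V)"
      by metis
    then show ?thesis by (simp only: loc_sheaf_def sheaf_data.simps partial_object.simps)
  qed
  show ?thesis unfolding is_sheaf_def
  proof (intro conjI allI impI)
    fix \<U> s
    assume h: "(\<forall>V\<in>\<U>. openin T V \<and> s V \<in> carrier (sections ?F V)) \<and>
      (\<forall>V\<in>\<U>. \<forall>W\<in>\<U>. restr ?F V (V \<inter> W) (s V) = restr ?F W (V \<inter> W) (s W))"
    show "\<exists>!t. t \<in> carrier (sections ?F (\<Union>\<U>)) \<and> (\<forall>V\<in>\<U>. restr ?F (\<Union>\<U>) V t = s V)"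
      by (rule glue)
        (use h[THEN conjunct1, rule_format] h[THEN conjunct2, rule_format] in simp_all)
  qed (rule pre)
qed

end

section \<open>Injective sheaves are flasque\<close>

text \<open>
  Morphisms from \<open>ext_sheaf T U\<close> to a sheaf \<open>I\<close> correspond to sections of \<open>I\<close> over \<open>U\<close>.
\<close>

abbreviation ext_sections :: "'a topology \<Rightarrow> 'a set \<Rightarrow> 'a set \<Rightarrow> ('a \<Rightarrow> int) set" where
  "ext_sections T \<equiv> loc_sections T integer_group"

abbreviation ext_sheaf :: "'a topology \<Rightarrow> 'a set \<Rightarrow> ('a, 'a \<Rightarrow> int) sheaf_data" where
  "ext_sheaf T \<equiv> loc_sheaf T integer_group"

lemmas ext_sections_add = loc_sections_mult[OF abelian_integer_group, simplified]

context sheaf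
begin

text \<open>The value on the constant \<open>m\<close> over \<open>W\<close> of the morphism that
  sends 1 to \<open>s\<close>. The second branch matters only for \<open>m = 0\<close>: a section
  vanishing off \<open>U\<close> can be a nonzero constant on \<open>W\<close> only if
  \<open>W \<subseteq> U\<close>.\<close>

definition ext_power :: "'a set \<Rightarrow> 'b \<Rightarrow> 'a set \<Rightarrow> int \<Rightarrow> 'b" where
  "ext_power U s W m = (if W \<subseteq> U then restr F U W s [^]\<^bsub>sections F W\<^esub> m else \<one>\<^bsub>sections F W\<^esub>)"

text \<open>The graph of the morphism built in \<open>section_morphism\<close>: \<open>t\<close> is
  locally the power of \<open>s\<close> whose exponent is the local value of \<open>f\<close>. With
  unique existence, additivity and naturality reduce to checking this relation.\<close>

definition ext_rep :: "'a set \<Rightarrow> 'b \<Rightarrow> 'a set \<Rightarrow> ('a \<Rightarrow> int) \<Rightarrow> 'b \<Rightarrow> bool" where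
  "ext_rep U s V f t \<longleftrightarrow> t \<in> carrier (sections F V) \<and>
     (\<forall>x\<in>V. \<exists>W c. openin T W \<and> x \<in> W \<and> W \<subseteq> V \<and> (\<forall>y\<in>W. f y = c) \<and>
        restr F V W t = ext_power U s W c)"

context
  fixes U s
  assumes U: "openin T U" and s: "s \<in> carrier (sections F U)"
begin

lemma ext_power_closed: "openin T W \<Longrightarrow> ext_power U s W m \<in> carrier (sections F W)"
  using U s group.int_pow_closed[OF group_sections] monoid.one_closed[OF group.is_monoid[OF group_sections]]
  by (simp add: ext_power_def restr_closed)

lemma restr_ext_power:
  assumes "openin T W" "openin T W'" "W' \<subseteq> W" "W \<subseteq> U \<or> m = 0"
  shows "restr F W W' (ext_power U s W m) = ext_power U s W' m"
proof (cases "W \<subseteq> U")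
  case True
  then have "W' \<subseteq> U" using assms(3) by blast
  then show ?thesis
    using True assms U s hom_int_pow[OF restr_hom[OF assms(1,2,3)], of "restr F U W s" m]
    by (auto simp: ext_power_def group_sections restr_restr restr_closed)
next
  case False
  then have m: "m = 0" using assms(4) by blast
  show ?thesis unfolding ext_power_def m using assms(1-3) by (simp add: restr_one)
qed

text \<open>If \<open>c\<close> is nonzero, then \<open>f\<close> vanishes nowhere on
  \<open>W\<close>, which forces \<open>W \<subseteq> U\<close>; so only the harmless cases of
  \<open>restr_ext_power\<close> occur.\<close>

lemma restr_ext_power':
  assumes "f \<in> ext_sections T U V" "openin T W" "openin T W'" "W' \<subseteq> W" "W \<subseteq> V"
    "\<And>y. y \<in> W \<Longrightarrow> f y = c"
  shows "restr F W W' (ext_power U s W c) = ext_power U s W' c"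
proof (rule restr_ext_power)
  show "W \<subseteq> U \<or> c = 0"
  proof (rule ccontr)
    assume "\<not> (W \<subseteq> U \<or> c = 0)"
    then obtain x where x: "x \<in> W" "x \<notin> U" "c \<noteq> 0" by blast
    then have "f x = 0" using assms(1,5) by (auto simp: loc_sections_def)
    then show False using assms(6)[OF x(1)] x by simp
  qed
qed (use assms in auto)

text \<open>The witnessing neighbourhood may be shrunk at will, so that two representations at one
  point can be compared on a common neighbourhood.\<close>

lemma ext_rep_shrink:
  assumes "ext_rep U s V f t" "openin T V" "f \<in> ext_sections T U V" "openin T V'" "x \<in> V \<inter> V'"
  obtains W c where "openin T W" "x \<in> W" "W \<subseteq> V \<inter> V'" "\<And>y. y \<in> W \<Longrightarrow> f y = c"
    "\<And>W'. \<lbrakk>openin T W'; W' \<subseteq> W\<rbrakk> \<Longrightarrow> restr F V W' t = ext_power U s W' c"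
proof -
  obtain W c where W: "openin T W" "x \<in> W" "W \<subseteq> V" "\<And>y. y \<in> W \<Longrightarrow> f y = c"
      "restr F V W t = ext_power U s W c"
    using assms(1,5) unfolding ext_rep_def by blast
  have t: "t \<in> carrier (sections F V)" using assms(1) by (simp add: ext_rep_def)
  show thesis
  proof (rule that[of "W \<inter> V'" c])
    fix W' assume W': "openin T W'" "W' \<subseteq> W \<inter> V'"
    then have "restr F V W' t = restr F W W' (restr F V W t)"
      using restr_restr[OF assms(2) W(1) W'(1) _ W(3) t] by simp
    then show "restr F V W' t = ext_power U s W' c"
      using restr_ext_power'[OF assms(3) W(1) W'(1) _ W(3,4)] W' W(5) by simp
  qed (use W assms in auto)
qed

lemma ext_rep_unique:
  assumes V: "openin T V" and f: "f \<in> ext_sections T U V" and t: "ext_rep U s V f t" "ext_rep U s V f t'"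
  shows "t = t'"
proof (rule separated)
  fix x assume x: "x \<in> V"
  obtain W c where W: "openin T W" "x \<in> W" "W \<subseteq> V \<inter> V" "\<And>y. y \<in> W \<Longrightarrow> f y = c"
      "\<And>W'. \<lbrakk>openin T W'; W' \<subseteq> W\<rbrakk> \<Longrightarrow> restr F V W' t = ext_power U s W' c"
    using ext_rep_shrink[OF t(1) V f V] x by (metis Int_iff)
  obtain W1 c1 where W1: "openin T W1" "x \<in> W1" "\<And>y. y \<in> W1 \<Longrightarrow> f y = c1"
      "\<And>W'. \<lbrakk>openin T W'; W' \<subseteq> W1\<rbrakk> \<Longrightarrow> restr F V W' t' = ext_power U s W' c1"
    using ext_rep_shrink[OF t(2) V f V] x by (metis Int_iff)
  have "c = c1" using W(2,4) W1(2,3) by metis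
  then show "\<exists>W. openin T W \<and> x \<in> W \<and> W \<subseteq> V \<and> restr F V W t = restr F V W t'"
    using W(1-3,5) W1(1,2,4) openin_Int[OF W(1) W1(1)] by (intro exI[of _ "W \<inter> W1"]) auto
qed (use assms in \<open>auto simp: ext_rep_def\<close>)

lemma ext_rep_exists:
  assumes V: "openin T V" and f: "f \<in> ext_sections T U V"
  shows "\<exists>t. ext_rep U s V f t"
proof -
  define \<U> where "\<U> = {W. openin T W \<and> W \<subseteq> V \<and> (\<exists>c. \<forall>y\<in>W. f y = c)}"
  \<comment> \<open>On the empty set every exponent qualifies and the chosen one is arbitrary; empty
    overlaps are therefore settled by uniqueness of the section over the empty set.\<close>
  define r where "r W = ext_power U s W (SOME c. \<forall>y\<in>W. f y = c)" for W
  have r: "r W = ext_power U s W c" if "x \<in> W" "\<And>y. y \<in> W \<Longrightarrow> f y = c" for W x c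
  proof -
    have "(SOME c. \<forall>y\<in>W. f y = c) = c" by (rule some_equality) (use that in auto)
    then show ?thesis by (simp add: r_def)
  qed
  have UU: "\<Union>\<U> = V"
  proof -
    have "\<exists>W\<in>\<U>. x \<in> W" if "x \<in> V" for x
    proof -
      obtain W c where "openin T W" "x \<in> W" "W \<subseteq> V" "\<And>y. y \<in> W \<Longrightarrow> f y = c"
        using loc_sectionsD[OF f \<open>x \<in> V\<close>] by metis
      then show ?thesis by (intro bexI[of _ W]) (auto simp: \<U>_def)
    qed
    then show ?thesis by (auto simp: \<U>_def)
  qed
  have "\<exists>!t. t \<in> carrier (sections F (\<Union>\<U>)) \<and> (\<forall>W\<in>\<U>. restr F (\<Union>\<U>) W t = r W)"
  proof (rule glue)
    fix W assume "W \<in> \<U>"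
    then show "openin T W" "r W \<in> carrier (sections F W)"
      by (auto simp: \<U>_def r_def ext_power_closed)
  next
    fix W W' assume W: "W \<in> \<U>" "W' \<in> \<U>"
    then have op: "openin T W" "openin T W'" "W \<subseteq> V" "W' \<subseteq> V" by (auto simp: \<U>_def)
    show "restr F W (W \<inter> W') (r W) = restr F W' (W \<inter> W') (r W')"
    proof (cases "W \<inter> W' = {}")
      case True
      show ?thesis unfolding True
        by (rule empty_section_unique) (use op in \<open>auto simp: r_def intro!: restr_closed ext_power_closed\<close>)
    next
      case False
      then obtain x where x: "x \<in> W" "x \<in> W'" by blast
      obtain c where c: "\<And>y. y \<in> W \<Longrightarrow> f y = c" using W(1) by (auto simp: \<U>_def)
      obtain c' where c': "\<And>y. y \<in> W' \<Longrightarrow> f y = c'" using W(2) by (auto simp: \<U>_def)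
      have "c = c'" using c c' x by metis
      then show ?thesis
        using restr_ext_power'[OF f op(1) _ _ op(3) c, of "W \<inter> W'"]
          restr_ext_power'[OF f op(2) _ _ op(4) c', of "W \<inter> W'"] r[OF x(1) c] r[OF x(2) c'] op openin_Int[OF op(1,2)]
        by auto
    qed
  qed
  then obtain t where t: "t \<in> carrier (sections F V)" "\<And>W. W \<in> \<U> \<Longrightarrow> restr F V W t = r W"
    unfolding UU by blast
  have "ext_rep U s V f t"
    unfolding ext_rep_def
  proof (intro conjI ballI)
    fix x assume "x \<in> V"
    then obtain W c where W: "openin T W" "x \<in> W" "W \<subseteq> V" "\<And>y. y \<in> W \<Longrightarrow> f y = c"
      using loc_sectionsD[OF f] by metis
    then have "W \<in> \<U>" unfolding \<U>_def by blast
    then show "\<exists>W c. openin T W \<and> x \<in> W \<and> W \<subseteq> V \<and> (\<forall>y\<in>W. f y = c) \<and>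
        restr F V W t = ext_power U s W c"
      using W t(2) r[OF W(2,4)] by (intro exI[of _ W] exI[of _ c]) auto
  qed (rule t(1))
  then show ?thesis ..
qed

lemma ext_rep_mult:
  assumes V: "openin T V" and f: "f \<in> ext_sections T U V" and g: "g \<in> ext_sections T U V"
    and t: "ext_rep U s V f t" and u: "ext_rep U s V g u"
  shows "ext_rep U s V (\<lambda>x\<in>V. f x + g x) (t \<otimes>\<^bsub>sections F V\<^esub> u)"
  unfolding ext_rep_def
proof (intro conjI ballI)
  interpret V: comm_group "sections F V" by (rule comm_group_sections[OF V])
  have tu: "t \<in> carrier (sections F V)" "u \<in> carrier (sections F V)"
    using t u by (auto simp: ext_rep_def)
  then show "t \<otimes>\<^bsub>sections F V\<^esub> u \<in> carrier (sections F V)" by simp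
  fix x assume x: "x \<in> V"
  obtain W c where W: "openin T W" "x \<in> W" "W \<subseteq> V \<inter> V" "\<And>y. y \<in> W \<Longrightarrow> f y = c"
      "\<And>W'. \<lbrakk>openin T W'; W' \<subseteq> W\<rbrakk> \<Longrightarrow> restr F V W' t = ext_power U s W' c"
    using ext_rep_shrink[OF t V f V] x by (metis Int_iff)
  obtain W1 c1 where W1: "openin T W1" "x \<in> W1" "\<And>y. y \<in> W1 \<Longrightarrow> g y = c1"
      "\<And>W'. \<lbrakk>openin T W'; W' \<subseteq> W1\<rbrakk> \<Longrightarrow> restr F V W' u = ext_power U s W' c1"
    using ext_rep_shrink[OF u V g V] x by (metis Int_iff)
  let ?W = "W \<inter> W1"
  have op: "openin T ?W" using W W1 by auto
  interpret W: comm_group "sections F ?W" by (rule comm_group_sections[OF op])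
  have "ext_power U s ?W c \<otimes>\<^bsub>sections F ?W\<^esub> ext_power U s ?W c1 = ext_power U s ?W (c + c1)"
    using restr_closed[OF U op _ s] W.int_pow_mult by (simp add: ext_power_def)
  moreover have "restr F V ?W (t \<otimes>\<^bsub>sections F V\<^esub> u) = restr F V ?W t \<otimes>\<^bsub>sections F ?W\<^esub> restr F V ?W u"
    by (rule restr_mult[OF V op _ tu]) (use W in auto)
  ultimately have "restr F V ?W (t \<otimes>\<^bsub>sections F V\<^esub> u) = ext_power U s ?W (c + c1)"
    using W(5)[OF op] W1(4)[OF op] by simp
  then show "\<exists>W c. openin T W \<and> x \<in> W \<and> W \<subseteq> V \<and> (\<forall>y\<in>W. (\<lambda>x\<in>V. f x + g x) y = c) \<and>
      restr F V W (t \<otimes>\<^bsub>sections F V\<^esub> u) = ext_power U s W c"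
    using W(1-4) W1(1-3) by (intro exI[of _ ?W] exI[of _ "c + c1"]) auto
qed

lemma ext_rep_restr:
  assumes V: "openin T V" and f: "f \<in> ext_sections T U V" and t: "ext_rep U s V f t"
    and V': "openin T V'" "V' \<subseteq> V"
  shows "ext_rep U s V' (restrict f V') (restr F V V' t)"
  unfolding ext_rep_def
proof (intro conjI ballI)
  have tc: "t \<in> carrier (sections F V)" using t by (simp add: ext_rep_def)
  then show "restr F V V' t \<in> carrier (sections F V')" using V V' restr_closed by blast
  fix x assume x: "x \<in> V'"
  then have "x \<in> V \<inter> V'" using V' by auto
  then obtain W c where W: "openin T W" "x \<in> W" "W \<subseteq> V \<inter> V'" "\<And>y. y \<in> W \<Longrightarrow> f y = c"
      "\<And>W'. \<lbrakk>openin T W'; W' \<subseteq> W\<rbrakk> \<Longrightarrow> restr F V W' t = ext_power U s W' c"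
    using ext_rep_shrink[OF t V f V'(1)] by metis
  have "restr F V' W (restr F V V' t) = restr F V W t"
    by (rule restr_restr) (use V V' W tc in auto)
  then have "restr F V' W (restr F V V' t) = ext_power U s W c"
    using W by simp
  then show "\<exists>W c. openin T W \<and> x \<in> W \<and> W \<subseteq> V' \<and> (\<forall>y\<in>W. restrict f V' y = c) \<and>
      restr F V' W (restr F V V' t) = ext_power U s W c"
    using W(1-4) by (intro exI[of _ W] exI[of _ c]) auto
qed

lemma section_morphism:
  obtains h where "h \<in> sheaf_hom T (ext_sheaf T U) F" "h U (\<lambda>x\<in>U. 1) = s"
proof -
  define h where "h V f = (THE t. ext_rep U s V f t)" for V f
  have h: "ext_rep U s V f (h V f)" if "openin T V" "f \<in> ext_sections T U V" for V f
    unfolding h_def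
    by (rule theI') (use that ext_rep_exists ext_rep_unique in blast)
  have h_eq: "h V f = t" if "openin T V" "f \<in> ext_sections T U V" "ext_rep U s V f t" for V f t
    using ext_rep_unique[OF that(1,2) h[OF that(1,2)] that(3)] .
  have "h \<in> sheaf_hom T (ext_sheaf T U) F"
    unfolding sheaf_hom_def
  proof (intro CollectI conjI allI impI ballI)
    fix V assume V: "openin T V"
    show "h V \<in> hom (sections (ext_sheaf T U) V) (sections F V)"
      by (rule homI) (use V h in \<open>auto simp: loc_sheaf_def ext_rep_def
          intro!: h_eq ext_sections_add ext_rep_mult\<close>)
  next
    fix V V' f assume "openin T V \<and> openin T V' \<and> V' \<subseteq> V" "f \<in> carrier (sections (ext_sheaf T U) V)"
    then show "h V' (restr (ext_sheaf T U) V V' f) = restr F V V' (h V f)"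
      using h by (auto simp: loc_sheaf_def intro!: h_eq loc_sections_restrict ext_rep_restr)
  qed
  moreover have "h U (\<lambda>x\<in>U. 1) = s"
  proof (rule h_eq[OF U])
    show "(\<lambda>x\<in>U. 1) \<in> ext_sections T U U" using U by (auto simp: loc_sections_def)
    interpret group "sections F U" by (rule group_sections[OF U])
    show "ext_rep U s U (\<lambda>x\<in>U. 1) s" unfolding ext_rep_def
      using U s by (auto simp: ext_power_def restr_id intro!: exI[of _ U])
  qed
  ultimately show thesis using that by blast
qed

end

end

text \<open>A section \<open>s\<close> over \<open>U\<close> is a morphism from
  \<open>ext_sheaf T U\<close>. Extend it along the inclusion into
  \<open>ext_sheaf T (topspace T)\<close>; the image of the global constant 1 is a global section
  restricting to \<open>s\<close>. Both sheaves are integer-valued, hence admissible test objects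
  for \<open>injective_sheaf\<close>.\<close>

lemma injective_imp_flasque:
  assumes "injective_sheaf T I"
  shows "flasque T I"
proof -
  interpret sheaf T I using assms by unfold_locales (simp add: injective_sheaf_def)
  have "\<exists>t \<in> carrier (sections I (topspace T)). restr I (topspace T) U t = s"
    if U: "openin T U" and s: "s \<in> carrier (sections I U)" for U s
  proof -
    let ?X = "topspace T" and ?F = "ext_sheaf T U" and ?G = "ext_sheaf T (topspace T)"
    obtain f where f: "f \<in> sheaf_hom T ?F I" "f U (\<lambda>x\<in>U. 1) = s"
      using section_morphism[OF U s] by metis
    define \<iota> :: "'a set \<Rightarrow> ('a \<Rightarrow> int) \<Rightarrow> 'a \<Rightarrow> int" where "\<iota> V f = f" for V f
    have "ext_sections T U V \<subseteq> ext_sections T ?X V" if "openin T V" for V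
      using openin_subset[OF that] by (auto simp: loc_sections_def)
    then have "\<iota> \<in> sheaf_mono T ?F ?G"
      unfolding sheaf_mono_def sheaf_hom_def \<iota>_def
      by (auto simp: hom_def loc_sheaf_def)
    then obtain g where g: "g \<in> sheaf_hom T ?G I"
        "\<And>V t. \<lbrakk>openin T V; t \<in> carrier (sections ?F V)\<rbrakk> \<Longrightarrow> g V (\<iota> V t) = f V t"
      using assms f(1) is_sheaf_loc_sheaf[OF abelian_integer_group] unfolding injective_sheaf_def by metis
    have one: "(\<lambda>x\<in>V. 1) \<in> ext_sections T V' V" if "openin T V" "V \<subseteq> V'" for V V'
      using that by (auto simp: loc_sections_def)
    have "g U (restrict (\<lambda>x\<in>?X. 1) U) = restr I ?X U (g ?X (\<lambda>x\<in>?X. 1))"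
      using g(1)[unfolded sheaf_hom_def, simplified, THEN conjunct2, rule_format, of ?X U "\<lambda>x\<in>?X. 1"]
        one[of ?X ?X] U openin_subset[OF U] by (simp add: loc_sheaf_def)
    moreover have "restrict (\<lambda>x\<in>?X. 1) U = (\<lambda>x\<in>U. 1 :: int)"
      using openin_subset[OF U] by (auto simp: fun_eq_iff)
    moreover have "g U (\<lambda>x\<in>U. 1) = s"
      using g(2)[OF U, of "\<lambda>x\<in>U. 1"] f(2) one[OF U] by (simp add: \<iota>_def loc_sheaf_def)
    moreover have "g ?X (\<lambda>x\<in>?X. 1) \<in> carrier (sections I ?X)"
      using g(1) one[of ?X ?X] by (auto simp: sheaf_hom_def hom_def loc_sheaf_def)
    ultimately show ?thesis by metis
  qed
  then show ?thesis using is_sheaf by (auto simp: flasque_def)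
qed

section \<open>The alternating Cech complex of a finite cover\<close>

text \<open>The base set \<open>W\<close> is kept as a parameter because the recursion of the
  differential replaces it by \<open>W \<inter> D m\<close>. The empty index set yields
  \<open>W\<close> itself, which builds the augmentation into the complex.\<close>

definition overlap :: "(nat \<Rightarrow> 'a set) \<Rightarrow> 'a set \<Rightarrow> nat set \<Rightarrow> 'a set" where
  "overlap D W A = W \<inter> (\<Inter>i\<in>A. D i)"

text \<open>
  The Cech complex for \<open>D 0, \<dots>, D m\<close> over \<open>W\<close> is the mapping cone of the restriction from the
  complex for \<open>D 0, \<dots>, D (m - 1)\<close> over \<open>W\<close> to the one over \<open>W \<inter> D m\<close>. Defining the differential
  by this recursion avoids explicit signs.
\<close>

fun cech_diff ::
  "('a, 'b) sheaf_data \<Rightarrow> (nat \<Rightarrow> 'a set) \<Rightarrow> nat \<Rightarrow> 'a set \<Rightarrow> (nat set \<Rightarrow> 'b) \<Rightarrow> nat set \<Rightarrow> 'b" where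
  "cech_diff F D 0 W a A = \<one>\<^bsub>sections F W\<^esub>"
| "cech_diff F D (Suc m) W a A =
     (if m \<in> A then
        restr F (overlap D W (A - {m})) (overlap D W A) (a (A - {m})) \<otimes>\<^bsub>sections F (overlap D W A)\<^esub>
        inv\<^bsub>sections F (overlap D W A)\<^esub>
          (cech_diff F D m (W \<inter> D m) (\<lambda>B. a (insert m B)) (A - {m}))
      else cech_diff F D m W a A)"

declare cech_diff.simps(2) [simp del]

lemma overlap_empty [simp]: "overlap D W {} = W"
  by (simp add: overlap_def)

lemma overlap_insert: "overlap D W (insert m B) = overlap D (W \<inter> D m) B"
  by (auto simp: overlap_def)

lemma overlap_mono: "\<lbrakk>V \<subseteq> W; B \<subseteq> A\<rbrakk> \<Longrightarrow> overlap D V A \<subseteq> overlap D W B"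
  by (auto simp: overlap_def)

lemma openin_overlap:
  assumes "\<And>i. openin T (D i)" "openin T W" "finite A"
  shows "openin T (overlap D W A)"
  using assms(3,2)
  by (induction A arbitrary: W) (auto simp: overlap_insert intro!: openin_Int assms(1))

lemma subset_lessThan_Suc_cases:
  fixes A :: "nat set"
  assumes "A \<subseteq> {..<Suc m}"
  obtains (sub) "A \<subseteq> {..<m}" | (ins) B where "B \<subseteq> {..<m}" "A = insert m B"
proof (cases "m \<in> A")
  case True
  show thesis by (rule ins[of "A - {m}"]) (use assms True in \<open>auto simp: less_Suc_eq\<close>)
next
  case False
  then show thesis using assms by (intro sub) (auto simp: less_Suc_eq)
qed

lemma cech_diff_sub: "A \<subseteq> {..<m} \<Longrightarrow> cech_diff F D (Suc m) W a A = cech_diff F D m W a A"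
  by (auto simp: cech_diff.simps(2))

lemma index_set_induct [consumes 1, case_names zero sub ins]:
  assumes "A \<subseteq> {..<m :: nat}" and "P 0 {}"
    and "\<And>m A. \<lbrakk>A \<subseteq> {..<m}; P m A\<rbrakk> \<Longrightarrow> P (Suc m) A"
    and "\<And>m B. \<lbrakk>B \<subseteq> {..<m}; P m B\<rbrakk> \<Longrightarrow> P (Suc m) (insert m B)"
  shows "P m A"
  using assms(1)
proof (induction m arbitrary: A)
  case 0
  then show ?case using assms(2) by simp
next
  case (Suc m)
  from Suc.prems show ?case
    by (cases rule: subset_lessThan_Suc_cases) (use Suc.IH assms(3,4) in auto)
qed

lemma cech_diff_insert:
  assumes "B \<subseteq> {..<m}"
  shows "cech_diff F D (Suc m) W a (insert m B) =
    restr F (overlap D W B) (overlap D (W \<inter> D m) B) (a B) \<otimes>\<^bsub>sections F (overlap D (W \<inter> D m) B)\<^esub>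
    inv\<^bsub>sections F (overlap D (W \<inter> D m) B)\<^esub> (cech_diff F D m (W \<inter> D m) (\<lambda>C. a (insert m C)) B)"
proof -
  have "insert m B - {m} = B" using assms by auto
  then show ?thesis by (simp add: cech_diff.simps(2) overlap_insert)
qed

text \<open>Only the faces of \<open>A\<close> enter the recursion. This is what allows a cochain of
  one degree to be padded arbitrarily in the others.\<close>

lemma cech_diff_cong:
  assumes "A \<subseteq> {..<m}" "\<And>i. i \<in> A \<Longrightarrow> a (A - {i}) = b (A - {i})"
  shows "cech_diff F D m W a A = cech_diff F D m W b A"
  using assms
proof (induction m arbitrary: W a b A)
  case (Suc m)
  from Suc.prems(1) show ?case
  proof (cases rule: subset_lessThan_Suc_cases)
    case sub
    show ?thesis unfolding cech_diff_sub[OF sub] by (rule Suc.IH[OF sub]) (rule Suc.prems(2))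
  next
    case (ins B)
    have "insert m B - {m} = B" using ins(1) by auto
    then have aB: "a B = b B" using Suc.prems(2)[of m, unfolded ins(2)] by simp
    have "cech_diff F D m (W \<inter> D m) (\<lambda>C. a (insert m C)) B =
        cech_diff F D m (W \<inter> D m) (\<lambda>C. b (insert m C)) B"
    proof (rule Suc.IH[OF ins(1)])
      fix i assume i: "i \<in> B"
      then have "insert m B - {i} = insert m (B - {i})" using ins(1) by auto
      then show "a (insert m (B - {i})) = b (insert m (B - {i}))"
        using Suc.prems(2)[of i, unfolded ins(2)] i by simp
    qed
    then show ?thesis
      unfolding ins(2) cech_diff_insert[OF ins(1)] aB by simp
  qed
qed simp

lemma cech_diff_empty [simp]: "cech_diff F D m W a {} = \<one>\<^bsub>sections F W\<^esub>"
  by (induction m) (auto simp: cech_diff.simps(2))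

locale presheaf_cover = presheaf T F for T :: "'a topology" and F :: "('a, 'b) sheaf_data" +
  fixes D :: "nat \<Rightarrow> 'a set"
  assumes open_cover: "openin T (D i)"
begin

abbreviation ov :: "'a set \<Rightarrow> nat set \<Rightarrow> 'a set" where
  "ov \<equiv> overlap D"

text \<open>All degrees are carried at once, so inductions along the recursion of
  \<open>cech_diff\<close> need not track how \<open>insert m\<close> shifts the degree.\<close>

definition cochain :: "'a set \<Rightarrow> nat set \<Rightarrow> (nat set \<Rightarrow> 'b) \<Rightarrow> bool" where
  "cochain W A a \<longleftrightarrow> (\<forall>B. B \<subseteq> A \<longrightarrow> a B \<in> carrier (sections F (ov W B)))"

lemma open_ov: "\<lbrakk>openin T W; A \<subseteq> {..<m}\<rbrakk> \<Longrightarrow> openin T (ov W A)"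
  using open_cover by (intro openin_overlap) (auto intro: finite_subset)

lemma cochainD: "\<lbrakk>cochain W A a; B \<subseteq> A\<rbrakk> \<Longrightarrow> a B \<in> carrier (sections F (ov W B))"
  by (simp add: cochain_def)

lemma cochain_mono: "\<lbrakk>cochain W A a; B \<subseteq> A\<rbrakk> \<Longrightarrow> cochain W B a"
  unfolding cochain_def by blast

lemma cochain_insert:
  "cochain W (insert m B) a \<Longrightarrow> cochain W B a \<and> cochain (W \<inter> D m) B (\<lambda>C. a (insert m C))"
  unfolding cochain_def by (metis insert_mono overlap_insert subset_insertI2)

lemma open_Int_cover: "openin T W \<Longrightarrow> openin T (W \<inter> D m)"
  using open_cover by blast

lemma cech_diff_closed:
  assumes "openin T W" "A \<subseteq> {..<m}" "cochain W A a"
  shows "cech_diff F D m W a A \<in> carrier (sections F (ov W A))"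
  using assms(2,1,3)
proof (induction arbitrary: W a rule: index_set_induct)
  case zero
  then show ?case by (simp add: group.is_monoid group_sections monoid.one_closed)
next
  case (sub m A)
  then show ?case by (simp add: cech_diff_sub)
next
  case (ins m B)
  have c: "cochain W B a" "cochain (W \<inter> D m) B (\<lambda>C. a (insert m C))"
    using cochain_insert ins.prems(2) by blast+
  have op: "openin T (ov W B)" "openin T (ov (W \<inter> D m) B)"
    using open_ov[OF _ ins.hyps] ins.prems(1) open_Int_cover by auto
  interpret G: group "sections F (ov (W \<inter> D m) B)" by (rule group_sections[OF op(2)])
  show ?case
    unfolding cech_diff_insert[OF ins.hyps] overlap_insert
    by (intro G.m_closed G.inv_closed ins.IH restr_closed op c ins.hyps open_Int_cover ins.prems
      cochainD[OF c(1)] overlap_mono) auto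
qed

lemma cech_diff_mult:
  assumes "openin T W" "A \<subseteq> {..<m}" "cochain W A a" "cochain W A b"
  shows "cech_diff F D m W (\<lambda>B. a B \<otimes>\<^bsub>sections F (ov W B)\<^esub> b B) A =
    cech_diff F D m W a A \<otimes>\<^bsub>sections F (ov W A)\<^esub> cech_diff F D m W b A"
  using assms(2,1,3,4)
proof (induction arbitrary: W a b rule: index_set_induct)
  case zero
  then show ?case by (simp add: group.is_monoid group_sections monoid.one_closed)
next
  case (sub m A)
  then show ?case by (simp add: cech_diff_sub)
next
  case (ins m B)
  have c: "cochain W B a" "cochain (W \<inter> D m) B (\<lambda>C. a (insert m C))"
      "cochain W B b" "cochain (W \<inter> D m) B (\<lambda>C. b (insert m C))"
    using cochain_insert ins.prems(2,3) by blast+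
  have op: "openin T (ov W B)" "openin T (ov (W \<inter> D m) B)" "openin T (W \<inter> D m)"
    using open_ov[OF _ ins.hyps] ins.prems(1) open_Int_cover by auto
  have sub: "ov (W \<inter> D m) B \<subseteq> ov W B" by (rule overlap_mono) auto
  interpret G: comm_group "sections F (ov (W \<inter> D m) B)" by (rule comm_group_sections[OF op(2)])
  have ab: "a B \<in> carrier (sections F (ov W B))" "b B \<in> carrier (sections F (ov W B))"
    using c cochainD by auto
  have IH: "cech_diff F D m (W \<inter> D m) (\<lambda>C. a (insert m C) \<otimes>\<^bsub>sections F (ov W (insert m C))\<^esub> b (insert m C)) B
    = cech_diff F D m (W \<inter> D m) (\<lambda>C. a (insert m C)) B \<otimes>\<^bsub>sections F (ov (W \<inter> D m) B)\<^esub>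
      cech_diff F D m (W \<inter> D m) (\<lambda>C. b (insert m C)) B"
    unfolding overlap_insert by (rule ins.IH[OF op(3) c(2,4)])
  show ?case
    unfolding cech_diff_insert[OF ins.hyps] IH
    unfolding overlap_insert
    using cech_diff_closed[OF op(3) ins.hyps c(2)] cech_diff_closed[OF op(3) ins.hyps c(4)]
      restr_closed[OF op(1,2) sub ab(1)] restr_closed[OF op(1,2) sub ab(2)]
    by (simp add: restr_mult[OF op(1,2) sub ab] G.inv_mult G.m_ac)
qed

lemma cech_diff_one:
  assumes "openin T W" "A \<subseteq> {..<m}"
  shows "cech_diff F D m W (\<lambda>B. \<one>\<^bsub>sections F (ov W B)\<^esub>) A = \<one>\<^bsub>sections F (ov W A)\<^esub>"
  using assms(2,1)
proof (induction arbitrary: W rule: index_set_induct)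
  case (sub m A)
  then show ?case by (simp add: cech_diff_sub)
next
  case (ins m B)
  have op: "openin T (ov W B)" "openin T (ov (W \<inter> D m) B)" "openin T (W \<inter> D m)"
    using open_ov[OF _ ins.hyps] ins.prems(1) open_Int_cover by auto
  have sub: "ov (W \<inter> D m) B \<subseteq> ov W B" by (rule overlap_mono) auto
  interpret G: comm_group "sections F (ov (W \<inter> D m) B)" by (rule comm_group_sections[OF op(2)])
  show ?case
    unfolding cech_diff_insert[OF ins.hyps] overlap_insert
    by (simp add: ins.IH[OF op(3)] restr_one[OF op(1,2) sub])
qed simp

text \<open>Multiply the quotient by \<open>b\<close> again: the product equals \<open>a\<close> on
  all faces of \<open>A\<close>, so \<open>cech_diff_mult\<close> and \<open>cech_diff_cong\<close>
  determine its differential.\<close>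

lemma cech_diff_div:
  assumes "openin T W" "A \<subseteq> {..<m}" "cochain W A a" "cochain W A b"
  shows "cech_diff F D m W (\<lambda>B. a B \<otimes>\<^bsub>sections F (ov W B)\<^esub> inv\<^bsub>sections F (ov W B)\<^esub> b B) A =
    cech_diff F D m W a A \<otimes>\<^bsub>sections F (ov W A)\<^esub>
    inv\<^bsub>sections F (ov W A)\<^esub> cech_diff F D m W b A" (is "cech_diff F D m W ?q A = _")
proof -
  interpret G: group "sections F (ov W A)" by (rule group_sections[OF open_ov[OF assms(1,2)]])
  have g: "group (sections F (ov W B))" if "B \<subseteq> A" for B
    using group_sections[OF open_ov[OF assms(1)]] that assms(2) by blast
  have q: "cochain W A ?q"
    unfolding cochain_def using g cochainD[OF assms(3)] cochainD[OF assms(4)]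
    by (simp add: group.is_monoid group.inv_closed monoid.m_closed)
  have "cech_diff F D m W ?q A \<otimes>\<^bsub>sections F (ov W A)\<^esub> cech_diff F D m W b A =
      cech_diff F D m W (\<lambda>B. ?q B \<otimes>\<^bsub>sections F (ov W B)\<^esub> b B) A"
    using cech_diff_mult[OF assms(1,2) q assms(4)] by simp
  also have "\<dots> = cech_diff F D m W a A"
  proof (rule cech_diff_cong[OF assms(2)])
    fix i assume "i \<in> A"
    then have "A - {i} \<subseteq> A" by blast
    then show "?q (A - {i}) \<otimes>\<^bsub>sections F (ov W (A - {i}))\<^esub> b (A - {i}) = a (A - {i})"
      using g[of "A - {i}"] cochainD[OF assms(3)] cochainD[OF assms(4)]
      by (simp add: group.is_monoid group.inv_closed group.l_inv monoid.m_assoc monoid.r_one)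
  qed
  finally show ?thesis
    using cech_diff_closed[OF assms(1,2)] assms(3,4) q by (simp add: G.inv_solve_right)
qed

lemma cech_diff_restr:
  assumes "openin T W" "openin T V" "V \<subseteq> W" "A \<subseteq> {..<m}" "cochain W A a"
  shows "cech_diff F D m V (\<lambda>B. restr F (ov W B) (ov V B) (a B)) A =
    restr F (ov W A) (ov V A) (cech_diff F D m W a A)"
  using assms(4,1,2,3,5)
proof (induction arbitrary: V W a rule: index_set_induct)
  case zero
  then show ?case by (simp add: restr_one)
next
  case (sub m A)
  then show ?case by (simp add: cech_diff_sub)
next
  case (ins m B)
  have c: "cochain W B a" "cochain (W \<inter> D m) B (\<lambda>C. a (insert m C))"
    using ins.prems(4) ins(2) cochain_insert by auto
  have op: "openin T (W \<inter> D m)" "openin T (V \<inter> D m)" "V \<inter> D m \<subseteq> W \<inter> D m"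
    using ins.prems(1,2,3) open_Int_cover by auto
  have o: "openin T (ov W B)" "openin T (ov (W \<inter> D m) B)" "openin T (ov V B)" "openin T (ov (V \<inter> D m) B)"
    using open_ov[OF _ ins.hyps] op ins.prems(1,2) by auto
  have sub: "ov (W \<inter> D m) B \<subseteq> ov W B" "ov (V \<inter> D m) B \<subseteq> ov V B" "ov V B \<subseteq> ov W B"
      "ov (V \<inter> D m) B \<subseteq> ov (W \<inter> D m) B"
    using ins.prems(3) op(3) by (simp_all add: overlap_mono)
  have aB: "a B \<in> carrier (sections F (ov W B))" using cochainD[OF c(1)] by blast
  have IH: "cech_diff F D m (V \<inter> D m) (\<lambda>C. restr F (ov W (insert m C)) (ov V (insert m C)) (a (insert m C))) B
    = restr F (ov (W \<inter> D m) B) (ov (V \<inter> D m) B) (cech_diff F D m (W \<inter> D m) (\<lambda>C. a (insert m C)) B)"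
    unfolding overlap_insert by (rule ins.IH[OF op c(2)])
  have cl: "cech_diff F D m (W \<inter> D m) (\<lambda>C. a (insert m C)) B \<in> carrier (sections F (ov (W \<inter> D m) B))"
    by (rule cech_diff_closed[OF op(1) ins.hyps c(2)])
  interpret G: group "sections F (ov (W \<inter> D m) B)" by (rule group_sections[OF o(2)])
  show ?case
    unfolding cech_diff_insert[OF ins.hyps] IH
    unfolding overlap_insert
    using cl restr_closed[OF o(1,2) sub(1) aB]
    by (simp add: restr_mult[OF o(2,4) sub(4)] restr_inv[OF o(2,4) sub(4)]
        restr_restr[OF o(1,3,4) sub(2,3) aB] restr_restr[OF o(1,2,4) sub(4,1) aB])
qed

text \<open>The mapping cone computation: over \<open>insert m B\<close> the inner differential is
  the restriction of \<open>a\<close> minus the differential of the part containing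
  \<open>m\<close>. Applying the differential again kills the second term by induction, and the
  first cancels against the restricted differential of \<open>a\<close>.\<close>

lemma cech_diff_cech_diff:
  assumes "openin T W" "A \<subseteq> {..<m}" "cochain W A a"
  shows "cech_diff F D m W (cech_diff F D m W a) A = \<one>\<^bsub>sections F (ov W A)\<^esub>"
  using assms(2,1,3)
proof (induction arbitrary: W a rule: index_set_induct)
  case (sub m A)
  have "cech_diff F D m W (cech_diff F D (Suc m) W a) A = cech_diff F D m W (cech_diff F D m W a) A"
    by (rule cech_diff_cong[OF sub.hyps], rule cech_diff_sub) (use sub.hyps in auto)
  then show ?case using sub by (simp add: cech_diff_sub)
next
  case (ins m B)
  let ?V = "W \<inter> D m"
  have c: "cochain W B a" "cochain ?V B (\<lambda>C. a (insert m C))"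
    using cochain_insert ins.prems(2) by blast+
  have op: "openin T (ov W B)" "openin T (ov ?V B)" "openin T ?V" "?V \<subseteq> W"
    using open_ov[OF _ ins.hyps] ins.prems(1) open_Int_cover by auto
  interpret G: group "sections F (ov ?V B)" by (rule group_sections[OF op(2)])
  have cr: "cochain ?V B (\<lambda>C. restr F (ov W C) (ov ?V C) (a C))"
    unfolding cochain_def
    using cochainD[OF c(1)] open_ov[OF ins.prems(1)] open_ov[OF op(3)] ins.hyps
    by (meson restr_closed overlap_mono op(4) order_refl subset_trans)
  have cd: "cochain ?V B (cech_diff F D m ?V (\<lambda>C. a (insert m C)))"
    unfolding cochain_def
    using cech_diff_closed[OF op(3)] ins.hyps cochain_mono[OF c(2)] by (meson subset_trans)
  have "cech_diff F D m ?V (\<lambda>C. cech_diff F D (Suc m) W a (insert m C)) B =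
      cech_diff F D m ?V (\<lambda>C. restr F (ov W C) (ov ?V C) (a C) \<otimes>\<^bsub>sections F (ov ?V C)\<^esub>
        inv\<^bsub>sections F (ov ?V C)\<^esub> (cech_diff F D m ?V (\<lambda>C. a (insert m C)) C)) B"
    by (rule cech_diff_cong[OF ins.hyps], rule cech_diff_insert) (use ins.hyps in auto)
  also have "\<dots> = restr F (ov W B) (ov ?V B) (cech_diff F D m W a B)"
    using cech_diff_closed[OF ins.prems(1) ins.hyps c(1)] restr_closed[OF op(1,2)] overlap_mono[OF op(4)]
    by (simp add: cech_diff_div[OF op(3) ins.hyps cr cd] ins.IH[OF op(3) c(2)]
      cech_diff_restr[OF ins.prems(1) op(3,4) ins.hyps c(1)])
  finally show ?case
    unfolding cech_diff_insert[OF ins.hyps]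
    using cech_diff_closed[OF ins.prems(1) ins.hyps c(1)] restr_closed[OF op(1,2)] overlap_mono[OF op(4)]
    by (simp add: cech_diff_sub[OF ins.hyps] overlap_insert G.r_inv)
qed simp

end

lemma cech_diff_natural:
  assumes F: "presheaf_cover T F D" and G: "presheaf_cover T G D" and h: "h \<in> sheaf_hom T F G"
  shows "\<lbrakk>openin T W; A \<subseteq> {..<m}; presheaf_cover.cochain F D W A a\<rbrakk> \<Longrightarrow>
    cech_diff G D m W (\<lambda>B. h (overlap D W B) (a B)) A = h (overlap D W A) (cech_diff F D m W a A)"
proof (induction m arbitrary: W a A)
  interpret F: presheaf_cover T F D by (rule F)
  interpret G: presheaf_cover T G D by (rule G)
  have h_hom: "h U \<in> hom (sections F U) (sections G U)" if "openin T U" for U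
    using h that by (simp add: sheaf_hom_def)
  have h_nat: "h V (restr F U V s) = restr G U V (h U s)"
    if "openin T U" "openin T V" "V \<subseteq> U" "s \<in> carrier (sections F U)" for U V s
    using h that by (simp add: sheaf_hom_def)
  {
    case 0
    then show ?case
      using h_hom[of W] F.group_sections[of W] G.group_sections[of W] by (simp add: hom_one)
  next
    case (Suc m)
    from Suc.prems(2) show ?case
    proof (cases rule: subset_lessThan_Suc_cases)
      case sub
      then show ?thesis using Suc by (simp only: cech_diff_sub)
    next
      case (ins B)
      let ?V = "W \<inter> D m"
      have c: "F.cochain W B a" "F.cochain ?V B (\<lambda>C. a (insert m C))"
        using Suc.prems(3) ins(2) F.cochain_insert by auto
      have op: "openin T (overlap D W B)" "openin T (overlap D ?V B)" "openin T ?V"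
        using F.open_ov[OF _ ins(1)] Suc.prems(1) F.open_Int_cover by auto
      have sub: "overlap D ?V B \<subseteq> overlap D W B" by (rule overlap_mono) auto
      interpret h: group_hom "sections F (overlap D ?V B)" "sections G (overlap D ?V B)" "h (overlap D ?V B)"
        by (simp add: group_hom_def group_hom_axioms_def F.group_sections G.group_sections h_hom op)
      have aB: "a B \<in> carrier (sections F (overlap D W B))" using F.cochainD[OF c(1)] by blast
      have IH: "cech_diff G D m ?V (\<lambda>C. h (overlap D W (insert m C)) (a (insert m C))) B
        = h (overlap D ?V B) (cech_diff F D m ?V (\<lambda>C. a (insert m C)) B)"
        unfolding overlap_insert by (rule Suc.IH[OF op(3) ins(1) c(2)])
      show ?thesis
        unfolding ins(2) cech_diff_insert[OF ins(1)] IH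
        unfolding overlap_insert
        using F.cech_diff_closed[OF op(3) ins(1) c(2)] F.restr_closed[OF op(1,2) sub aB]
        by (simp add: h_nat[OF op(1,2) sub aB])
    qed
  }
qed

text \<open>
  Exactness by induction on the number of covering sets: restricting to the part \<open>V\<close> of \<open>W\<close> that is
  covered by the first \<open>m\<close> sets changes a cochain only at the empty index set, where the values
  are recovered by gluing along \<open>W = V \<union> W \<inter> D m\<close> and by extending from \<open>V \<inter> D m\<close> to \<open>W \<inter> D m\<close>.
\<close>

lemma (in presheaf_cover) cech_exact:
  assumes fl: "flasque T F"
  shows "\<lbrakk>openin T W; W \<subseteq> (\<Union>i<m. D i); cochain W {..<m} a;
      \<And>A. A \<subseteq> {..<m} \<Longrightarrow> cech_diff F D m W a A = \<one>\<^bsub>sections F (ov W A)\<^esub>\<rbrakk> \<Longrightarrow>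
    \<exists>b. cochain W {..<m} b \<and> (\<forall>A\<subseteq>{..<m}. cech_diff F D m W b A = a A)"
proof (induction m arbitrary: W a)
  interpret sheaf T F using fl by unfold_locales (simp add: flasque_def)
  {
    case 0
    have "\<one>\<^bsub>sections F W\<^esub> = a {}"
      using 0 cochainD[OF 0(3), of "{}"] monoid.one_closed[OF group.is_monoid[OF group_sections]]
      by (intro empty_section_unique) auto
    then show ?case using 0 by (intro exI[of _ a]) simp
  next
    case (Suc m)
    define U where "U = (\<Union>i<m. D i)"
    define V where "V = W \<inter> U"
    define W' where "W' = W \<inter> D m"
    define V' where "V' = V \<inter> D m"
    have opW: "openin T W" by (rule Suc.prems)
    have opU: "openin T U" unfolding U_def using open_cover by blast
    have op: "openin T V" "openin T W'" "openin T V'"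
      using opW opU open_cover by (auto simp: V_def W'_def V'_def intro!: openin_Int)
    have sub: "V \<subseteq> W" "W' \<subseteq> W" "V' \<subseteq> V" "V' \<subseteq> W'" by (auto simp: V_def W'_def V'_def)
    have WVW: "V \<union> W' = W" "V \<inter> W' = V'"
      using Suc.prems(2) by (auto simp: V_def W'_def V'_def U_def lessThan_Suc)
    \<comment> \<open>A nonempty \<open>B\<close> already confines the overlap to the sets covered
      by \<open>U\<close>, so passing from \<open>W\<close> to \<open>V\<close> loses information
      only at the empty index set.\<close>
    have ov_eq: "ov V B = ov W B" "ov V' B = ov W' B" if "B \<noteq> {}" "B \<subseteq> {..<m}" for B
      using that by (auto simp: overlap_def V_def W'_def V'_def U_def)
    define a' where "a' B = a (insert m B)" for B
    have ca: "cochain W {..<m} a" "cochain W' {..<m} a'"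
      using cochain_insert[of W m "{..<m}" a] Suc.prems(3)
      by (auto simp: lessThan_Suc W'_def a'_def[abs_def])
    have aW: "a B \<in> carrier (sections F (ov W B))" "a' B \<in> carrier (sections F (ov W' B))"
      if "B \<subseteq> {..<m}" for B
      using that ca cochainD by auto
    have cyc: "cech_diff F D m W a B = \<one>\<^bsub>sections F (ov W B)\<^esub>" if "B \<subseteq> {..<m}" for B
      using Suc.prems(4)[of B] that cech_diff_sub[OF that, of F D W a] by fastforce
    \<comment> \<open>The components of the cocycle condition at \<open>insert m B\<close>, solved
      for the restriction of \<open>a\<close>.\<close>
    have cyc': "restr F (ov W B) (ov W' B) (a B) = cech_diff F D m W' a' B" if "B \<subseteq> {..<m}" for B
    proof -
      interpret G: group "sections F (ov W' B)" by (rule group_sections[OF open_ov[OF op(2) that]])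
      have "insert m B \<subseteq> {..<Suc m}" using that by auto
      from Suc.prems(4)[OF this] show ?thesis
        unfolding cech_diff_insert[OF that] overlap_insert a'_def[abs_def] W'_def[symmetric]
        using restr_closed[OF open_ov[OF opW that] open_ov[OF op(2) that] overlap_mono[OF sub(2)] aW(1)[OF that]]
          cech_diff_closed[OF op(2) that cochain_mono[OF ca(2) that]]
        by (simp add: G.inv_solve_right' a'_def[abs_def])
    qed
    define r where "r B = restr F (ov W B) (ov V B) (a B)" for B
    have cr: "cochain V {..<m} r"
      unfolding cochain_def r_def
      by (intro allI impI restr_closed open_ov[OF opW] open_ov[OF op(1)] overlap_mono[OF sub(1)] aW order_refl)
    have "cech_diff F D m V r A = \<one>\<^bsub>sections F (ov V A)\<^esub>" if "A \<subseteq> {..<m}" for A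
      unfolding r_def
      using cech_diff_restr[OF opW op(1) sub(1) that cochain_mono[OF ca(1) that]] cyc[OF that]
        restr_one[OF open_ov[OF opW that] open_ov[OF op(1) that] overlap_mono[OF sub(1)]] by simp
    then obtain b where b: "cochain V {..<m} b" "\<And>A. A \<subseteq> {..<m} \<Longrightarrow> cech_diff F D m V b A = r A"
      using Suc.IH[OF op(1) _ cr] by (auto simp: V_def U_def)
    have bV: "b B \<in> carrier (sections F (ov V B))" if "B \<subseteq> {..<m}" for B
      using cochainD[OF b(1) that] .
    define e1 where "e1 B = restr F (ov V B) (ov V' B) (b B)" for B
    define e2 where "e2 B = restr F (ov W' B) (ov V' B) (a' B)" for B
    \<comment> \<open>Both \<open>b\<close> and \<open>a'\<close> have the restriction of
      \<open>a\<close> as differential over \<open>V'\<close>, so their quotient is a cocycle there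
      and the induction hypothesis applies once more.\<close>
    define e where "e B = e1 B \<otimes>\<^bsub>sections F (ov V' B)\<^esub> inv\<^bsub>sections F (ov V' B)\<^esub> e2 B" for B
    have e12: "e1 B \<in> carrier (sections F (ov V' B))" "e2 B \<in> carrier (sections F (ov V' B))"
      if "B \<subseteq> {..<m}" for B
      unfolding e1_def e2_def
      by (intro restr_closed open_ov[OF _ that] op overlap_mono order_refl sub bV aW that)+
    have ce: "cochain V' {..<m} e1" "cochain V' {..<m} e2" "cochain V' {..<m} e"
      unfolding cochain_def e_def using e12 group_sections[OF open_ov[OF op(3)]]
      by (auto intro!: monoid.m_closed group.is_monoid group.inv_closed)
    have "cech_diff F D m V' e A = \<one>\<^bsub>sections F (ov V' A)\<^esub>" if A: "A \<subseteq> {..<m}" for A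
    proof -
      interpret G: group "sections F (ov V' A)" by (rule group_sections[OF open_ov[OF op(3) A]])
      have oA: "openin T (ov W A)" "openin T (ov V A)" "openin T (ov W' A)" "openin T (ov V' A)"
        using open_ov[OF _ A] opW op by auto
      have sA: "ov V A \<subseteq> ov W A" "ov W' A \<subseteq> ov W A" "ov V' A \<subseteq> ov V A" "ov V' A \<subseteq> ov W' A"
        using sub by (simp_all add: overlap_mono)
      have "cech_diff F D m V' e1 A = restr F (ov V A) (ov V' A) (r A)"
        unfolding e1_def using cech_diff_restr[OF op(1,3) sub(3) A cochain_mono[OF b(1) A]] b(2)[OF A] by simp
      also have "\<dots> = restr F (ov W A) (ov V' A) (a A)"
        unfolding r_def by (rule restr_restr[OF oA(1,2,4) sA(3,1) aW(1)[OF A]])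
      also have "\<dots> = restr F (ov W' A) (ov V' A) (cech_diff F D m W' a' A)"
        using restr_restr[OF oA(1,3,4) sA(4,2) aW(1)[OF A]] cyc'[OF A] by simp
      also have "\<dots> = cech_diff F D m V' e2 A"
        unfolding e2_def using cech_diff_restr[OF op(2,3) sub(4) A cochain_mono[OF ca(2) A]] by simp
      finally have eq: "cech_diff F D m V' e1 A = cech_diff F D m V' e2 A" .
      show ?thesis
        unfolding e_def cech_diff_div[OF op(3) A cochain_mono[OF ce(1) A] cochain_mono[OF ce(2) A]] eq
        using cech_diff_closed[OF op(3) A cochain_mono[OF ce(2) A]] by (rule G.r_inv)
    qed
    then obtain d where d: "cochain V' {..<m} d" "\<And>A. A \<subseteq> {..<m} \<Longrightarrow> cech_diff F D m V' d A = e A"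
      using Suc.IH[OF op(3) _ ce(3)] by (auto simp: V_def V'_def U_def)
    have dV: "d B \<in> carrier (sections F (ov V' B))" if "B \<subseteq> {..<m}" for B
      using cochainD[OF d(1) that] .
    have a0: "a {} = \<one>\<^bsub>sections F W\<^esub>"
    proof (rule separated)
      have "restr F W V (a {}) = \<one>\<^bsub>sections F V\<^esub>" using b(2)[of "{}"] by (simp add: r_def)
      moreover have "restr F W W' (a {}) = \<one>\<^bsub>sections F W'\<^esub>" using cyc'[of "{}"] by simp
      moreover have "restr F W V \<one>\<^bsub>sections F W\<^esub> = \<one>\<^bsub>sections F V\<^esub>"
          "restr F W W' \<one>\<^bsub>sections F W\<^esub> = \<one>\<^bsub>sections F W'\<^esub>"
        using restr_one opW op sub by auto
      moreover fix x assume "x \<in> W"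
      ultimately show "\<exists>V. openin T V \<and> x \<in> V \<and> V \<subseteq> W \<and> restr F W V (a {}) = restr F W V \<one>\<^bsub>sections F W\<^esub>"
        using WVW op sub by (metis Un_iff)
    qed (use opW aW(1)[of "{}"] group_sections in \<open>auto intro!: monoid.one_closed group.is_monoid\<close>)
    \<comment> \<open>A differential is trivial at the empty index set. Hence so is
      \<open>e {}\<close>, which says that \<open>b {}\<close> and \<open>a' {}\<close> agree on
      \<open>V'\<close> and can be glued.\<close>
    have "restr F V V' (b {}) = restr F W' V' (a' {})"
    proof -
      interpret G: group "sections F V'" by (rule group_sections[OF op(3)])
      have "e {} = \<one>\<^bsub>sections F V'\<^esub>" using d(2)[of "{}"] by simp
      then show ?thesis using e12[of "{}"] by (simp add: e_def e1_def e2_def G.inv_solve_right')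
    qed
    then obtain \<beta> where \<beta>: "\<beta> \<in> carrier (sections F W)" "restr F W V \<beta> = b {}" "restr F W W' \<beta> = a' {}"
      using glue_two[OF op(1,2), of "b {}" "a' {}"] bV[of "{}"] aW(2)[of "{}"] unfolding WVW by auto
    \<comment> \<open>This is where flasqueness enters: \<open>d {}\<close> lives on
      \<open>V'\<close> but is needed on \<open>W'\<close>.\<close>
    obtain \<gamma> where \<gamma>: "\<gamma> \<in> carrier (sections F W')" "restr F W' V' \<gamma> = d {}"
      using flasque_extend[OF fl op(3,2) sub(4), of "d {}"] dV[of "{}"] by auto
    define c0 where "c0 A = (if A = {} then \<beta> else b A)" for A
    define c1 where "c1 A = (if A = {} then \<gamma> else d A)" for A
    \<comment> \<open>Over \<open>insert m B\<close> with \<open>B\<close> nonempty the differential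
      becomes \<open>e1 B\<close> divided by \<open>e B\<close>, that is \<open>e2 B = a' B\<close>.
      For empty \<open>B\<close> it is the restriction of \<open>\<beta>\<close> to
      \<open>W'\<close>, which is \<open>a' {}\<close> by the choice of
      \<open>\<beta>\<close>.\<close>
    define c where "c A = (if m \<in> A then c1 (A - {m}) else c0 A)" for A
    have cc: "cochain W {..<m} c0" "cochain W' {..<m} c1"
      unfolding cochain_def c0_def c1_def using \<beta>(1) \<gamma>(1) bV dV ov_eq by (metis overlap_empty)+
    have c_sub: "c A = c0 A" "c (insert m A) = c1 A" if "A \<subseteq> {..<m}" for A
    proof -
      have "m \<notin> A" using that by auto
      then show "c A = c0 A" "c (insert m A) = c1 A" by (auto simp: c_def)
    qed
    have restr_c0: "restr F (ov W B) (ov V B) (c0 B) = b B" if "B \<subseteq> {..<m}" for B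
      using that \<beta>(2) ov_eq(1)[of B] restr_id[OF open_ov[OF op(1) that] bV[OF that]]
      by (cases "B = {}") (simp_all add: c0_def)
    have restr_c1: "restr F (ov W' B) (ov V' B) (c1 B) = d B" if "B \<subseteq> {..<m}" for B
      using that \<gamma>(2) ov_eq(2)[of B] restr_id[OF open_ov[OF op(3) that] dV[OF that]]
      by (cases "B = {}") (simp_all add: c1_def)
    have dc0: "cech_diff F D m W c0 A = a A" if A: "A \<subseteq> {..<m}" for A
    proof (cases "A = {}")
      case False
      have "restr F (ov W A) (ov V A) (cech_diff F D m W c0 A) = cech_diff F D m V b A"
        unfolding cech_diff_restr[OF opW op(1) sub(1) A cochain_mono[OF cc(1) A], symmetric]
        by (rule cech_diff_cong[OF A], rule restr_c0) (use A in auto)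
      also have "\<dots> = restr F (ov W A) (ov V A) (a A)" using b(2)[OF A] by (simp add: r_def)
      finally show ?thesis
        using False A ov_eq(1)[of A] restr_id[OF open_ov[OF opW A]] aW(1)[OF A]
          cech_diff_closed[OF opW A cochain_mono[OF cc(1) A]] by simp
    qed (simp add: a0)
    have dc1: "cech_diff F D m W' c1 A = e A" if A: "A \<subseteq> {..<m}" "A \<noteq> {}" for A
    proof -
      have "restr F (ov W' A) (ov V' A) (cech_diff F D m W' c1 A) = cech_diff F D m V' d A"
        unfolding cech_diff_restr[OF op(2,3) sub(4) A(1) cochain_mono[OF cc(2) A(1)], symmetric]
        by (rule cech_diff_cong[OF A(1)], rule restr_c1) (use A in auto)
      then show ?thesis
        using A ov_eq(2)[of A] restr_id[OF open_ov[OF op(2) A(1)]] d(2)[OF A(1)]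
          cech_diff_closed[OF op(2) A(1) cochain_mono[OF cc(2) A(1)]] by simp
    qed
    have "cech_diff F D (Suc m) W c A = a A" if "A \<subseteq> {..<Suc m}" for A
      using that
    proof (cases rule: subset_lessThan_Suc_cases)
      case sub
      have "cech_diff F D m W c A = cech_diff F D m W c0 A"
        by (rule cech_diff_cong[OF sub], rule c_sub(1)) (use sub in auto)
      then show ?thesis unfolding cech_diff_sub[OF sub] using dc0[OF sub] by simp
    next
      case (ins B)
      interpret G: comm_group "sections F (ov W' B)"
        by (rule comm_group_sections[OF open_ov[OF op(2) ins(1)]])
      have "cech_diff F D m W' (\<lambda>C. c (insert m C)) B = cech_diff F D m W' c1 B"
        by (rule cech_diff_cong[OF ins(1)], rule c_sub(2)) (use ins in auto)
      then have *: "cech_diff F D (Suc m) W c A =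
          restr F (ov W B) (ov W' B) (c0 B) \<otimes>\<^bsub>sections F (ov W' B)\<^esub>
          inv\<^bsub>sections F (ov W' B)\<^esub> (cech_diff F D m W' c1 B)"
        unfolding ins(2) cech_diff_insert[OF ins(1)] W'_def[symmetric] by (simp add: c_sub ins(1))
      show ?thesis
      proof (cases "B = {}")
        case True
        then show ?thesis unfolding * using aW(2)[of "{}"] \<beta>(3) G.inv_one G.r_one
          by (simp add: c0_def ins(2) a'_def)
      next
        case False
        note ov_eq = ov_eq[OF False ins(1)]
        have "restr F (ov W B) (ov W' B) (c0 B) = e1 B"
          using False ov_eq by (simp add: c0_def e1_def)
        moreover have "e2 B = a' B"
          using ov_eq(2) restr_id[OF open_ov[OF op(2) ins(1)] aW(2)[OF ins(1)]] by (simp add: e2_def)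
        ultimately show ?thesis
          unfolding * dc1[OF ins(1) False] e_def using e12[OF ins(1)] ov_eq(2)
          by (simp add: G.inv_mult G.m_assoc[symmetric] ins(2) a'_def[symmetric])
      qed
    qed
    moreover have "cochain W {..<Suc m} c"
      unfolding cochain_def
    proof (intro allI impI)
      fix A :: "nat set" assume "A \<subseteq> {..<Suc m}"
      then show "c A \<in> carrier (sections F (ov W A))"
      proof (cases rule: subset_lessThan_Suc_cases)
        case sub
        then show ?thesis using c_sub(1)[OF sub] cochainD[OF cc(1)] by simp
      next
        case (ins B)
        then show ?thesis
          using c_sub(2)[OF ins(1)] cochainD[OF cc(2)] by (simp add: overlap_insert W'_def)
      qed
    qed
    ultimately show ?case by (intro exI[of _ c]) simp
  }
qed

section \<open>Double complexes with exact rows and columns\<close>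

text \<open>Here \<open>q\<close> is the degree in the resolution, \<open>p\<close> the index in the
  Cech direction, and \<open>F\<close> augments at \<open>q = 0\<close>. Exactness in direction
  \<open>dh\<close> is assumed from \<open>p = 0\<close> on, but in direction \<open>dv\<close> only
  for positive \<open>p\<close>; this asymmetry leaves room for cohomology at
  \<open>p = 0\<close>.\<close>

locale augmented_double_complex =
  fixes G :: "nat \<Rightarrow> nat \<Rightarrow> 'b monoid" and F :: "nat \<Rightarrow> 'c monoid"
    and dv dh :: "nat \<Rightarrow> nat \<Rightarrow> 'b \<Rightarrow> 'b" and e :: "nat \<Rightarrow> 'c \<Rightarrow> 'b" and dF :: "nat \<Rightarrow> 'c \<Rightarrow> 'c"
  assumes comm_group_G: "\<And>q p. comm_group (G q p)"
    and comm_group_F: "\<And>p. comm_group (F p)"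
    and dv_hom: "\<And>q p. dv q p \<in> hom (G q p) (G (Suc q) p)"
    and dh_hom: "\<And>q p. dh q p \<in> hom (G q p) (G q (Suc p))"
    and e_hom: "\<And>p. e p \<in> hom (F p) (G 0 p)"
    and dF_hom: "\<And>p. dF p \<in> hom (F p) (F (Suc p))"
    and dv_dv: "\<And>q p x. x \<in> carrier (G q p) \<Longrightarrow> dv (Suc q) p (dv q p x) = \<one>\<^bsub>G (Suc (Suc q)) p\<^esub>"
    and dh_dh: "\<And>q p x. x \<in> carrier (G q p) \<Longrightarrow> dh q (Suc p) (dh q p x) = \<one>\<^bsub>G q (Suc (Suc p))\<^esub>"
    and dv_e: "\<And>p c. c \<in> carrier (F p) \<Longrightarrow> dv 0 p (e p c) = \<one>\<^bsub>G (Suc 0) p\<^esub>"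
    and dv_dh: "\<And>q p x. x \<in> carrier (G q p) \<Longrightarrow> dv q (Suc p) (dh q p x) = dh (Suc q) p (dv q p x)"
    and e_dF: "\<And>p c. c \<in> carrier (F p) \<Longrightarrow> e (Suc p) (dF p c) = dh 0 p (e p c)"
    and e_inj: "\<And>p. inj_on (e p) (carrier (F p))"
    and row_zero: "\<And>q x. \<lbrakk>x \<in> carrier (G q 0); dh q 0 x = \<one>\<^bsub>G q (Suc 0)\<^esub>\<rbrakk> \<Longrightarrow> x = \<one>\<^bsub>G q 0\<^esub>"
    and row: "\<And>q p x. \<lbrakk>x \<in> carrier (G q (Suc p)); dh q (Suc p) x = \<one>\<^bsub>G q (Suc (Suc p))\<^esub>\<rbrakk> \<Longrightarrow>
      \<exists>y \<in> carrier (G q p). dh q p y = x"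
    and col_zero: "\<And>p x. \<lbrakk>x \<in> carrier (G 0 (Suc p)); dv 0 (Suc p) x = \<one>\<^bsub>G (Suc 0) (Suc p)\<^esub>\<rbrakk> \<Longrightarrow>
      \<exists>c \<in> carrier (F (Suc p)). e (Suc p) c = x"
    and col: "\<And>q p x. \<lbrakk>x \<in> carrier (G (Suc q) (Suc p)); dv (Suc q) (Suc p) x = \<one>\<^bsub>G (Suc (Suc q)) (Suc p)\<^esub>\<rbrakk> \<Longrightarrow>
      \<exists>y \<in> carrier (G q (Suc p)). dv q (Suc p) y = x"
begin

lemma group_G: "group (G q p)" and group_F: "group (F p)"
  using comm_group_G comm_group_F comm_group.axioms(2) by auto

lemma dv_group_hom: "group_hom (G q p) (G (Suc q) p) (dv q p)"
  and dh_group_hom: "group_hom (G q p) (G q (Suc p)) (dh q p)"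
  and e_group_hom: "group_hom (F p) (G 0 p) (e p)"
  and dF_group_hom: "group_hom (F p) (F (Suc p)) (dF p)"
  by (simp_all add: group_hom_def group_hom_axioms_def group_G group_F dv_hom dh_hom e_hom dF_hom)

lemmas G_m_closed [simp] = monoid.m_closed[OF group.is_monoid[OF group_G]]
lemmas G_inv_closed [simp] = group.inv_closed[OF group_G]
lemmas G_one_closed [simp] = monoid.one_closed[OF group.is_monoid[OF group_G]]
lemmas F_m_closed [simp] = monoid.m_closed[OF group.is_monoid[OF group_F]]
lemmas F_inv_closed [simp] = group.inv_closed[OF group_F]
lemmas F_one_closed [simp] = monoid.one_closed[OF group.is_monoid[OF group_F]]
lemmas dv_closed [simp] = group_hom.hom_closed[OF dv_group_hom]
lemmas dh_closed [simp] = group_hom.hom_closed[OF dh_group_hom]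
lemmas e_closed [simp] = group_hom.hom_closed[OF e_group_hom]
lemmas dF_closed [simp] = group_hom.hom_closed[OF dF_group_hom]
lemmas dv_one [simp] = group_hom.hom_one[OF dv_group_hom]
lemmas dh_one [simp] = group_hom.hom_one[OF dh_group_hom]
lemmas e_one [simp] = group_hom.hom_one[OF e_group_hom]
lemmas dv_mult [simp] = group_hom.hom_mult[OF dv_group_hom]
lemmas dh_mult [simp] = group_hom.hom_mult[OF dh_group_hom]
lemmas e_mult [simp] = group_hom.hom_mult[OF e_group_hom]
lemmas dv_inv [simp] = group_hom.hom_inv[OF dv_group_hom]
lemmas dh_inv [simp] = group_hom.hom_inv[OF dh_group_hom]
lemmas e_inv [simp] = group_hom.hom_inv[OF e_group_hom]

text \<open>
  \<open>link q p c x\<close> says that the zigzag through the double complex starting at \<open>c\<close> in the augmenting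
  column can be chosen to end in \<open>x\<close>.
\<close>

primrec link :: "nat \<Rightarrow> nat \<Rightarrow> 'c \<Rightarrow> 'b \<Rightarrow> bool" where
  "link 0 p c x \<longleftrightarrow> c \<in> carrier (F (Suc p)) \<and> x \<in> carrier (G 0 p) \<and> dh 0 p x = e (Suc p) c"
| "link (Suc q) p c x \<longleftrightarrow> x \<in> carrier (G (Suc q) p) \<and>
     (\<exists>y. link q (Suc p) c y \<and> dh (Suc q) p x = dv q (Suc p) y)"

lemma link_closed: "link q p c x \<Longrightarrow> x \<in> carrier (G q p) \<and> c \<in> carrier (F (Suc (p + q)))"
  by (induction q arbitrary: p x) fastforce+

text \<open>Every condition in a zigzag is an equation between homomorphisms, so zigzags multiply
  entry by entry. This substitutes for a homomorphism, since the entries are not unique.\<close>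

lemma link_mult:
  "\<lbrakk>link q p c x; link q p c' x'\<rbrakk> \<Longrightarrow> link q p (c \<otimes>\<^bsub>F (Suc (p + q))\<^esub> c') (x \<otimes>\<^bsub>G q p\<^esub> x')"
proof (induction q arbitrary: p x x')
  case (Suc q)
  then obtain y y' where y: "link q (Suc p) c y" "dh (Suc q) p x = dv q (Suc p) y"
      "link q (Suc p) c' y'" "dh (Suc q) p x' = dv q (Suc p) y'" by auto
  have "y \<in> carrier (G q (Suc p))" "y' \<in> carrier (G q (Suc p))"
    using y link_closed by blast+
  then show ?case
    using Suc.IH[OF y(1,3)] y Suc.prems by (auto intro!: exI[of _ "y \<otimes>\<^bsub>G q (Suc p)\<^esub> y'"])
qed auto

lemma link_inv:
  "link q p c x \<Longrightarrow> link q p (inv\<^bsub>F (Suc (p + q))\<^esub> c) (inv\<^bsub>G q p\<^esub> x)"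
proof (induction q arbitrary: p x)
  case (Suc q)
  then obtain y where y: "link q (Suc p) c y" "dh (Suc q) p x = dv q (Suc p) y" by auto
  have "y \<in> carrier (G q (Suc p))" using y link_closed by blast
  then show ?case
    using Suc.IH[OF y(1)] y Suc.prems by (auto intro!: exI[of _ "inv\<^bsub>G q (Suc p)\<^esub> y"])
qed auto

text \<open>Commute the two maps: \<open>dh\<close> of \<open>x\<close> comes from the previous
  entry by \<open>dv\<close>, or from \<open>c\<close> by \<open>e\<close>, and a further
  \<open>dv\<close> kills it.\<close>

lemma link_dh_dv:
  assumes "link q p c x" "dF (Suc (p + q)) c = \<one>\<^bsub>F (Suc (Suc (p + q)))\<^esub>"
  shows "dh (Suc q) p (dv q p x) = \<one>\<^bsub>G (Suc q) (Suc p)\<^esub>"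
proof (cases q)
  case 0
  then show ?thesis using assms by (simp flip: dv_dh add: dv_e)
next
  case (Suc r)
  then obtain y where y: "x \<in> carrier (G (Suc r) p)" "link r (Suc p) c y" "dh (Suc r) p x = dv r (Suc p) y"
    using assms by auto
  have "y \<in> carrier (G r (Suc p))" using y link_closed by blast
  then show ?thesis using y by (simp flip: dv_dh add: Suc dv_dv)
qed

text \<open>Each new entry is a \<open>dh\<close>-preimage of \<open>dv\<close> of the previous one;
  \<open>link_dh_dv\<close> supplies the cycle condition that row exactness asks for.\<close>

lemma link_exists:
  "\<lbrakk>c \<in> carrier (F (Suc (p + q))); dF (Suc (p + q)) c = \<one>\<^bsub>F (Suc (Suc (p + q)))\<^esub>\<rbrakk> \<Longrightarrow> \<exists>x. link q p c x"
proof (induction q arbitrary: p)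
  case 0
  have "dh 0 (Suc p) (e (Suc p) c) = \<one>\<^bsub>G 0 (Suc (Suc p))\<^esub>"
    using 0 by (simp flip: e_dF)
  then show ?case using row[of "e (Suc p) c" 0 p] 0 by auto
next
  case (Suc q)
  obtain y where y: "link q (Suc p) c y" using Suc.IH[of "Suc p"] Suc.prems by auto
  have "dh (Suc q) (Suc p) (dv q (Suc p) y) = \<one>\<^bsub>G (Suc q) (Suc (Suc p))\<^esub>"
    by (rule link_dh_dv[OF y]) (use Suc.prems in simp)
  then obtain x where "x \<in> carrier (G (Suc q) p)" "dh (Suc q) p x = dv q (Suc p) y"
    using row[of "dv q (Suc p) y" "Suc q" p] link_closed[OF y] by auto
  then show ?case using y by auto
qed

text \<open>The zigzag is traversed backwards by column exactness. At \<open>q = 0\<close>,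
  injectivity of \<open>e\<close> turns the vanishing of \<open>dh\<close> after \<open>dh\<close>
  into the cocycle condition for \<open>c\<close>.\<close>

lemma link_exists':
  "\<lbrakk>x \<in> carrier (G q p); dh (Suc q) p (dv q p x) = \<one>\<^bsub>G (Suc q) (Suc p)\<^esub>\<rbrakk> \<Longrightarrow>
    \<exists>c. link q p c x \<and> dF (Suc (p + q)) c = \<one>\<^bsub>F (Suc (Suc (p + q)))\<^esub>"
proof (induction q arbitrary: p x)
  case 0
  then obtain c where c: "c \<in> carrier (F (Suc p))" "e (Suc p) c = dh 0 p x"
    using col_zero[of "dh 0 p x" p] by (auto simp: dv_dh)
  have "e (Suc (Suc p)) (dF (Suc p) c) = e (Suc (Suc p)) \<one>\<^bsub>F (Suc (Suc p))\<^esub>"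
    using c 0 by (simp add: e_dF dh_dh)
  then have "dF (Suc p) c = \<one>\<^bsub>F (Suc (Suc p))\<^esub>"
    using inj_onD[OF e_inj] c by (meson F_one_closed dF_closed)
  then show ?case using c 0 by auto
next
  case (Suc q)
  then obtain y where y: "y \<in> carrier (G q (Suc p))" "dv q (Suc p) y = dh (Suc q) p x"
    using col[of "dh (Suc q) p x" q p] by (auto simp: dv_dh)
  then have "dh (Suc q) (Suc p) (dv q (Suc p) y) = \<one>\<^bsub>G (Suc q) (Suc (Suc p))\<^esub>"
    using Suc.prems by (simp add: dh_dh)
  then obtain c where "link q (Suc p) c y" "dF (Suc (Suc p + q)) c = \<one>\<^bsub>F (Suc (Suc (Suc p + q)))\<^esub>"
    using Suc.IH[OF y(1)] by blast
  then show ?case using y Suc.prems by (intro exI[of _ c]) auto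
qed

text \<open>The image of the incoming vertical map, with the augmentation in that role for
  \<open>q = 0\<close>. It measures the ambiguity of a zigzag entry.\<close>

primrec vbound :: "nat \<Rightarrow> nat \<Rightarrow> 'b \<Rightarrow> bool" where
  "vbound 0 p u \<longleftrightarrow> u \<in> e p ` carrier (F p)"
| "vbound (Suc q) p u \<longleftrightarrow> u \<in> dv q p ` carrier (G q p)"

lemma vbound_closed: "vbound q p u \<Longrightarrow> u \<in> carrier (G q p)"
  and dv_vbound: "vbound q p u \<Longrightarrow> dv q p u = \<one>\<^bsub>G (Suc q) p\<^esub>"
  by (cases q; auto simp: dv_e dv_dv)+

lemma col_vbound:
  assumes "x \<in> carrier (G q (Suc p))" "dv q (Suc p) x = \<one>\<^bsub>G (Suc q) (Suc p)\<^esub>"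
  shows "vbound q (Suc p) x"
  using assms col_zero col by (cases q) fastforce+

lemma row_eq:
  assumes "x \<in> carrier (G q (Suc p))" "u \<in> carrier (G q (Suc p))" "dh q (Suc p) x = dh q (Suc p) u"
  obtains b where "b \<in> carrier (G q p)" "x = u \<otimes>\<^bsub>G q (Suc p)\<^esub> dh q p b"
proof -
  interpret G: comm_group "G q (Suc p)" by (rule comm_group_G)
  have "dh q (Suc p) (inv\<^bsub>G q (Suc p)\<^esub> u \<otimes>\<^bsub>G q (Suc p)\<^esub> x) = \<one>\<^bsub>G q (Suc (Suc p))\<^esub>"
    using assms group.l_inv[OF group_G] by simp
  then obtain b where b: "b \<in> carrier (G q p)" "dh q p b = inv\<^bsub>G q (Suc p)\<^esub> u \<otimes>\<^bsub>G q (Suc p)\<^esub> x"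
    using row assms by (metis G.inv_closed G.m_closed)
  then have "x = u \<otimes>\<^bsub>G q (Suc p)\<^esub> dh q p b" using assms by (simp flip: G.m_assoc)
  then show thesis using that b(1) by blast
qed

lemma row_eq_zero:
  assumes "x \<in> carrier (G q 0)" "u \<in> carrier (G q 0)" "dh q 0 x = dh q 0 u"
  shows "x = u"
proof -
  interpret G: comm_group "G q 0" by (rule comm_group_G)
  have "dh q 0 (x \<otimes>\<^bsub>G q 0\<^esub> inv\<^bsub>G q 0\<^esub> u) = \<one>\<^bsub>G q (Suc 0)\<^esub>"
    using assms group.r_inv[OF group_G] by simp
  then show ?thesis using row_zero assms by (metis G.inv_closed G.m_closed G.inv_solve_right' G.l_one G.one_closed)
qed

text \<open>The primitive \<open>f\<close> is pushed along the zigzag: row exactness turns equal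
  \<open>dh\<close>-values into \<open>y = u\<close> times \<open>dh b\<close>, and
  \<open>dv b\<close> is the vertical boundary for the next entry.\<close>

lemma link_coboundary:
  "\<lbrakk>link q p (dF (p + q) f) x; f \<in> carrier (F (p + q))\<rbrakk> \<Longrightarrow> \<exists>u. vbound q p u \<and> dh q p x = dh q p u"
proof (induction q arbitrary: p x)
  case 0
  then show ?case by (auto simp: e_dF)
next
  case (Suc q)
  then obtain y where y: "link q (Suc p) (dF (p + Suc q) f) y" "dh (Suc q) p x = dv q (Suc p) y" by auto
  then obtain u where u: "vbound q (Suc p) u" "dh q (Suc p) y = dh q (Suc p) u"
    using Suc.IH[of "Suc p" y] Suc.prems by auto
  obtain b where b: "b \<in> carrier (G q p)" "y = u \<otimes>\<^bsub>G q (Suc p)\<^esub> dh q p b"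
    using row_eq[OF _ vbound_closed[OF u(1)] u(2)] link_closed[OF y(1)] by blast
  have "dh (Suc q) p x = dh (Suc q) p (dv q p b)"
    using y(2) b vbound_closed[OF u(1)] monoid.l_one[OF group.is_monoid[OF group_G]]
    by (simp add: dv_vbound[OF u(1)] dv_dh)
  then show ?case using b by auto
qed

text \<open>The same correction read backwards: \<open>y\<close> divided by \<open>dh b\<close> is
  killed by \<open>dv\<close>, hence is a vertical boundary by column exactness, and its
  \<open>dh\<close> is unchanged.\<close>

lemma link_coboundary':
  "\<lbrakk>link q p c x; vbound q p u; dh q p x = dh q p u\<rbrakk> \<Longrightarrow> c \<in> dF (p + q) ` carrier (F (p + q))"
proof (induction q arbitrary: p x u)
  case 0
  then obtain f where f: "f \<in> carrier (F p)" "u = e p f" by auto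
  then have "e (Suc p) c = e (Suc p) (dF p f)" using 0 by (simp add: e_dF)
  then have "c = dF p f" using inj_onD[OF e_inj] 0 f by (metis dF_closed link.simps(1))
  then show ?case using f by simp
next
  case (Suc q)
  then obtain y b where y: "link q (Suc p) c y" "dh (Suc q) p x = dv q (Suc p) y"
      and b: "b \<in> carrier (G q p)" "u = dv q p b" by auto
  interpret G: comm_group "G q (Suc p)" by (rule comm_group_G)
  have yc: "y \<in> carrier (G q (Suc p))" using link_closed[OF y(1)] by blast
  let ?w = "y \<otimes>\<^bsub>G q (Suc p)\<^esub> inv\<^bsub>G q (Suc p)\<^esub> dh q p b"
  have "dv q (Suc p) ?w = \<one>\<^bsub>G (Suc q) (Suc p)\<^esub>"
    using yc b y(2) Suc.prems(3) group.r_inv[OF group_G] by (simp add: dv_dh)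
  then have "vbound q (Suc p) ?w" using col_vbound yc b by (metis G.inv_closed G.m_closed dh_closed)
  moreover have "dh q (Suc p) y = dh q (Suc p) ?w"
    using yc b monoid.r_one[OF group.is_monoid[OF group_G]]
    by (simp add: dh_dh monoid.inv_one[OF group.is_monoid[OF group_G]])
  ultimately show ?case using Suc.IH[OF y(1)] by auto
qed

text \<open>Degree \<open>m\<close> sits at index \<open>Suc m\<close>. The term at index 0 belongs
  to the augmentation, so it contributes no coboundaries in degree 0; hence the case
  distinction.\<close>

definition coboundaries :: "nat \<Rightarrow> 'c set" where
  "coboundaries m = (case m of 0 \<Rightarrow> {\<one>\<^bsub>F (Suc 0)\<^esub>} | Suc q \<Rightarrow> dF m ` carrier (F m))"

definition boundaries :: "nat \<Rightarrow> 'b set" where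
  "boundaries m = (case m of 0 \<Rightarrow> {\<one>\<^bsub>G 0 0\<^esub>} | Suc q \<Rightarrow> dv q 0 ` carrier (G q 0))"

text \<open>At \<open>p = 0\<close> the map \<open>dh\<close> is injective, so the equality of
  \<open>dh\<close>-values from \<open>link_coboundary\<close> becomes equality with a vertical
  boundary. In degree 0 injectivity of \<open>e\<close> gives the converse.\<close>

lemma link_boundary_iff:
  assumes l: "link m 0 c z"
  shows "c \<in> coboundaries m \<longleftrightarrow> z \<in> boundaries m"
proof (cases m)
  case 0
  have "dh 0 0 z = e (Suc 0) c" "z \<in> carrier (G 0 0)" "c \<in> carrier (F (Suc 0))" using l 0 by auto
  then show ?thesis
    using 0 row_zero[of z 0] inj_onD[OF e_inj[of "Suc 0"], of c "\<one>\<^bsub>F (Suc 0)\<^esub>"]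
    by (auto simp: coboundaries_def boundaries_def)
next
  case (Suc q)
  show ?thesis
  proof
    assume "c \<in> coboundaries m"
    then obtain f where "f \<in> carrier (F (0 + m))" "c = dF (0 + m) f" using Suc by (auto simp: coboundaries_def)
    then obtain u where u: "vbound m 0 u" "dh m 0 z = dh m 0 u"
      using link_coboundary[of m 0 f z] l by auto
    then have "z = u" using row_eq_zero link_closed[OF l] vbound_closed by blast
    then show "z \<in> boundaries m" using u Suc by (auto simp: boundaries_def)
  next
    assume "z \<in> boundaries m"
    then have "vbound m 0 z" using Suc by (auto simp: boundaries_def)
    then show "c \<in> coboundaries m"
      using link_coboundary'[OF l _ refl] Suc by (auto simp: coboundaries_def)
  qed
qed

lemma cocycle_lifts:
  assumes "c \<in> carrier (F (Suc m))" "dF (Suc m) c = \<one>\<^bsub>F (Suc (Suc m))\<^esub>"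
  obtains z where "link m 0 c z" "dv m 0 z = \<one>\<^bsub>G (Suc m) 0\<^esub>"
proof -
  obtain z where z: "link m 0 c z" using link_exists[of c 0 m] assms by auto
  \<comment> \<open>At \<open>p = 0\<close>, \<open>row_zero\<close> upgrades the vanishing of
    \<open>dh\<close> after \<open>dv\<close> to the vanishing of \<open>dv\<close> itself.\<close>
  moreover have "dv m 0 z = \<one>\<^bsub>G (Suc m) 0\<^esub>"
    using link_dh_dv[OF z] assms link_closed[OF z] row_zero by simp
  ultimately show thesis using that by blast
qed

lemma cocycle_descends:
  assumes "z \<in> carrier (G m 0)" "dv m 0 z = \<one>\<^bsub>G (Suc m) 0\<^esub>"
  obtains c where "link m 0 c z" "c \<in> carrier (F (Suc m))" "dF (Suc m) c = \<one>\<^bsub>F (Suc (Suc m))\<^esub>"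
  using link_exists'[of z m 0] assms link_closed by fastforce

end

section \<open>Cech cochains of a fixed degree\<close>

definition index_sets :: "nat \<Rightarrow> nat \<Rightarrow> nat set set" where
  "index_sets N p = {A. A \<subseteq> {..<N} \<and> card A = p}"

definition cech_group ::
  "('a, 'b) sheaf_data \<Rightarrow> (nat \<Rightarrow> 'a set) \<Rightarrow> nat \<Rightarrow> 'a set \<Rightarrow> nat \<Rightarrow> (nat set \<Rightarrow> 'b) monoid" where
  "cech_group F D N X p = product_group (index_sets N p) (\<lambda>A. sections F (overlap D X A))"

text \<open>Padding by trivial sections turns a cochain of one degree into an argument of
  \<open>cech_diff\<close>, which acts on all degrees together.\<close>

definition extend_cochain ::
  "('a, 'b) sheaf_data \<Rightarrow> (nat \<Rightarrow> 'a set) \<Rightarrow> nat \<Rightarrow> 'a set \<Rightarrow> nat \<Rightarrow> (nat set \<Rightarrow> 'b) \<Rightarrow> nat set \<Rightarrow> 'b" where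
  "extend_cochain F D N X p x A = (if A \<in> index_sets N p then x A else \<one>\<^bsub>sections F (overlap D X A)\<^esub>)"

definition cech_map ::
  "('a, 'b) sheaf_data \<Rightarrow> (nat \<Rightarrow> 'a set) \<Rightarrow> nat \<Rightarrow> 'a set \<Rightarrow> nat \<Rightarrow> (nat set \<Rightarrow> 'b) \<Rightarrow> nat set \<Rightarrow> 'b" where
  "cech_map F D N X p x =
     (\<lambda>A\<in>index_sets N (Suc p). cech_diff F D N X (extend_cochain F D N X p x) A)"

lemma index_sets_remove: "\<lbrakk>A \<in> index_sets N (Suc p); i \<in> A\<rbrakk> \<Longrightarrow> A - {i} \<in> index_sets N p"
  by (auto simp: index_sets_def card_Diff_singleton_if dest: finite_subset[OF _ finite_lessThan])

lemma index_sets_zero: "index_sets N 0 = {{}}"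
  by (auto simp: index_sets_def dest: finite_subset[OF _ finite_lessThan])

context presheaf_cover
begin

context
  fixes N :: nat and X :: "'a set"
  assumes X: "openin T X"
begin

lemma group_index: "A \<in> index_sets N p \<Longrightarrow> comm_group (sections F (ov X A))"
  using comm_group_sections open_ov[OF X] by (auto simp: index_sets_def)

lemma comm_group_cech_group: "comm_group (cech_group F D N X p)"
proof -
  have "group (cech_group F D N X p)"
    unfolding cech_group_def using group_index comm_group.axioms(2) by (intro product_group) blast
  then show ?thesis
  proof (rule group.group_comm_groupI)
    fix x y assume "x \<in> carrier (cech_group F D N X p)" "y \<in> carrier (cech_group F D N X p)"
    then show "x \<otimes>\<^bsub>cech_group F D N X p\<^esub> y = y \<otimes>\<^bsub>cech_group F D N X p\<^esub> x"
      using comm_monoid.m_comm[OF comm_group.axioms(1)[OF group_index]]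
      by (auto simp: cech_group_def PiE_iff intro!: restrict_ext)
  qed
qed

lemma cochain_extend:
  "x \<in> carrier (cech_group F D N X p) \<Longrightarrow> A \<subseteq> {..<N} \<Longrightarrow> cochain X A (extend_cochain F D N X p x)"
  using monoid.one_closed[OF group.is_monoid[OF group_sections[OF open_ov[OF X]]]]
  by (auto simp: cochain_def extend_cochain_def cech_group_def) (meson subset_trans)

lemma cech_map_closed:
  "x \<in> carrier (cech_group F D N X p) \<Longrightarrow> cech_map F D N X p x \<in> carrier (cech_group F D N X (Suc p))"
  using cech_diff_closed[OF X _ cochain_extend]
  by (auto simp: cech_map_def cech_group_def index_sets_def)

lemma cech_map_hom: "cech_map F D N X p \<in> hom (cech_group F D N X p) (cech_group F D N X (Suc p))"
proof (rule homI)
  fix x y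
  assume x: "x \<in> carrier (cech_group F D N X p)" and y: "y \<in> carrier (cech_group F D N X p)"
  have "cech_diff F D N X (extend_cochain F D N X p (x \<otimes>\<^bsub>cech_group F D N X p\<^esub> y)) A =
      cech_diff F D N X (extend_cochain F D N X p x) A \<otimes>\<^bsub>sections F (ov X A)\<^esub>
      cech_diff F D N X (extend_cochain F D N X p y) A" if A: "A \<in> index_sets N (Suc p)" for A
  proof -
    have sub: "A \<subseteq> {..<N}" using A by (simp add: index_sets_def)
    have "cech_diff F D N X (extend_cochain F D N X p (x \<otimes>\<^bsub>cech_group F D N X p\<^esub> y)) A =
      cech_diff F D N X (\<lambda>B. extend_cochain F D N X p x B \<otimes>\<^bsub>sections F (ov X B)\<^esub>
        extend_cochain F D N X p y B) A"
      by (rule cech_diff_cong[OF sub])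
        (use index_sets_remove[OF A] in \<open>simp add: extend_cochain_def cech_group_def\<close>)
    then show ?thesis
      using cech_diff_mult[OF X sub cochain_extend[OF x sub] cochain_extend[OF y sub]] by simp
  qed
  then show "cech_map F D N X p (x \<otimes>\<^bsub>cech_group F D N X p\<^esub> y) =
      cech_map F D N X p x \<otimes>\<^bsub>cech_group F D N X (Suc p)\<^esub> cech_map F D N X p y"
    unfolding cech_map_def by (auto simp: cech_group_def intro!: restrict_ext)
qed (rule cech_map_closed)

lemma cech_map_cech_map:
  assumes x: "x \<in> carrier (cech_group F D N X p)"
  shows "cech_map F D N X (Suc p) (cech_map F D N X p x) = \<one>\<^bsub>cech_group F D N X (Suc (Suc p))\<^esub>"
proof -
  have "cech_diff F D N X (extend_cochain F D N X (Suc p) (cech_map F D N X p x)) A = \<one>\<^bsub>sections F (ov X A)\<^esub>"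
    if A: "A \<in> index_sets N (Suc (Suc p))" for A
  proof -
    have sub: "A \<subseteq> {..<N}" using A by (simp add: index_sets_def)
    have "cech_diff F D N X (extend_cochain F D N X (Suc p) (cech_map F D N X p x)) A =
      cech_diff F D N X (cech_diff F D N X (extend_cochain F D N X p x)) A"
      by (rule cech_diff_cong[OF sub])
        (use index_sets_remove[OF A] in \<open>simp add: extend_cochain_def cech_map_def\<close>)
    then show ?thesis using cech_diff_cech_diff[OF X sub cochain_extend[OF x sub]] by simp
  qed
  then show ?thesis by (auto simp: cech_map_def cech_group_def intro!: restrict_ext)
qed

lemma cech_map_exact_all:
  assumes fl: "flasque T F" and cov: "X \<subseteq> (\<Union>i<N. D i)"
    and x: "x \<in> carrier (cech_group F D N X p)"
    and dx: "cech_map F D N X p x = \<one>\<^bsub>cech_group F D N X (Suc p)\<^esub>"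
  shows "\<exists>b. cochain X {..<N} b \<and> (\<forall>A\<subseteq>{..<N}. cech_diff F D N X b A = extend_cochain F D N X p x A)"
proof (rule cech_exact[OF fl X cov cochain_extend[OF x order_refl]])
  fix A assume A: "A \<subseteq> {..<N}"
  show "cech_diff F D N X (extend_cochain F D N X p x) A = \<one>\<^bsub>sections F (ov X A)\<^esub>"
  proof (cases "A \<in> index_sets N (Suc p)")
    case True
    then show ?thesis using fun_cong[OF dx, of A] by (simp add: cech_map_def cech_group_def)
  next
    case False
    \<comment> \<open>If \<open>A\<close> does not have \<open>Suc p\<close> elements, none of its
      faces has \<open>p\<close>, so the differential sees only the padding.\<close>
    have "cech_diff F D N X (extend_cochain F D N X p x) A =
        cech_diff F D N X (\<lambda>B. \<one>\<^bsub>sections F (ov X B)\<^esub>) A"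
    proof (rule cech_diff_cong[OF A])
      fix i assume "i \<in> A"
      then have "A - {i} \<notin> index_sets N p"
        using False A finite_subset[OF A finite_lessThan]
        by (auto simp: index_sets_def card_Diff_singleton_if) (metis Suc_pred card_gt_0_iff empty_iff)
      then show "extend_cochain F D N X p x (A - {i}) = \<one>\<^bsub>sections F (ov X (A - {i}))\<^esub>"
        by (simp add: extend_cochain_def)
    qed
    then show ?thesis using cech_diff_one[OF X A] by simp
  qed
qed

lemma cech_map_exact:
  assumes "flasque T F" "X \<subseteq> (\<Union>i<N. D i)" "x \<in> carrier (cech_group F D N X (Suc p))"
    "cech_map F D N X (Suc p) x = \<one>\<^bsub>cech_group F D N X (Suc (Suc p))\<^esub>"
  shows "\<exists>y \<in> carrier (cech_group F D N X p). cech_map F D N X p y = x"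
proof -
  obtain b where b: "cochain X {..<N} b"
      "\<And>A. A \<subseteq> {..<N} \<Longrightarrow> cech_diff F D N X b A = extend_cochain F D N X (Suc p) x A"
    using cech_map_exact_all[OF assms] by blast
  \<comment> \<open>Only the component of index \<open>p\<close> of the mixed-degree primitive
    contributes to the differential at index \<open>Suc p\<close>.\<close>
  let ?y = "restrict b (index_sets N p)"
  have "?y \<in> carrier (cech_group F D N X p)"
    using cochainD[OF b(1)] by (auto simp: cech_group_def index_sets_def)
  moreover have "cech_map F D N X p ?y A = x A" for A
  proof (cases "A \<in> index_sets N (Suc p)")
    case True
    then have A: "A \<subseteq> {..<N}" by (simp add: index_sets_def)
    have "cech_diff F D N X (extend_cochain F D N X p ?y) A = cech_diff F D N X b A"
      by (rule cech_diff_cong[OF A]) (use index_sets_remove[OF True] in \<open>simp add: extend_cochain_def\<close>)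
    then show ?thesis using True b(2)[OF A] by (simp add: cech_map_def extend_cochain_def)
  next
    case False
    then show ?thesis using assms(3) by (auto simp: cech_map_def cech_group_def PiE_iff extensional_def)
  qed
  ultimately show ?thesis by blast
qed

lemma cech_map_exact_zero:
  assumes "flasque T F" "X \<subseteq> (\<Union>i<N. D i)" "x \<in> carrier (cech_group F D N X 0)"
    "cech_map F D N X 0 x = \<one>\<^bsub>cech_group F D N X (Suc 0)\<^esub>"
  shows "x = \<one>\<^bsub>cech_group F D N X 0\<^esub>"
proof -
  obtain b where "\<And>A. A \<subseteq> {..<N} \<Longrightarrow> cech_diff F D N X b A = extend_cochain F D N X 0 x A"
    using cech_map_exact_all[OF assms] by blast
  \<comment> \<open>The differential of anything is trivial at the empty set, the only index set of
    size 0.\<close>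
  from this[of "{}"] have "x {} = \<one>\<^bsub>sections F X\<^esub>"
    by (simp add: extend_cochain_def index_sets_zero)
  then show ?thesis
    using assms(3) by (auto simp: cech_group_def index_sets_zero PiE_iff extensional_def fun_eq_iff)
qed

end

end

definition cech_induced ::
  "('a set \<Rightarrow> 'b \<Rightarrow> 'c) \<Rightarrow> (nat \<Rightarrow> 'a set) \<Rightarrow> nat \<Rightarrow> 'a set \<Rightarrow> nat \<Rightarrow> (nat set \<Rightarrow> 'b) \<Rightarrow> nat set \<Rightarrow> 'c" where
  "cech_induced h D N X p x = (\<lambda>A\<in>index_sets N p. h (overlap D X A) (x A))"

lemma cech_induced_hom:
  assumes "presheaf_cover T F D" "openin T X" "h \<in> sheaf_hom T F G"
  shows "cech_induced h D N X p \<in> hom (cech_group F D N X p) (cech_group G D N X p)"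
proof -
  interpret presheaf_cover T F D by (rule assms(1))
  have h: "h (ov X A) \<in> hom (sections F (ov X A)) (sections G (ov X A))" if "A \<in> index_sets N p" for A
    using assms(3) open_ov[OF assms(2), of A N] that by (simp add: sheaf_hom_def index_sets_def)
  note hom_in_carrier[OF h] hom_mult[OF h]
  then show ?thesis
    by (intro homI) (auto simp: cech_induced_def cech_group_def PiE_iff intro!: restrict_ext)
qed

lemma cech_induced_cech_map:
  assumes F: "presheaf_cover T F D" and G: "presheaf_cover T G D"
    and X: "openin T X" and h: "h \<in> sheaf_hom T F G" and x: "x \<in> carrier (cech_group F D N X p)"
  shows "cech_induced h D N X (Suc p) (cech_map F D N X p x) =
    cech_map G D N X p (cech_induced h D N X p x)"
proof -
  interpret F: presheaf_cover T F D by (rule F)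
  have "cech_diff G D N X (extend_cochain G D N X p (cech_induced h D N X p x)) A =
      h (overlap D X A) (cech_diff F D N X (extend_cochain F D N X p x) A)"
    if A: "A \<in> index_sets N (Suc p)" for A
  proof -
    have sub: "A \<subseteq> {..<N}" using A by (simp add: index_sets_def)
    have "cech_diff G D N X (extend_cochain G D N X p (cech_induced h D N X p x)) A =
      cech_diff G D N X (\<lambda>B. h (overlap D X B) (extend_cochain F D N X p x B)) A"
      by (rule cech_diff_cong[OF sub])
        (use index_sets_remove[OF A] in \<open>simp add: extend_cochain_def cech_induced_def\<close>)
    then show ?thesis using cech_diff_natural[OF F G h X sub F.cochain_extend[OF X x sub]] by simp
  qed
  then show ?thesis unfolding cech_map_def cech_induced_def by (intro restrict_ext) (simp add: cech_induced_def)
qed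

section \<open>Cech cohomology computes sheaf cohomology\<close>

definition ultraparacompact_in :: "'a topology \<Rightarrow> 'a set \<Rightarrow> bool" where
  "ultraparacompact_in T W \<longleftrightarrow>
     (\<forall>\<V>. (\<forall>V\<in>\<V>. openin T V) \<and> W \<subseteq> \<Union>\<V> \<longrightarrow>
        (\<exists>\<P>. pairwise disjnt \<P> \<and> \<Union>\<P> = W \<and> (\<forall>P\<in>\<P>. openin T P \<and> (\<exists>V\<in>\<V>. P \<subseteq> V))))"

text \<open>Local preimages exist on some cover; over a disjoint refinement they glue with no
  compatibility to check. This removes the usual obstruction to lifting through a map onto the image
  sheaf.\<close>

lemma lift_section:
  assumes F: "sheaf T F" and G: "sheaf T G" and h: "h \<in> sheaf_hom T F G"
    and W: "openin T W" "ultraparacompact_in T W"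
    and s: "s \<in> carrier (sections G W)" and im: "in_image_sheaf T F G h W s"
  shows "\<exists>t \<in> carrier (sections F W). h W t = s"
proof -
  interpret F: sheaf T F by (rule F)
  interpret G: sheaf T G by (rule G)
  have h_hom: "h U \<in> hom (sections F U) (sections G U)" if "openin T U" for U
    using h that by (simp add: sheaf_hom_def)
  have h_nat: "h V (restr F U V t) = restr G U V (h U t)"
    if "openin T U" "openin T V" "V \<subseteq> U" "t \<in> carrier (sections F U)" for U V t
    using h that by (simp add: sheaf_hom_def)
  define good where "good V t \<longleftrightarrow> t \<in> carrier (sections F V) \<and> h V t = restr G W V s" for V t
  define \<V> where "\<V> = {V. openin T V \<and> V \<subseteq> W \<and> (\<exists>t. good V t)}"
  have "(\<forall>V\<in>\<V>. openin T V) \<and> W \<subseteq> \<Union>\<V>"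
  proof (intro conjI ballI subsetI)
    fix x assume "x \<in> W"
    then obtain V t where "openin T V" "x \<in> V" "V \<subseteq> W" "good V t"
      using im unfolding in_image_sheaf_def good_def by metis
    then show "x \<in> \<Union>\<V>" by (auto simp: \<V>_def)
  qed (simp add: \<V>_def)
  then obtain \<P> where P: "pairwise disjnt \<P>" "\<Union>\<P> = W" "\<And>P. P \<in> \<P> \<Longrightarrow> openin T P"
      "\<And>P. P \<in> \<P> \<Longrightarrow> \<exists>V\<in>\<V>. P \<subseteq> V"
    using W(2) unfolding ultraparacompact_in_def by metis
  have "\<exists>t. good P t" if "P \<in> \<P>" for P
  proof -
    obtain V t where V: "P \<subseteq> V" "openin T V" "V \<subseteq> W" "good V t"
      using P(4)[OF \<open>P \<in> \<P>\<close>] by (auto simp: \<V>_def)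
    have "good P (restr F V P t)"
      using V P(3)[OF that] W(1) s unfolding good_def by (simp add: F.restr_closed h_nat G.restr_restr)
    then show ?thesis ..
  qed
  then obtain r where r: "\<And>P. P \<in> \<P> \<Longrightarrow> good P (r P)" by metis
  obtain t where t: "t \<in> carrier (sections F W)" "\<And>P. P \<in> \<P> \<Longrightarrow> restr F W P t = r P"
    using F.glue_disjoint[of \<P> r] P r unfolding P(2) good_def by metis
  have "h W t = s"
  proof (rule G.separated[OF _ W(1) _ s])
    fix x assume "x \<in> W"
    then obtain P' where P': "P' \<in> \<P>" "x \<in> P'" using P(2) by blast
    then have "P' \<subseteq> W" using P(2) by blast
    then show "\<exists>V. openin T V \<and> x \<in> V \<and> V \<subseteq> W \<and> restr G W V (h W t) = restr G W V s"
      using P' P(3)[OF P'(1)] h_nat[OF W(1) _ _ t(1), of P'] t(2)[OF P'(1)] r[OF P'(1)]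
      by (intro exI[of _ P']) (simp add: good_def)
  qed (rule hom_in_carrier[OF h_hom[OF W(1)] t(1)])
  then show ?thesis using t(1) by blast
qed

text \<open>Refinements are demanded for nonempty \<open>A\<close> only. For empty \<open>A\<close>
  the overlap is the whole space, where failure to lift sections is what cohomology
  measures.\<close>

locale cech_resolution =
  fixes T :: "'a topology" and F :: "('a, 'c) sheaf_data" and I :: "nat \<Rightarrow> ('a, 'b) sheaf_data"
    and \<epsilon> d and D :: "nat \<Rightarrow> 'a set" and N :: nat
  assumes sheaf_F: "is_sheaf T F"
    and resolution: "injective_resolution T F I \<epsilon> d"
    and open_D: "\<And>i. openin T (D i)"
    and cover: "topspace T = (\<Union>i<N. D i)"
    and refine: "\<And>A. \<lbrakk>A \<subseteq> {..<N}; A \<noteq> {}\<rbrakk> \<Longrightarrow> ultraparacompact_in T (overlap D (topspace T) A)"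
begin

abbreviation X :: "'a set" where "X \<equiv> topspace T"
abbreviation "CI \<equiv> \<lambda>q p. cech_group (I q) D N X p"
abbreviation "CF \<equiv> \<lambda>p. cech_group F D N X p"
abbreviation "dv \<equiv> \<lambda>q p. cech_induced (d q) D N X p"
abbreviation "dh \<equiv> \<lambda>q p. cech_map (I q) D N X p"
abbreviation "e \<equiv> \<lambda>p. cech_induced \<epsilon> D N X p"
abbreviation "dF \<equiv> \<lambda>p. cech_map F D N X p"

lemma flasque_I: "flasque T (I q)"
  using resolution injective_imp_flasque by (auto simp: injective_resolution_def)

sublocale I: sheaf T "I q" for q
  by unfold_locales (use flasque_I in \<open>simp add: flasque_def\<close>)

sublocale F: sheaf T F
  by unfold_locales (rule sheaf_F)

lemma cover_I: "presheaf_cover T (I q) D"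
  by unfold_locales (rule open_D)

lemma cover_F: "presheaf_cover T F D"
  by unfold_locales (rule open_D)

lemma \<epsilon>_hom: "\<epsilon> \<in> sheaf_hom T F (I 0)" and \<epsilon>_inj: "openin T U \<Longrightarrow> inj_on (\<epsilon> U) (carrier (sections F U))"
  using resolution by (auto simp: injective_resolution_def sheaf_mono_def)

lemma d_hom: "d q \<in> sheaf_hom T (I q) (I (Suc q))"
  using resolution by (auto simp: injective_resolution_def)

lemma exact_zero: "sheaf_exact T F (I 0) (I (Suc 0)) \<epsilon> (d 0)"
  and exact_Suc: "sheaf_exact T (I q) (I (Suc q)) (I (Suc (Suc q))) (d q) (d (Suc q))"
  using resolution by (auto simp: injective_resolution_def)

lemma exact_comp:
  assumes "sheaf_exact T A B C f g" "f \<in> sheaf_hom T A B" "openin T U" "s \<in> carrier (sections A U)"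
    "\<And>t. t \<in> carrier (sections B U) \<Longrightarrow> restr B U U t = t"
  shows "g U (f U s) = \<one>\<^bsub>sections C U\<^esub>"
proof -
  have fs: "f U s \<in> carrier (sections B U)"
    using assms(2-4) hom_in_carrier by (fastforce simp: sheaf_hom_def)
  then have "in_image_sheaf T A B f U (f U s)"
    unfolding in_image_sheaf_def using assms(3,4,5) by (intro ballI exI[of _ U]) auto
  then show ?thesis using assms(1,3) fs unfolding sheaf_exact_def by blast
qed

lemma d_d: "d (Suc q) U (d q U s) = \<one>\<^bsub>sections (I (Suc (Suc q))) U\<^esub>"
  if "openin T U" "s \<in> carrier (sections (I q) U)"
  by (rule exact_comp[OF exact_Suc d_hom that]) (rule I.restr_id[OF that(1)])

lemma d_\<epsilon>: "d 0 U (\<epsilon> U s) = \<one>\<^bsub>sections (I (Suc 0)) U\<^esub>"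
  if "openin T U" "s \<in> carrier (sections F U)"
  by (rule exact_comp[OF exact_zero \<epsilon>_hom that]) (rule I.restr_id[OF that(1)])

lemma open_overlap: "A \<in> index_sets N p \<Longrightarrow> openin T (overlap D X A)"
  using openin_overlap[OF open_D openin_topspace] finite_subset[OF _ finite_lessThan]
  by (auto simp: index_sets_def)

lemma cech_induced_surj:
  assumes A: "sheaf T A" and B: "sheaf T B" and f: "f \<in> sheaf_hom T A B" and ex: "sheaf_exact T A B C f g"
    and x: "x \<in> carrier (cech_group B D N X (Suc p))"
    and gx: "cech_induced g D N X (Suc p) x = \<one>\<^bsub>cech_group C D N X (Suc p)\<^esub>"
  shows "\<exists>y \<in> carrier (cech_group A D N X (Suc p)). cech_induced f D N X (Suc p) y = x"
proof -
  have "\<exists>t \<in> carrier (sections A (overlap D X J)). f (overlap D X J) t = x J"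
    if J: "J \<in> index_sets N (Suc p)" for J
  proof (rule lift_section[OF A B f open_overlap[OF J]])
    show "ultraparacompact_in T (overlap D X J)"
      by (rule refine) (use J in \<open>auto simp: index_sets_def\<close>)
    show xJ: "x J \<in> carrier (sections B (overlap D X J))" using x J by (auto simp: cech_group_def)
    have "g (overlap D X J) (x J) = \<one>\<^bsub>sections C (overlap D X J)\<^esub>"
      using fun_cong[OF gx, of J] J by (simp add: cech_induced_def cech_group_def)
    then show "in_image_sheaf T A B f (overlap D X J) (x J)"
      using ex open_overlap[OF J] xJ unfolding sheaf_exact_def by blast
  qed
  then obtain y where y: "\<And>J. J \<in> index_sets N (Suc p) \<Longrightarrow>
      y J \<in> carrier (sections A (overlap D X J)) \<and> f (overlap D X J) (y J) = x J"
    by metis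
  show ?thesis
    by (rule bexI[of _ "restrict y (index_sets N (Suc p))"])
      (use y x in \<open>auto simp: cech_group_def cech_induced_def PiE_iff extensional_def fun_eq_iff\<close>)
qed

lemma cech_induced_comp:
  assumes "\<And>U s. \<lbrakk>openin T U; s \<in> carrier (sections A U)\<rbrakk> \<Longrightarrow> g U (f U s) = \<one>\<^bsub>sections C U\<^esub>"
    and x: "x \<in> carrier (cech_group A D N X p)"
  shows "cech_induced g D N X p (cech_induced f D N X p x) = \<one>\<^bsub>cech_group C D N X p\<^esub>"
proof -
  have "g (overlap D X J) (f (overlap D X J) (x J)) = \<one>\<^bsub>sections C (overlap D X J)\<^esub>" if "J \<in> index_sets N p" for J
    by (rule assms(1)[OF open_overlap[OF that]]) (use x that in \<open>auto simp: cech_group_def\<close>)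
  then show ?thesis by (auto simp: cech_induced_def cech_group_def intro!: restrict_ext)
qed

sublocale C: augmented_double_complex
  CI CF dv dh e dF
proof (rule augmented_double_complex.intro)
  fix q p :: nat
  show "comm_group (CI q p)"
    by (rule presheaf_cover.comm_group_cech_group[OF cover_I openin_topspace])
  show "comm_group (CF p)"
    by (rule presheaf_cover.comm_group_cech_group[OF cover_F openin_topspace])
  show "dv q p \<in> hom (CI q p) (CI (Suc q) p)"
    by (rule cech_induced_hom[OF cover_I openin_topspace d_hom])
  show "e p \<in> hom (CF p) (CI 0 p)"
    by (rule cech_induced_hom[OF cover_F openin_topspace \<epsilon>_hom])
  show "dh q p \<in> hom (CI q p) (CI q (Suc p))"
    by (rule presheaf_cover.cech_map_hom[OF cover_I openin_topspace])
  show "dF p \<in> hom (CF p) (CF (Suc p))"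
    by (rule presheaf_cover.cech_map_hom[OF cover_F openin_topspace])
  show "inj_on (e p) (carrier (CF p))"
  proof (rule inj_onI, rule ext)
    fix x y A
    assume xy: "x \<in> carrier (CF p)" "y \<in> carrier (CF p)"
      "e p x = e p y"
    show "x A = y A"
    proof (cases "A \<in> index_sets N p")
      case True
      then have "\<epsilon> (overlap D X A) (x A) = \<epsilon> (overlap D X A) (y A)"
        using fun_cong[OF xy(3), of A] by (simp add: cech_induced_def)
      then show ?thesis
        using inj_onD[OF \<epsilon>_inj[OF open_overlap[OF True]]] xy(1,2) True by (auto simp: cech_group_def)
    next
      case False
      then show ?thesis using xy(1,2) by (auto simp: cech_group_def PiE_iff extensional_def)
    qed
  qed
next
  fix q p :: nat and x assume x: "x \<in> carrier (CI q p)"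
  show "dv (Suc q) p (dv q p x) = \<one>\<^bsub>CI (Suc (Suc q)) p\<^esub>"
    by (rule cech_induced_comp[OF _ x], rule d_d)
  show "dh q (Suc p) (dh q p x) = \<one>\<^bsub>CI q (Suc (Suc p))\<^esub>"
    by (rule presheaf_cover.cech_map_cech_map[OF cover_I openin_topspace x])
  show "dv q (Suc p) (dh q p x) =
      dh (Suc q) p (dv q p x)"
    by (rule cech_induced_cech_map[OF cover_I cover_I openin_topspace d_hom x])
next
  fix p :: nat and c assume c: "c \<in> carrier (CF p)"
  show "dv 0 p (e p c) = \<one>\<^bsub>CI (Suc 0) p\<^esub>"
    by (rule cech_induced_comp[OF _ c], rule d_\<epsilon>)
  show "e (Suc p) (dF p c) =
      dh 0 p (e p c)"
    by (rule cech_induced_cech_map[OF cover_F cover_I openin_topspace \<epsilon>_hom c])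
next
  fix q x
  assume "x \<in> carrier (CI q 0)" "dh q 0 x = \<one>\<^bsub>CI q (Suc 0)\<^esub>"
  then show "x = \<one>\<^bsub>CI q 0\<^esub>"
    using presheaf_cover.cech_map_exact_zero[OF cover_I openin_topspace flasque_I] cover by blast
next
  fix q p x
  assume "x \<in> carrier (CI q (Suc p))"
    "dh q (Suc p) x = \<one>\<^bsub>CI q (Suc (Suc p))\<^esub>"
  then show "\<exists>y\<in>carrier (CI q p). dh q p y = x"
    using presheaf_cover.cech_map_exact[OF cover_I openin_topspace flasque_I] cover by blast
next
  fix p x
  assume "x \<in> carrier (CI 0 (Suc p))"
    "dv 0 (Suc p) x = \<one>\<^bsub>CI (Suc 0) (Suc p)\<^esub>"
  then show "\<exists>c\<in>carrier (CF (Suc p)). e (Suc p) c = x"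
    by (rule cech_induced_surj[OF F.sheaf_axioms I.sheaf_axioms \<epsilon>_hom exact_zero])
next
  fix q p x
  assume "x \<in> carrier (CI (Suc q) (Suc p))"
    "dv (Suc q) (Suc p) x = \<one>\<^bsub>CI (Suc (Suc q)) (Suc p)\<^esub>"
  then show "\<exists>y\<in>carrier (CI q (Suc p)). dv q (Suc p) y = x"
    by (rule cech_induced_surj[OF I.sheaf_axioms I.sheaf_axioms d_hom exact_Suc])
qed

section \<open>Comparison of Cech cocycles with cycles of global sections\<close>

abbreviation cocycle :: "nat \<Rightarrow> (nat set \<Rightarrow> 'c) \<Rightarrow> bool" where
  "cocycle m c \<equiv> c \<in> carrier (CF (Suc m)) \<and>
     dF (Suc m) c = \<one>\<^bsub>CF (Suc (Suc m))\<^esub>"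

definition cycles :: "nat \<Rightarrow> 'b monoid" where
  "cycles m = (sections (I m) X)\<lparr>carrier := kernel (sections (I m) X) (sections (I (Suc m)) X) (d m X)\<rparr>"

text \<open>A zigzag ends at \<open>p = 0\<close>, where a cochain is a function on the single index
  set \<open>{}\<close>, that is, one global section \<open>z\<close>.\<close>

definition represents :: "nat \<Rightarrow> (nat set \<Rightarrow> 'c) \<Rightarrow> 'b \<Rightarrow> bool" where
  "represents m c z \<longleftrightarrow> C.link m 0 c (\<lambda>A\<in>{{}}. z)"

lemma d_global_hom: "d m X \<in> hom (sections (I m) X) (sections (I (Suc m)) X)"
  using d_hom[of m] by (simp add: sheaf_hom_def)

lemma d_group_hom: "group_hom (sections (I m) X) (sections (I (Suc m)) X) (d m X)"
  by (simp add: group_hom_def group_hom_axioms_def I.group_sections d_global_hom)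

lemma cycles_subgroup: "subgroup (carrier (cycles m)) (sections (I m) X)"
  using group_hom.subgroup_kernel[OF d_group_hom] by (simp add: cycles_def)

lemma comm_group_cycles: "comm_group (cycles m)"
proof -
  interpret G: comm_group "sections (I m) X" by (rule I.comm_group_sections[OF openin_topspace])
  have "group (cycles m)"
    using G.subgroup_imp_group[OF cycles_subgroup] by (simp add: cycles_def)
  then show ?thesis
    by (rule group.group_comm_groupI) (simp add: cycles_def kernel_def G.m_comm)
qed

lemma group_cycles: "group (cycles m)"
  using comm_group_cycles comm_group.axioms(2) by blast

lemma global_coboundaries_subgroup: "subgroup (global_coboundaries T I d m) (cycles m)"
proof -
  have "subgroup (global_coboundaries T I d m) (sections (I m) X)"
    using group.triv_subgroup[OF I.group_sections[OF openin_topspace, of 0]] group_hom.img_is_subgroup[OF d_group_hom]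
    by (cases m) (auto simp: global_coboundaries_def)
  moreover have "global_coboundaries T I d m \<subseteq> carrier (cycles m)"
  proof (cases m)
    case 0
    then show ?thesis
      using group_hom.hom_one[OF d_group_hom[of 0]] group.is_monoid[OF I.group_sections[OF openin_topspace, of 0]]
      by (auto simp: global_coboundaries_def cycles_def kernel_def monoid.one_closed)
  next
    case (Suc q)
    then show ?thesis
      using d_d[OF openin_topspace] group_hom.hom_closed[OF d_group_hom]
      by (auto simp: global_coboundaries_def cycles_def kernel_def)
  qed
  ultimately show ?thesis
    using group.subgroup_incl[OF I.group_sections[OF openin_topspace] _ cycles_subgroup]
    by (simp add: cycles_def)
qed

lemma global_cohomology_eq: "global_cohomology T I d (int m) = cycles m Mod global_coboundaries T I d m"
  by (simp add: global_cohomology_def cycles_def Let_def)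

lemma represents_mult:
  assumes "represents m c z" "represents m c' z'"
  shows "represents m (c \<otimes>\<^bsub>CF (Suc m)\<^esub> c') (z \<otimes>\<^bsub>cycles m\<^esub> z')"
proof -
  have "(\<lambda>A\<in>{{}}. z) \<otimes>\<^bsub>CI m 0\<^esub> (\<lambda>A\<in>{{}}. z') = (\<lambda>A\<in>{{}}. z \<otimes>\<^bsub>cycles m\<^esub> z')"
    by (auto simp: cech_group_def index_sets_zero cycles_def intro!: restrict_ext)
  then show ?thesis using C.link_mult[of m 0] assms unfolding represents_def by fastforce
qed

lemma inv_cycles:
  "z \<in> carrier (cycles m) \<Longrightarrow> inv\<^bsub>cycles m\<^esub> z = inv\<^bsub>sections (I m) X\<^esub> z"
  using group.m_inv_consistent[OF I.group_sections[OF openin_topspace] cycles_subgroup]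
  by (simp add: cycles_def)

lemma represents_inv:
  assumes "represents m c z" "z \<in> carrier (cycles m)"
  shows "represents m (inv\<^bsub>CF (Suc m)\<^esub> c) (inv\<^bsub>cycles m\<^esub> z)"
proof -
  have z: "(\<lambda>A\<in>{{}}. z) \<in> carrier (CI m 0)"
    using assms(2) by (auto simp: cech_group_def index_sets_zero cycles_def kernel_def)
  have "inv\<^bsub>CI m 0\<^esub> (\<lambda>A\<in>{{}}. z) = (\<lambda>A\<in>{{}}. inv\<^bsub>sections (I m) X\<^esub> z)"
    using inv_product_group[OF z[unfolded cech_group_def carrier_product_group]] I.group_sections[OF openin_topspace]
    by (auto simp: cech_group_def index_sets_zero intro!: restrict_ext)
  then show ?thesis using C.link_inv[of m 0] assms(1) unfolding represents_def inv_cycles[OF assms(2)] by fastforce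
qed

lemma in_boundaries_iff:
  "(\<lambda>A\<in>{{}}. z) \<in> C.boundaries m \<longleftrightarrow> z \<in> global_coboundaries T I d m"
proof (cases m)
  case 0
  then show ?thesis
    unfolding C.boundaries_def global_coboundaries_def
    by (auto simp: cech_group_def index_sets_zero fun_eq_iff)
next
  case (Suc q)
  have "(\<exists>x\<in>carrier (CI q 0). (\<lambda>A\<in>{{}}. z) = dv q 0 x) \<longleftrightarrow>
      (\<exists>y\<in>carrier (sections (I q) X). z = d q X y)"
  proof
    assume "\<exists>x\<in>carrier (CI q 0). (\<lambda>A\<in>{{}}. z) = dv q 0 x"
    then obtain x where x: "x \<in> carrier (CI q 0)" "(\<lambda>A\<in>{{}}. z) = dv q 0 x"
      by blast
    have "z = d q X (x {})"
      using fun_cong[OF x(2), of "{}"] by (simp add: cech_induced_def index_sets_zero)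
    moreover have "x {} \<in> carrier (sections (I q) X)"
      using x(1) by (simp add: cech_group_def index_sets_zero PiE_iff)
    ultimately show "\<exists>y\<in>carrier (sections (I q) X). z = d q X y" by blast
  next
    assume "\<exists>y\<in>carrier (sections (I q) X). z = d q X y"
    then obtain y where "y \<in> carrier (sections (I q) X)" "z = d q X y" by blast
    then show "\<exists>x\<in>carrier (CI q 0). (\<lambda>A\<in>{{}}. z) = dv q 0 x"
      by (intro bexI[of _ "\<lambda>A\<in>{{}::nat set}. y"]) (auto simp: cech_group_def index_sets_zero cech_induced_def fun_eq_iff)
  qed
  then show ?thesis unfolding C.boundaries_def global_coboundaries_def by (simp add: Suc image_iff)
qed

text \<open>With \<open>represents_mult\<close>, \<open>cocycle_represents\<close> and
  \<open>cycle_represented\<close>, this makes \<open>represents\<close> the graph, modulo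
  coboundaries, of an isomorphism between Cech and sheaf cohomology.\<close>

lemma represents_boundary_iff:
  "represents m c z \<Longrightarrow> c \<in> C.coboundaries m \<longleftrightarrow> z \<in> global_coboundaries T I d m"
  using C.link_boundary_iff in_boundaries_iff unfolding represents_def by blast

lemma global_section_cochain:
  assumes "x \<in> carrier (CI m 0)"
  shows "x = (\<lambda>A\<in>{{}}. x {})"
  using assms by (auto simp: cech_group_def index_sets_zero PiE_iff extensional_def fun_eq_iff)

lemma cycles_iff:
  "z \<in> carrier (cycles m) \<longleftrightarrow> (\<lambda>A\<in>{{}}. z) \<in> carrier (CI m 0) \<and>
     dv m 0 (\<lambda>A\<in>{{}}. z) = \<one>\<^bsub>CI (Suc m) 0\<^esub>"
  by (auto simp: cycles_def kernel_def cech_group_def index_sets_zero cech_induced_def fun_eq_iff)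

lemma cocycle_represents:
  assumes "cocycle m c"
  obtains z where "represents m c z" "z \<in> carrier (cycles m)"
proof -
  obtain x where x: "C.link m 0 c x" "dv m 0 x = \<one>\<^bsub>CI (Suc m) 0\<^esub>"
    using C.cocycle_lifts assms by blast
  have "x \<in> carrier (CI m 0)" using C.link_closed[OF x(1)] by blast
  then show thesis
    using that[of "x {}"] x global_section_cochain unfolding represents_def cycles_iff by metis
qed

lemma cycle_represented:
  assumes "z \<in> carrier (cycles m)"
  obtains c where "represents m c z" "cocycle m c"
  using C.cocycle_descends assms unfolding cycles_iff represents_def by metis

end

section \<open>Constant sheaves as sheaves of locally constant functions\<close>

lemma continuous_map_discrete_locally_constant:
  assumes "openin T U"
  shows "continuous_map (subtopology T U) (discrete_topology S) f \<longleftrightarrow>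
    f \<in> U \<rightarrow> S \<and> (\<forall>x\<in>U. \<exists>W c. openin T W \<and> x \<in> W \<and> W \<subseteq> U \<and> (\<forall>y\<in>W. f y = c))"
    (is "?cont \<longleftrightarrow> ?S \<and> ?loc")
proof -
  have top: "topspace (subtopology T U) = U" using openin_subset[OF assms] by auto
  have "?cont \<Longrightarrow> ?loc"
  proof (intro ballI)
    fix x assume c: ?cont and x: "x \<in> U"
    let ?W = "{y \<in> U. f y \<in> {f x}}"
    have "f x \<in> S" using continuous_map_image_subset_topspace[OF c] x top by auto
    then have "openin (subtopology T U) ?W"
      using openin_continuous_map_preimage[OF c, of "{f x}", unfolded top] by simp
    then have "openin T ?W" using assms openin_open_subtopology by blast
    then show "\<exists>W c. openin T W \<and> x \<in> W \<and> W \<subseteq> U \<and> (\<forall>y\<in>W. f y = c)"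
      using x by (intro exI[of _ ?W] exI[of _ "f x"]) auto
  qed
  moreover have "?cont \<Longrightarrow> ?S"
    using continuous_map_image_subset_topspace top by fastforce
  moreover have ?cont if S: ?S and loc: ?loc
    unfolding continuous_map_def top
  proof (intro conjI allI impI)
    show "f \<in> U \<rightarrow> topspace (discrete_topology S)" using S by simp
    fix V
    have "openin T {x \<in> U. f x \<in> V}"
    proof (subst openin_subopen, intro ballI)
      fix x assume x: "x \<in> {x \<in> U. f x \<in> V}"
      then have "x \<in> U" by simp
      then obtain W c where "openin T W" "x \<in> W" "W \<subseteq> U" "\<And>y. y \<in> W \<Longrightarrow> f y = c"
        using bspec[OF loc] by metis
      with x show "\<exists>W. openin T W \<and> x \<in> W \<and> W \<subseteq> {x \<in> U. f x \<in> V}"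
        by (intro exI[of _ W]) auto
    qed
    then show "openin (subtopology T U) {x \<in> U. f x \<in> V}"
      using assms openin_open_subtopology by blast
  qed
  ultimately show ?thesis by blast
qed

text \<open>With the whole space as permitted support the vanishing condition is empty, so the sheaf
  property proved for extensions by zero carries over.\<close>

lemma constant_sheaf_sections:
  assumes "openin T U"
  shows "sections (constant_sheaf T A) U = sections (loc_sheaf T A (topspace T)) U"
proof -
  have "U - topspace T = {}" using openin_subset[OF assms] by auto
  then show ?thesis
    unfolding constant_sheaf_def loc_sheaf_def loc_sections_def
    by (auto simp: continuous_map_discrete_locally_constant[OF assms] PiE_def)
qed

lemma is_sheaf_cong:
  assumes "\<And>U. openin T U \<Longrightarrow> sections F U = sections G U" "restr F = restr G" "is_sheaf T G"
  shows "is_sheaf T F"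
proof -
  have "is_presheaf T F"
    using assms(1,2) assms(3)[unfolded is_sheaf_def, THEN conjunct1] unfolding is_presheaf_def
    by (elim conjE) (intro conjI allI impI; simp)
  moreover have "\<exists>!t. t \<in> carrier (sections F (\<Union>\<U>)) \<and> (\<forall>U\<in>\<U>. restr F (\<Union>\<U>) U t = s U)"
    if h: "(\<forall>U\<in>\<U>. openin T U \<and> s U \<in> carrier (sections F U)) \<and>
      (\<forall>U\<in>\<U>. \<forall>V\<in>\<U>. restr F U (U \<inter> V) (s U) = restr F V (U \<inter> V) (s V))" for \<U> s
  proof -
    have "(\<forall>U\<in>\<U>. openin T U \<and> s U \<in> carrier (sections G U)) \<and>
      (\<forall>U\<in>\<U>. \<forall>V\<in>\<U>. restr G U (U \<inter> V) (s U) = restr G V (U \<inter> V) (s V))"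
      using h assms(1) unfolding assms(2) by (metis (full_types))
    then have "\<exists>!t. t \<in> carrier (sections G (\<Union>\<U>)) \<and> (\<forall>U\<in>\<U>. restr G (\<Union>\<U>) U t = s U)"
      by (rule assms(3)[unfolded is_sheaf_def, THEN conjunct2, rule_format])
    moreover have "openin T (\<Union>\<U>)" using h by blast
    ultimately show ?thesis using assms(1,2) by simp
  qed
  ultimately show ?thesis unfolding is_sheaf_def by (intro conjI allI impI)
qed

lemma is_sheaf_constant_sheaf:
  assumes "comm_group A" shows "is_sheaf T (constant_sheaf T A)"
  by (rule is_sheaf_cong[OF constant_sheaf_sections _ is_sheaf_loc_sheaf[OF assms]])
    (simp_all add: constant_sheaf_def loc_sheaf_def)

section \<open>Cech cochains with values in the integers modulo 2\<close>

abbreviation (input) Z2_sheaf :: "'a topology \<Rightarrow> ('a, 'a \<Rightarrow> int) sheaf_data" where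
  "Z2_sheaf T \<equiv> constant_sheaf T (integer_mod_group 2)"

lemma is_sheaf_Z2: "is_sheaf T (Z2_sheaf T)"
  by (rule is_sheaf_constant_sheaf) simp

lemma restr_Z2 [simp]: "restr (Z2_sheaf T) U V f = restrict f V"
  by (simp add: constant_sheaf_def)

lemma mult_Z2 [simp]: "f \<otimes>\<^bsub>sections (Z2_sheaf T) U\<^esub> g = (\<lambda>x\<in>U. (f x + g x) mod 2)"
  by (simp add: constant_sheaf_def)

lemma one_Z2 [simp]: "\<one>\<^bsub>sections (Z2_sheaf T) U\<^esub> = (\<lambda>x\<in>U. 0)"
  by (simp add: constant_sheaf_def)

lemma Z2_sections_iff:
  assumes "openin T U"
  shows "f \<in> carrier (sections (Z2_sheaf T) U) \<longleftrightarrow> f \<in> U \<rightarrow>\<^sub>E {0..<2} \<and>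
    (\<forall>x\<in>U. \<exists>W c. openin T W \<and> x \<in> W \<and> W \<subseteq> U \<and> (\<forall>y\<in>W. f y = c))"
  using assms
  by (auto simp: constant_sheaf_def continuous_map_discrete_locally_constant[OF assms]
      carrier_integer_mod_group PiE_def)

lemma Z2_value:
  assumes "f \<in> carrier (sections (Z2_sheaf T) U)" "openin T U" "x \<in> U"
  shows "f x = 0 \<or> f x = 1"
proof -
  have "f x \<in> {0..<2}" using assms by (auto simp: Z2_sections_iff)
  then show ?thesis by auto
qed

lemma Z2_self_inverse:
  assumes f: "f \<in> carrier (sections (Z2_sheaf T) U)" and U: "openin T U"
  shows "inv\<^bsub>sections (Z2_sheaf T) U\<^esub> f = f"
proof (rule group.inv_equality)
  interpret sheaf T "Z2_sheaf T" by unfold_locales (rule is_sheaf_Z2)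
  show "group (sections (Z2_sheaf T) U)" by (rule group_sections[OF U])
  show "f \<otimes>\<^bsub>sections (Z2_sheaf T) U\<^esub> f = \<one>\<^bsub>sections (Z2_sheaf T) U\<^esub>"
    using Z2_value[OF f U] by (auto intro!: restrict_ext)
qed (use f in auto)

text \<open>Sections are their own inverses mod 2, so the inverse in the recursion disappears and
  unfolding collects one summand per face, without signs.\<close>

lemma Z2_cech_diff:
  assumes D: "\<And>i. openin T (D i)"
  shows "\<lbrakk>openin T W; A \<subseteq> {..<m}; \<And>B. B \<subseteq> A \<Longrightarrow> a B \<in> carrier (sections (Z2_sheaf T) (overlap D W B));
      x \<in> overlap D W A\<rbrakk> \<Longrightarrow>
    cech_diff (Z2_sheaf T) D m W a A x = (\<Sum>i\<in>A. a (A - {i}) x) mod 2"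
proof (induction m arbitrary: W a A)
  case (Suc m)
  interpret presheaf_cover T "Z2_sheaf T" D
    using is_sheaf_Z2 D by unfold_locales (auto simp only: is_sheaf_def)
  from Suc.prems(2) show ?case
  proof (cases rule: subset_lessThan_Suc_cases)
    case sub
    then show ?thesis using Suc by (simp only: cech_diff_sub)
  next
    case (ins B)
    have c: "cochain (W \<inter> D m) B (\<lambda>C. a (insert m C))"
      using cochain_insert[of W m B a] Suc.prems(3) ins(2) by (simp add: cochain_def)
    have op: "openin T (W \<inter> D m)" using Suc.prems(1) open_Int_cover by blast
    have ov: "openin T (ov (W \<inter> D m) B)" by (rule open_ov[OF op ins(1)])
    have x: "x \<in> ov (W \<inter> D m) B" using Suc.prems(4) ins(2) overlap_insert by metis
    have B: "finite B" "m \<notin> B" "insert m B - {m} = B" using ins(1) finite_subset by auto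
    let ?d = "cech_diff (Z2_sheaf T) D m (W \<inter> D m) (\<lambda>C. a (insert m C)) B"
    have "?d x = (\<Sum>i\<in>B. a (insert m (B - {i})) x) mod 2"
      by (rule Suc.IH[OF op ins(1) _ x]) (use c in \<open>simp add: cochain_def\<close>)
    also have "(\<Sum>i\<in>B. a (insert m (B - {i})) x) = (\<Sum>i\<in>B. a (A - {i}) x)"
      unfolding ins(2) using B(2) by (intro sum.cong refl) (metis insert_Diff_if singletonD)
    finally have d: "?d x = (\<Sum>i\<in>B. a (A - {i}) x) mod 2" .
    have "cech_diff (Z2_sheaf T) D (Suc m) W a A x = (a B x + ?d x) mod 2"
      unfolding ins(2) cech_diff_insert[OF ins(1)] Z2_self_inverse[OF cech_diff_closed[OF op ins(1) c] ov]
      using x by simp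
    also have "\<dots> = (\<Sum>i\<in>A. a (A - {i}) x) mod 2"
      unfolding d using B by (simp add: ins(2) mod_add_right_eq)
    finally show ?thesis .
  qed
qed simp

lemma Z2_cech_map:
  assumes D: "\<And>i. openin T (D i)" and X: "openin T X"
    and c: "c \<in> carrier (cech_group (Z2_sheaf T) D N X p)"
    and A: "A \<in> index_sets N (Suc p)" and x: "x \<in> overlap D X A"
  shows "cech_map (Z2_sheaf T) D N X p c A x = (\<Sum>i\<in>A. c (A - {i}) x) mod 2"
proof -
  interpret presheaf_cover T "Z2_sheaf T" D
    using is_sheaf_Z2 D by unfold_locales (auto simp only: is_sheaf_def)
  have sub: "A \<subseteq> {..<N}" using A by (simp add: index_sets_def)
  have "cech_map (Z2_sheaf T) D N X p c A x =
      (\<Sum>i\<in>A. extend_cochain (Z2_sheaf T) D N X p c (A - {i}) x) mod 2"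
    using A Z2_cech_diff[OF D X sub cochainD[OF cochain_extend[OF X c sub]] x]
    by (simp add: cech_map_def)
  also have "(\<Sum>i\<in>A. extend_cochain (Z2_sheaf T) D N X p c (A - {i}) x) = (\<Sum>i\<in>A. c (A - {i}) x)"
    using index_sets_remove[OF A] by (intro sum.cong) (auto simp: extend_cochain_def)
  finally show ?thesis .
qed

lemma Z2_cech_self_inverse:
  assumes "\<And>i. openin T (D i)" "openin T X" "c \<in> carrier (cech_group (Z2_sheaf T) D N X p)"
  shows "c \<otimes>\<^bsub>cech_group (Z2_sheaf T) D N X p\<^esub> c = \<one>\<^bsub>cech_group (Z2_sheaf T) D N X p\<^esub>"
proof -
  have "(\<lambda>x\<in>overlap D X A. (c A x + c A x) mod 2) = (\<lambda>x\<in>overlap D X A. 0)" if "A \<in> index_sets N p" for A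
    by (intro restrict_ext) simp
  then show ?thesis by (auto simp: cech_group_def intro!: restrict_ext)
qed

section \<open>Topology of products of one-point compactifications\<close>

abbreviation \<alpha> :: "'k set \<Rightarrow> 'k option topology" where
  "\<alpha> K \<equiv> Alexandroff_compactification (discrete_topology K)"

lemma openin_Alexandroff_discrete:
  "openin (\<alpha> K) V \<longleftrightarrow>
     V \<subseteq> insert None (Some ` K) \<and> (None \<in> V \<longrightarrow> finite {k \<in> K. Some k \<notin> V})"
proof
  assume "openin (\<alpha> K) V"
  then consider S where "S \<subseteq> K" "V = Some ` S"
    | C where "finite C" "C \<subseteq> K" "V = insert None (Some ` (K - C))"
    by (auto simp: openin_Alexandroff_compactification compactin_discrete_topology)
  then show "V \<subseteq> insert None (Some ` K) \<and> (None \<in> V \<longrightarrow> finite {k \<in> K. Some k \<notin> V})"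
  proof cases
    case 2
    then have "{k \<in> K. Some k \<notin> V} \<subseteq> C" by auto
    then show ?thesis using 2 finite_subset by auto
  qed auto
next
  assume V: "V \<subseteq> insert None (Some ` K) \<and> (None \<in> V \<longrightarrow> finite {k \<in> K. Some k \<notin> V})"
  show "openin (\<alpha> K) V"
  proof (cases "None \<in> V")
    case True
    then have "V = insert None (Some ` (K - {k \<in> K. Some k \<notin> V}))" using V by auto
    moreover have "finite {k \<in> K. Some k \<notin> V}" using V True by blast
    ultimately show ?thesis
      unfolding openin_Alexandroff_compactification
      by (intro disjI2 exI[of _ "{k \<in> K. Some k \<notin> V}"])
        (auto simp: compactin_discrete_topology)
  next
    case False
    then have "V = Some ` {k \<in> K. Some k \<in> V}" using V by auto
    then show ?thesis
      unfolding openin_Alexandroff_compactification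
      by (intro disjI1 exI[of _ "{k \<in> K. Some k \<in> V}"]) auto
  qed
qed

lemma closedin_Alexandroff_singleton:
  assumes "k \<in> K" shows "closedin (\<alpha> K) {Some k}"
proof -
  have "{l \<in> K. Some l \<notin> insert None (Some ` K) - {Some k}} \<subseteq> {k}" by auto
  then show ?thesis
    using assms by (auto simp: closedin_def openin_Alexandroff_discrete intro: finite_subset)
qed

text \<open>An open set containing \<open>None\<close> is already closed, because its complement
  consists of isolated points; at a finite point the singleton is clopen.\<close>

lemma clopen_base_Alexandroff:
  assumes "openin (\<alpha> K) V" "v \<in> V"
  obtains C where "openin (\<alpha> K) C"
    "closedin (\<alpha> K) C" "v \<in> C" "C \<subseteq> V"
proof (cases v)
  case None
  then have "closedin (\<alpha> K) V"
    using assms openin_subset[OF assms(1)] by (auto simp: closedin_def openin_Alexandroff_discrete)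
  then show thesis using that assms by blast
next
  case (Some k)
  then have "k \<in> K" using assms openin_subset[OF assms(1)] by auto
  then show thesis
    using that[of "{Some k}"] closedin_Alexandroff_singleton[of k K] Some assms
    by (auto simp: openin_Alexandroff_discrete)
qed

lemma topspace_X_space: "topspace (X_space n K) = (\<Pi>\<^sub>E i\<in>{..n}. insert None (Some ` K i))"
  by (simp add: X_space_def)

lemma compact_X_space: "compact_space (X_space n K)"
  by (simp add: X_space_def compact_space_product_topology)

lemma clopen_base_X_space:
  assumes "openin (X_space n K) U" "x \<in> U"
  obtains C where "openin (X_space n K) C" "closedin (X_space n K) C" "x \<in> C" "C \<subseteq> U"
proof -
  let ?T = "\<lambda>i. \<alpha> (K i)"
  obtain B where B: "x \<in> (\<Pi>\<^sub>E i\<in>{..n}. B i)" "\<And>i. openin (?T i) (B i)" "(\<Pi>\<^sub>E i\<in>{..n}. B i) \<subseteq> U"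
    using product_topology_open_contains_basis[OF assms[unfolded X_space_def]] by auto
  have "\<exists>C. openin (?T i) C \<and> closedin (?T i) C \<and> x i \<in> C \<and> C \<subseteq> B i" if "i \<le> n" for i
    using clopen_base_Alexandroff[OF B(2), of "x i" i] B(1) that by (metis PiE_mem atMost_iff)
  then obtain C where C: "\<And>i. i \<le> n \<Longrightarrow> openin (?T i) (C i) \<and> closedin (?T i) (C i) \<and> x i \<in> C i \<and> C i \<subseteq> B i"
    by metis
  show thesis
  proof (rule that[of "\<Pi>\<^sub>E i\<in>{..n}. C i"])
    show "openin (X_space n K) (\<Pi>\<^sub>E i\<in>{..n}. C i)"
      unfolding X_space_def by (rule iffD2[OF openin_PiE_gen]) (use C in simp)
    show "closedin (X_space n K) (\<Pi>\<^sub>E i\<in>{..n}. C i)"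
      unfolding X_space_def closedin_product_topology
    proof (intro disjI2 ballI)
      fix i assume "i \<in> {..n}"
      then show "closedin (?T i) (C i)" using C[of i] by simp
    qed
    show "x \<in> (\<Pi>\<^sub>E i\<in>{..n}. C i)" using B(1) C by (auto simp: PiE_iff)
    have "(\<Pi>\<^sub>E i\<in>{..n}. C i) \<subseteq> (\<Pi>\<^sub>E i\<in>{..n}. B i)" by (rule PiE_mono) (use C in simp)
    with B(3) show "(\<Pi>\<^sub>E i\<in>{..n}. C i) \<subseteq> U" by (rule order_trans[rotated])
  qed
qed

section \<open>Disjoint open refinements of covers\<close>

lemma clopen_disjoint_refinement:
  assumes "finite \<B>" "\<And>B. B \<in> \<B> \<Longrightarrow> openin X B \<and> closedin X B"
  shows "\<exists>\<P>. pairwise disjnt \<P> \<and> \<Union>\<P> = \<Union>\<B> \<and> (\<forall>P\<in>\<P>. openin X P \<and> (\<exists>B\<in>\<B>. P \<subseteq> B))"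
  using assms
proof (induction \<B>)
  case empty
  then show ?case by (intro exI[of _ "{}"]) auto
next
  case (insert B \<B>)
  then obtain \<P> where P: "pairwise disjnt \<P>" "\<Union>\<P> = \<Union>\<B>"
      "\<And>P. P \<in> \<P> \<Longrightarrow> openin X P \<and> (\<exists>B\<in>\<B>. P \<subseteq> B)" by auto
  \<comment> \<open>A finite union of clopen sets is closed, so what remains of \<open>B\<close>
    after removing it is still open.\<close>
  have "closedin X (\<Union>\<B>)" using insert by (intro closedin_Union) auto
  then have "openin X (B - \<Union>\<B>)" using insert.prems by (intro openin_diff) auto
  moreover have "disjnt P (B - \<Union>\<B>)" "disjnt (B - \<Union>\<B>) P" if "P \<in> \<P>" for P
    using that P(2) by (auto simp: disjnt_def)
  ultimately show ?case
    using P by (intro exI[of _ "insert (B - \<Union>\<B>) \<P>"]) (auto simp: pairwise_insert)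
qed

text \<open>Clopen subsets of \<open>E\<close> inside members of the cover form a cover of
  \<open>E\<close>; compactness leaves finitely many, and these can be made disjoint.\<close>

lemma ultraparacompact_compact:
  assumes E: "compactin X E" "openin X E"
    and base: "\<And>U x. \<lbrakk>openin X U; x \<in> U\<rbrakk> \<Longrightarrow> \<exists>C. openin X C \<and> closedin X C \<and> x \<in> C \<and> C \<subseteq> U"
  shows "ultraparacompact_in X E"
  unfolding ultraparacompact_in_def
proof (intro allI impI)
  fix \<V> assume V: "(\<forall>V\<in>\<V>. openin X V) \<and> E \<subseteq> \<Union>\<V>"
  define \<C> where "\<C> = {C. openin X C \<and> closedin X C \<and> C \<subseteq> E \<and> (\<exists>V\<in>\<V>. C \<subseteq> V)}"
  have "E \<subseteq> \<Union>\<C>"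
  proof
    fix x assume "x \<in> E"
    then obtain V where "V \<in> \<V>" "x \<in> V" using V by blast
    then obtain C where "openin X C" "closedin X C" "x \<in> C" "C \<subseteq> E \<inter> V"
      using base[of "E \<inter> V" x] E(2) V \<open>x \<in> E\<close> by auto
    then show "x \<in> \<Union>\<C>" using \<open>V \<in> \<V>\<close> by (auto simp: \<C>_def)
  qed
  moreover have "\<forall>C\<in>\<C>. openin X C" by (auto simp: \<C>_def)
  ultimately obtain \<B> where B: "finite \<B>" "\<B> \<subseteq> \<C>" "E \<subseteq> \<Union>\<B>"
    using E(1) unfolding compactin_def by metis
  then have "\<Union>\<B> = E" by (auto simp: \<C>_def)
  moreover have "\<And>B. B \<in> \<B> \<Longrightarrow> openin X B \<and> closedin X B \<and> (\<exists>V\<in>\<V>. B \<subseteq> V)"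
    using B(2) by (auto simp: \<C>_def)
  moreover from this obtain \<P> where "pairwise disjnt \<P>" "\<Union>\<P> = \<Union>\<B>"
      "\<And>P. P \<in> \<P> \<Longrightarrow> openin X P \<and> (\<exists>B\<in>\<B>. P \<subseteq> B)"
    using clopen_disjoint_refinement[OF B(1)] by metis
  ultimately show "\<exists>\<P>. pairwise disjnt \<P> \<and> \<Union>\<P> = E \<and> (\<forall>P\<in>\<P>. openin X P \<and> (\<exists>V\<in>\<V>. P \<subseteq> V))"
    by (intro exI[of _ \<P>]) (metis subset_trans)
qed

text \<open>The members of the family are refined separately. Pieces from different members are
  disjoint because the members are, which is how noncompact sets such as \<open>D_set\<close> are
  reached.\<close>

lemma ultraparacompact_Union:
  assumes disj: "pairwise disjnt \<E>" and E: "\<And>E. E \<in> \<E> \<Longrightarrow> ultraparacompact_in X E"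
  shows "ultraparacompact_in X (\<Union>\<E>)"
  unfolding ultraparacompact_in_def
proof (intro allI impI)
  fix \<V> assume V: "(\<forall>V\<in>\<V>. openin X V) \<and> \<Union>\<E> \<subseteq> \<Union>\<V>"
  have "\<exists>\<P>. pairwise disjnt \<P> \<and> \<Union>\<P> = E \<and> (\<forall>P\<in>\<P>. openin X P \<and> (\<exists>V\<in>\<V>. P \<subseteq> V))"
    if "E \<in> \<E>" for E
    using E[OF that, unfolded ultraparacompact_in_def, rule_format, of \<V>] V that by blast
  then obtain \<P> where P: "\<And>E. E \<in> \<E> \<Longrightarrow> pairwise disjnt (\<P> E) \<and> \<Union>(\<P> E) = E \<and>
      (\<forall>P\<in>\<P> E. openin X P \<and> (\<exists>V\<in>\<V>. P \<subseteq> V))"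
    by metis
  have "pairwise disjnt (\<Union>(\<P> ` \<E>))"
  proof (rule pairwiseI)
    fix P Q assume "P \<in> \<Union>(\<P> ` \<E>)" "Q \<in> \<Union>(\<P> ` \<E>)" "P \<noteq> Q"
    then obtain E E' where EE: "E \<in> \<E>" "E' \<in> \<E>" "P \<in> \<P> E" "Q \<in> \<P> E'" by blast
    show "disjnt P Q"
    proof (cases "E = E'")
      case True
      then show ?thesis using P[OF EE(1)] EE \<open>P \<noteq> Q\<close> by (auto simp: pairwise_def)
    next
      case False
      then have "disjnt E E'" using disj EE by (auto simp: pairwise_def)
      moreover have "P \<subseteq> E" "Q \<subseteq> E'" using P EE by blast+
      ultimately show ?thesis by (auto simp: disjnt_def)
    qed
  qed
  moreover have "\<Union>(\<Union>(\<P> ` \<E>)) = \<Union>\<E>" 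
  proof -
    have "\<Union>(\<Union>(\<P> ` \<E>)) = (\<Union>E\<in>\<E>. \<Union>(\<P> E))" by blast
    also have "\<dots> = \<Union>\<E>" using P by simp
    finally show ?thesis .
  qed
  moreover have "openin X P \<and> (\<exists>V\<in>\<V>. P \<subseteq> V)" if "P \<in> \<Union>(\<P> ` \<E>)" for P
    using P that by (metis UN_E)
  ultimately show "\<exists>\<P>. pairwise disjnt \<P> \<and> \<Union>\<P> = \<Union>\<E> \<and> (\<forall>P\<in>\<P>. openin X P \<and> (\<exists>V\<in>\<V>. P \<subseteq> V))"
    by blast
qed

lemma ultraparacompact_subtopology:
  assumes "ultraparacompact_in X W" "W \<subseteq> S"
  shows "ultraparacompact_in (subtopology X S) W"
  unfolding ultraparacompact_in_def
proof (intro allI impI)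
  fix \<V> assume V: "(\<forall>V\<in>\<V>. openin (subtopology X S) V) \<and> W \<subseteq> \<Union>\<V>"
  define \<V>' where "\<V>' = {V. openin X V \<and> V \<inter> S \<in> \<V>}"
  have "W \<subseteq> \<Union>\<V>'"
  proof
    fix x assume "x \<in> W"
    then obtain V' where "V' \<in> \<V>" "x \<in> V'" using V by blast
    moreover from this obtain U where "openin X U" "V' = U \<inter> S" using V by (auto simp: openin_subtopology)
    ultimately show "x \<in> \<Union>\<V>'" by (auto simp: \<V>'_def)
  qed
  moreover have "\<forall>V\<in>\<V>'. openin X V" by (simp add: \<V>'_def)
  ultimately obtain \<P> where P: "pairwise disjnt \<P>" "\<Union>\<P> = W" "\<And>P. P \<in> \<P> \<Longrightarrow> openin X P \<and> (\<exists>V\<in>\<V>'. P \<subseteq> V)"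
    using assms(1) unfolding ultraparacompact_in_def by metis
  have "openin (subtopology X S) P \<and> (\<exists>V\<in>\<V>. P \<subseteq> V)" if "P \<in> \<P>" for P
  proof -
    obtain V where V: "openin X P" "V \<inter> S \<in> \<V>" "P \<subseteq> V" using P(3)[OF \<open>P \<in> \<P>\<close>] by (auto simp: \<V>'_def)
    have "P \<subseteq> S" using that P(2) assms(2) by blast
    moreover from this have "P = P \<inter> S" by blast
    ultimately show ?thesis using V by (auto simp: openin_subtopology intro: bexI[of _ "V \<inter> S"])
  qed
  then show "\<exists>\<P>. pairwise disjnt \<P> \<and> \<Union>\<P> = W \<and> (\<forall>P\<in>\<P>. openin (subtopology X S) P \<and> (\<exists>V\<in>\<V>. P \<subseteq> V))"
    using P by blast
qed

section \<open>The sets of points with prescribed finite coordinates, and the cover they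
  give\<close>

lemma fixed_coordinates_clopen:
  assumes "x \<in> topspace (X_space n K)" "A \<subseteq> {..n}" "\<And>i. i \<in> A \<Longrightarrow> x i \<noteq> None"
  shows "openin (X_space n K) {y \<in> topspace (X_space n K). \<forall>i\<in>A. y i = x i}"
    and "closedin (X_space n K) {y \<in> topspace (X_space n K). \<forall>i\<in>A. y i = x i}"
proof -
  let ?T = "\<lambda>i. \<alpha> (K i)"
  \<comment> \<open>The set is a product of clopen factors. Finiteness of the fixed coordinates
    matters here: the singleton of infinity need not be open.\<close>
  define B where "B i = (if i \<in> A then {x i} else topspace (?T i))" for i
  have eq: "{y \<in> topspace (X_space n K). \<forall>i\<in>A. y i = x i} = (\<Pi>\<^sub>E i\<in>{..n}. B i)"
  proof (intro equalityI subsetI)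
    fix y assume y: "y \<in> (\<Pi>\<^sub>E i\<in>{..n}. B i)"
    have "y i \<in> insert None (Some ` K i)" if "i \<le> n" for i
      using PiE_mem[OF y, of i] PiE_mem[OF assms(1)[unfolded topspace_X_space], of i] that
      by (auto simp: B_def split: if_splits)
    moreover have "y i = x i" if "i \<in> A" for i using PiE_mem[OF y, of i] that assms(2) by (auto simp: B_def)
    ultimately show "y \<in> {y \<in> topspace (X_space n K). \<forall>i\<in>A. y i = x i}"
      using y by (auto simp: topspace_X_space PiE_iff)
  qed (use assms(1,2) in \<open>auto simp: topspace_X_space PiE_iff B_def\<close>)
  have "openin (?T i) (B i) \<and> closedin (?T i) (B i)" if "i \<le> n" for i
  proof (cases "i \<in> A")
    case True
    then obtain k where k: "x i = Some k" "k \<in> K i"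
      using assms(3)[OF True] PiE_mem[OF assms(1)[unfolded topspace_X_space], of i] \<open>i \<le> n\<close>
      by (cases "x i") auto
    then show ?thesis using True closedin_Alexandroff_singleton[OF k(2)] by (auto simp: B_def openin_Alexandroff_discrete)
  qed (simp add: B_def del: topspace_Alexandroff_compactification)
  then have B: "\<forall>i\<in>{..n}. openin (?T i) (B i)" "\<forall>i\<in>{..n}. closedin (?T i) (B i)" by auto
  show "openin (X_space n K) {y \<in> topspace (X_space n K). \<forall>i\<in>A. y i = x i}"
    unfolding eq unfolding X_space_def openin_PiE_gen using B by simp
  show "closedin (X_space n K) {y \<in> topspace (X_space n K). \<forall>i\<in>A. y i = x i}"
    unfolding eq unfolding X_space_def closedin_product_topology using B by simp
qed

lemma openin_D_set: "A \<subseteq> {..n} \<Longrightarrow> openin (X_space n K) (D_set n K A)"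
  using fixed_coordinates_clopen(1)[of _ n K A]
  by (subst openin_subopen) (fastforce simp: D_set_def)

text \<open>The pieces are the fibres of the projection to the coordinates in \<open>A\<close>.
  Those coordinates are finite, so each fibre is clopen in a compact space.\<close>

lemma ultraparacompact_D_set:
  assumes "A \<subseteq> {..n}"
  shows "ultraparacompact_in (X_space n K) (D_set n K A)"
proof -
  let ?X = "X_space n K"
  define E where "E x = {y \<in> topspace ?X. \<forall>i\<in>A. y i = x i}" for x
  have "pairwise disjnt (E ` D_set n K A)"
    by (rule pairwiseI) (auto simp: E_def disjnt_def)
  moreover have "ultraparacompact_in ?X (E x)" if "x \<in> D_set n K A" for x
  proof (rule ultraparacompact_compact)
    have x: "x \<in> topspace ?X" "\<And>i. i \<in> A \<Longrightarrow> x i \<noteq> None" using that by (auto simp: D_set_def)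
    show "openin ?X (E x)" unfolding E_def by (rule fixed_coordinates_clopen(1)[OF x(1) assms x(2)])
    show "compactin ?X (E x)"
      unfolding E_def
      by (rule closedin_compact_space[OF compact_X_space fixed_coordinates_clopen(2)[OF x(1) assms x(2)]])
    show "\<exists>C. openin ?X C \<and> closedin ?X C \<and> x \<in> C \<and> C \<subseteq> U" if "openin ?X U" "x \<in> U" for U x
      using clopen_base_X_space[OF that] by metis
  qed
  ultimately have "ultraparacompact_in ?X (\<Union>(E ` D_set n K A))"
    by (intro ultraparacompact_Union) auto
  moreover have "\<Union>(E ` D_set n K A) = D_set n K A" by (auto simp: E_def D_set_def)
  ultimately show ?thesis by simp
qed

text \<open>The Cech machinery expects an open set for every natural number. Beyond \<open>n\<close>
  the empty set is used, since there \<open>x i\<close> is merely the default value of an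
  extensional function.\<close>

definition D_cover :: "nat \<Rightarrow> (nat \<Rightarrow> 'k set) \<Rightarrow> nat \<Rightarrow> (nat \<Rightarrow> 'k option) set" where
  "D_cover n K i = (if i \<le> n then D_set n K {i} else {})"

lemma topspace_X_minus: "topspace (X_minus n K) = topspace (X_space n K) - {\<lambda>i\<in>{..n}. None}"
  by (auto simp: X_minus_def)

lemma D_set_subset_X_minus: "\<lbrakk>A \<subseteq> {..n}; A \<noteq> {}\<rbrakk> \<Longrightarrow> D_set n K A \<subseteq> topspace (X_minus n K)"
  unfolding topspace_X_minus by (fastforce simp: D_set_def)

lemma X_minus_cover: "topspace (X_minus n K) = (\<Union>i<Suc n. D_cover n K i)"
proof (intro equalityI subsetI)
  fix x assume "x \<in> topspace (X_minus n K)"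
  then have x: "x \<in> topspace (X_space n K)" "x \<noteq> (\<lambda>i\<in>{..n}. None)" by (auto simp: topspace_X_minus)
  have "\<exists>i\<le>n. x i \<noteq> None"
  proof (rule ccontr)
    assume "\<not> (\<exists>i\<le>n. x i \<noteq> None)"
    then have "x = (\<lambda>i\<in>{..n}. None)"
      using x(1) by (auto simp: topspace_X_space fun_eq_iff PiE_iff extensional_def)
    then show False using x(2) by blast
  qed
  then show "x \<in> (\<Union>i<Suc n. D_cover n K i)" using x(1) by (auto simp: D_cover_def D_set_def)
next
  fix x assume "x \<in> (\<Union>i<Suc n. D_cover n K i)"
  then obtain i where "i \<le> n" "x \<in> D_set n K {i}" by (auto simp: D_cover_def less_Suc_eq_le)
  then show "x \<in> topspace (X_minus n K)" using D_set_subset_X_minus[of "{i}" n K] by auto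
qed

lemma overlap_D_cover:
  assumes "A \<subseteq> {..<Suc n}" "A \<noteq> {}"
  shows "overlap (D_cover n K) (topspace (X_minus n K)) A = D_set n K A"
proof -
  have A: "A \<subseteq> {..n}" using assms(1) by auto
  have "D_cover n K i = D_set n K {i}" if "i \<in> A" for i using that A by (auto simp: D_cover_def)
  then show ?thesis
    using assms(2) D_set_subset_X_minus[OF A assms(2), of K] by (auto simp: overlap_def D_set_def)
qed

lemma openin_X_minus: "openin (X_space n K) U \<Longrightarrow> U \<subseteq> topspace (X_minus n K) \<Longrightarrow> openin (X_minus n K) U"
  unfolding X_minus_def openin_subtopology by (intro exI[of _ U]) auto

lemma open_D_cover: "openin (X_minus n K) (D_cover n K i)"
  unfolding D_cover_def using openin_D_set[of "{i}" n K] D_set_subset_X_minus[of "{i}" n K]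
  by (auto intro!: openin_X_minus)

lemma open_D_set_X_minus: "\<lbrakk>A \<subseteq> {..n}; A \<noteq> {}\<rbrakk> \<Longrightarrow> openin (X_minus n K) (D_set n K A)"
  by (intro openin_X_minus openin_D_set D_set_subset_X_minus)

lemma cech_resolution_X_minus:
  assumes "injective_resolution (X_minus n K) (Z2_sheaf (X_minus n K)) I \<epsilon> d"
  shows "cech_resolution (X_minus n K) (Z2_sheaf (X_minus n K)) I \<epsilon> d (D_cover n K) (Suc n)"
proof
  fix A assume A: "A \<subseteq> {..<Suc n}" "A \<noteq> {}"
  then have A': "A \<subseteq> {..n}" by auto
  show "ultraparacompact_in (X_minus n K) (overlap (D_cover n K) (topspace (X_minus n K)) A)"
    unfolding overlap_D_cover[OF A] using D_set_subset_X_minus[OF A' A(2), of K]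
    unfolding X_minus_def topspace_subtopology
    by (intro ultraparacompact_subtopology ultraparacompact_D_set A') auto
qed (rule is_sheaf_Z2 assms open_D_cover X_minus_cover)+

section \<open>Cochains on products of one-point compactifications\<close>

abbreviation Z2_cochains :: "nat \<Rightarrow> (nat \<Rightarrow> 'k set) \<Rightarrow> nat \<Rightarrow> (nat set \<Rightarrow> (nat \<Rightarrow> 'k option) \<Rightarrow> int) monoid" where
  "Z2_cochains n K \<equiv>
     cech_group (Z2_sheaf (X_minus n K)) (D_cover n K) (Suc n) (topspace (X_minus n K))"

abbreviation Z2_diff :: "nat \<Rightarrow> (nat \<Rightarrow> 'k set) \<Rightarrow> nat \<Rightarrow> (nat set \<Rightarrow> (nat \<Rightarrow> 'k option) \<Rightarrow> int) \<Rightarrow>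
    nat set \<Rightarrow> (nat \<Rightarrow> 'k option) \<Rightarrow> int" where
  "Z2_diff n K \<equiv> cech_map (Z2_sheaf (X_minus n K)) (D_cover n K) (Suc n) (topspace (X_minus n K))"

lemma index_sets_SucD:
  assumes "A \<in> index_sets (Suc n) (Suc p)"
  shows "A \<subseteq> {..n}" "A \<noteq> {}" "finite A" "card A = Suc p"
  using assms by (auto simp: index_sets_def lessThan_Suc_atMost dest: finite_subset)

lemma overlap_index_sets:
  assumes "A \<in> index_sets (Suc n) (Suc p)"
  shows "overlap (D_cover n K) (topspace (X_minus n K)) A = D_set n K A"
  using assms index_sets_SucD[OF assms] by (intro overlap_D_cover) (auto simp: index_sets_def)

lemma open_X_minus_iff: "openin (X_minus n K) W \<longleftrightarrow> openin (X_space n K) W \<and> W \<subseteq> topspace (X_minus n K)"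
proof -
  have "openin (X_space n K) (topspace (X_minus n K))"
    unfolding X_minus_cover by (auto simp: D_cover_def intro!: openin_D_set)
  then show ?thesis
    using openin_X_minus[of n K W] openin_subset[of "X_minus n K" W]
      openin_trans_full[of "X_space n K" "topspace (X_minus n K)" W]
    unfolding X_minus_def by (metis openin_trans_full topspace_subtopology_subset openin_subset Diff_subset)
qed

lemma Z2_section_D_setI:
  assumes "A \<subseteq> {..n}" "A \<noteq> {}"
    and "\<And>x. x \<in> D_set n K A \<Longrightarrow> f x = 0 \<or> f x = (1 :: int)"
    and "\<And>x. x \<in> D_set n K A \<Longrightarrow>
      \<exists>W c. openin (X_space n K) W \<and> x \<in> W \<and> W \<subseteq> D_set n K A \<and> (\<forall>y\<in>W. f y = c)"
  shows "restrict f (D_set n K A) \<in> carrier (sections (Z2_sheaf (X_minus n K)) (D_set n K A))"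
proof -
  have op: "openin (X_minus n K) (D_set n K A)" by (rule open_D_set_X_minus[OF assms(1,2)])
  have "\<exists>W c. openin (X_minus n K) W \<and> x \<in> W \<and> W \<subseteq> D_set n K A \<and> (\<forall>y\<in>W. restrict f (D_set n K A) y = c)"
    if x: "x \<in> D_set n K A" for x
  proof -
    obtain W c where W: "openin (X_space n K) W" "x \<in> W" "W \<subseteq> D_set n K A" "\<And>y. y \<in> W \<Longrightarrow> f y = c"
      using assms(4)[OF x] by metis
    then have "openin (X_minus n K) W"
      using D_set_subset_X_minus[OF assms(1,2), of K] by (intro openin_X_minus) auto
    then show ?thesis using W by (intro exI[of _ W] exI[of _ c]) auto
  qed
  then show ?thesis
    using assms(3) unfolding Z2_sections_iff[OF op] by force
qed

lemma Z2_section_D_setD: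
  assumes "f \<in> carrier (sections (Z2_sheaf (X_minus n K)) (D_set n K A))" "A \<subseteq> {..n}" "A \<noteq> {}" "x \<in> D_set n K A"
  obtains W c where "openin (X_space n K) W" "x \<in> W" "W \<subseteq> D_set n K A" "\<And>y. y \<in> W \<Longrightarrow> f y = c"
proof -
  have "\<forall>x\<in>D_set n K A. \<exists>W c. openin (X_minus n K) W \<and> x \<in> W \<and> W \<subseteq> D_set n K A \<and> (\<forall>y\<in>W. f y = c)"
    using assms(1) unfolding Z2_sections_iff[OF open_D_set_X_minus[OF assms(2,3)]] by (elim conjE)
  then show thesis using that assms(4) unfolding open_X_minus_iff by metis
qed

lemma Z2_cochain_section:
  assumes "c \<in> carrier (Z2_cochains n K (Suc p))" "A \<in> index_sets (Suc n) (Suc p)"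
  shows "c A \<in> carrier (sections (Z2_sheaf (X_minus n K)) (D_set n K A))"
  using assms PiE_mem[of c _ _ A] by (simp add: cech_group_def overlap_index_sets[symmetric])

lemma Z2_cochain_value:
  assumes "c \<in> carrier (Z2_cochains n K (Suc p))" "A \<in> index_sets (Suc n) (Suc p)" "x \<in> D_set n K A"
  shows "c A x = 0 \<or> c A x = 1"
  using Z2_value[OF Z2_cochain_section[OF assms(1,2)] open_D_set_X_minus assms(3)] index_sets_SucD[OF assms(2)]
  by blast

lemma Z2_cochainI:
  assumes "\<And>A. A \<in> index_sets (Suc n) (Suc p) \<Longrightarrow>
    f A \<in> carrier (sections (Z2_sheaf (X_minus n K)) (D_set n K A))"
  shows "restrict f (index_sets (Suc n) (Suc p)) \<in> carrier (Z2_cochains n K (Suc p))"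
  using assms by (auto simp: cech_group_def overlap_index_sets)

lemma Z2_cochain_eqI:
  assumes c: "c \<in> carrier (Z2_cochains n K (Suc p))" and c': "c' \<in> carrier (Z2_cochains n K (Suc p))"
    and eq: "\<And>A x. \<lbrakk>A \<in> index_sets (Suc n) (Suc p); x \<in> D_set n K A\<rbrakk> \<Longrightarrow> c A x = c' A x"
  shows "c = c'"
proof
  fix A show "c A = c' A"
  proof (cases "A \<in> index_sets (Suc n) (Suc p)")
    case True
    have "c A \<in> extensional (D_set n K A)" "c' A \<in> extensional (D_set n K A)"
      using Z2_cochain_section[OF c True] Z2_cochain_section[OF c' True]
      by (auto simp: constant_sheaf_def)
    then show ?thesis using eq[OF True] by (rule extensionalityI)
  next
    case False
    then show ?thesis using c c' by (auto simp: cech_group_def PiE_iff extensional_def)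
  qed
qed

lemma Z2_cochains_mult:
  "\<lbrakk>A \<in> index_sets (Suc n) (Suc p); x \<in> D_set n K A\<rbrakk> \<Longrightarrow>
    (c \<otimes>\<^bsub>Z2_cochains n K (Suc p)\<^esub> c') A x = (c A x + c' A x) mod 2"
  by (simp add: cech_group_def overlap_index_sets)

lemma Z2_cochains_one:
  "\<lbrakk>A \<in> index_sets (Suc n) (Suc p); x \<in> D_set n K A\<rbrakk> \<Longrightarrow> \<one>\<^bsub>Z2_cochains n K (Suc p)\<^esub> A x = 0"
  by (simp add: cech_group_def overlap_index_sets)

lemma presheaf_cover_Z2: "presheaf_cover (X_minus n K) (Z2_sheaf (X_minus n K)) (D_cover n K)"
  using is_sheaf_Z2[of "X_minus n K"] open_D_cover[of n K] by unfold_locales (auto simp only: is_sheaf_def)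

lemmas Z2_comm_group = presheaf_cover.comm_group_cech_group[OF presheaf_cover_Z2 openin_topspace]
lemmas Z2_diff_hom = presheaf_cover.cech_map_hom[OF presheaf_cover_Z2 openin_topspace]
lemmas Z2_diff_closed = presheaf_cover.cech_map_closed[OF presheaf_cover_Z2 openin_topspace]
lemmas Z2_diff_diff = presheaf_cover.cech_map_cech_map[OF presheaf_cover_Z2 openin_topspace]

lemma Z2_group: "group (Z2_cochains n K p)"
  using Z2_comm_group comm_group.axioms(2) by blast

lemma Z2_one_closed: "\<one>\<^bsub>Z2_cochains n K p\<^esub> \<in> carrier (Z2_cochains n K p)"
  by (rule monoid.one_closed[OF group.is_monoid[OF Z2_group]])

lemma Z2_diff_value:
  assumes "c \<in> carrier (Z2_cochains n K (Suc p))" "A \<in> index_sets (Suc n) (Suc (Suc p))" "x \<in> D_set n K A"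
  shows "Z2_diff n K (Suc p) c A x = (\<Sum>i\<in>A. c (A - {i}) x) mod 2"
  using assms by (intro Z2_cech_map open_D_cover openin_topspace) (auto simp: overlap_index_sets)

section \<open>Fubini partitions\<close>

locale fubini_partition =
  fixes k n :: nat and K :: "nat \<Rightarrow> 'k set" and Y :: "nat \<Rightarrow> (nat \<Rightarrow> 'k option) set"
  assumes Fubini: "Fubini_partition (int k) n K Y"
begin

definition part :: "(nat \<Rightarrow> 'k option) \<Rightarrow> nat" where
  "part x = (THE i. i \<le> n \<and> x \<in> Y i)"

lemma part_eq: "\<lbrakk>i \<le> n; x \<in> Y i\<rbrakk> \<Longrightarrow> part x = i"
  unfolding part_def
proof (rule the_equality)
  fix j assume "i \<le> n" "x \<in> Y i" "j \<le> n \<and> x \<in> Y j"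
  then show "j = i"
    using Fubini by (auto simp: Fubini_partition_def disjoint_family_on_def)
qed simp

lemma part_le: "part x \<le> n" and part_mem: "x \<in> Y (part x)" if "x \<in> topspace (X_minus n K)"
proof -
  have "(\<Union>i\<le>n. Y i) = topspace (X_minus n K)" using Fubini by (simp add: Fubini_partition_def)
  then have "x \<in> (\<Union>i\<le>n. Y i)" using that by simp
  then obtain i where "i \<le> n" "x \<in> Y i" by blast
  then show "part x \<le> n" "x \<in> Y (part x)" using part_eq by auto
qed

text \<open>Let \<open>A\<close> collect all finite coordinates of \<open>x\<close>. Then
  \<open>x\<close> lies in the facet of \<open>A\<close> and in every neighbourhood
  \<open>N_set n K A x E\<close>, so clause (2) for \<open>A\<close> puts \<open>x\<close> into some
  \<open>Y i\<close> with \<open>i\<close> in \<open>A\<close>: the part containing \<open>x\<close>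
  is indexed by a finite coordinate.\<close>

lemma D_set_part:
  assumes B: "B \<subseteq> {..n}" "k < card B" and x: "x \<in> D_set n K B"
  shows "x \<in> D_set n K (insert (part x) B)"
proof -
  define A where "A = {i \<in> {..n}. x i \<noteq> None}"
  have "B \<subseteq> A" using B x by (auto simp: A_def D_set_def)
  then have "k < card A" using B(2) card_mono[of A B] by (auto simp: A_def)
  moreover have A: "A \<subseteq> {..n}" "x \<in> facet n K A" using x by (auto simp: A_def facet_def D_set_def)
  ultimately obtain E where "N_set n K A x E \<subseteq> (\<Union>i\<in>A. Y i)"
    using Fubini unfolding Fubini_partition_def by (metis less_iff_succ_less_eq of_nat_Suc of_nat_add of_nat_le_iff
        of_nat_1 Suc_eq_plus1)
  moreover have "x \<in> N_set n K A x E" using x by (auto simp: N_set_def A_def D_set_def)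
  ultimately obtain i where "i \<in> A" "x \<in> Y i" by blast
  moreover from this have "part x = i" using part_eq by (auto simp: A_def)
  ultimately show ?thesis using x by (auto simp: A_def D_set_def)
qed

lemma part_clopen:
  assumes "B \<subseteq> {..n}" "k < card B" "i \<le> n" "i \<notin> B"
  shows "openin (X_space n K) (Y i \<inter> D_set n K B)" "openin (X_space n K) (D_set n K B - Y i)"
proof -
  let ?S = "subtopology (X_space n K) (D_set n K B)"
  have D: "openin (X_space n K) (D_set n K B)" by (rule openin_D_set[OF assms(1)])
  have "openin ?S (Y i \<inter> D_set n K B)" "closedin ?S (Y i \<inter> D_set n K B)"
    using Fubini assms unfolding Fubini_partition_def by auto
  moreover from this have "openin ?S (topspace ?S - Y i \<inter> D_set n K B)" by blast
  moreover have "topspace ?S - Y i \<inter> D_set n K B = D_set n K B - Y i"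
    using openin_subset[OF D] by auto
  ultimately show "openin (X_space n K) (Y i \<inter> D_set n K B)" "openin (X_space n K) (D_set n K B - Y i)"
    using openin_open_subtopology[OF D] by auto
qed

text \<open>
  Clause (2) of the definition of a Fubini partition enters only through \<open>D_set_part\<close>: it makes
  \<open>c (insert i B) x\<close> meaningful for \<open>x \<in> Y i \<inter> D_set n K B\<close>. Clause (1) makes \<open>b B\<close> continuous.
\<close>

lemma fubini_primitive:
  assumes c: "c \<in> carrier (Z2_cochains n K (Suc (Suc k)))"
    and dc: "Z2_diff n K (Suc (Suc k)) c = \<one>\<^bsub>Z2_cochains n K (Suc (Suc (Suc k)))\<^esub>"
  obtains b where "b \<in> carrier (Z2_cochains n K (Suc k))" "Z2_diff n K (Suc k) b = c"
    "\<And>B x. \<lbrakk>B \<in> index_sets (Suc n) (Suc k); x \<in> D_set n K B;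
        \<And>A. \<lbrakk>A \<in> index_sets (Suc n) (Suc (Suc k)); x \<in> D_set n K A\<rbrakk> \<Longrightarrow> c A x = 0\<rbrakk> \<Longrightarrow> b B x = 0"
proof -
  define f where "f B x = (if part x \<in> B then 0 else c (insert (part x) B) x)" for B x
  define b where "b = (\<lambda>B\<in>index_sets (Suc n) (Suc k). \<lambda>x\<in>D_set n K B. f B x)"
  have part: "part x \<le> n" "x \<in> Y (part x)" "x \<in> D_set n K (insert (part x) B)"
    if "B \<in> index_sets (Suc n) (Suc k)" "x \<in> D_set n K B" for B x
  proof -
    note B = index_sets_SucD[OF that(1)]
    have "x \<in> topspace (X_minus n K)" using that(2) D_set_subset_X_minus[OF B(1,2)] by blast
    then show "part x \<le> n" "x \<in> Y (part x)" using part_le part_mem by auto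
    show "x \<in> D_set n K (insert (part x) B)" by (rule D_set_part[OF B(1) _ that(2)]) (simp add: B(4))
  qed
  have ins: "insert i B \<in> index_sets (Suc n) (Suc p)"
    if "B \<in> index_sets (Suc n) p" "i \<le> n" "i \<notin> B" for B i p
    using that finite_subset[of B "{..<Suc n}"] by (auto simp: index_sets_def)
  have "restrict (f B) (D_set n K B) \<in> carrier (sections (Z2_sheaf (X_minus n K)) (D_set n K B))"
    if B: "B \<in> index_sets (Suc n) (Suc k)" for B
  proof (rule Z2_section_D_setI)
    note B' = index_sets_SucD[OF B]
    show "B \<subseteq> {..n}" "B \<noteq> {}" by (rule B')+
    have kB: "k < card B" using B'(4) by simp
    fix x assume x: "x \<in> D_set n K B"
    note p = part[OF B x]
    show "f B x = 0 \<or> f B x = 1"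
      using Z2_cochain_value[OF c ins[OF B p(1)] p(3)] by (auto simp: f_def)
    show "\<exists>W c. openin (X_space n K) W \<and> x \<in> W \<and> W \<subseteq> D_set n K B \<and> (\<forall>y\<in>W. f B y = c)"
    proof (cases "part x \<in> B")
      case False
      \<comment> \<open>As \<open>part x\<close> is not in \<open>B\<close>, clause (1) makes
        \<open>Y (part x)\<close> open in \<open>D_set n K B\<close>. Near \<open>x\<close> the part
        is constant, so \<open>f B\<close> is there a single component of \<open>c\<close>.\<close>
      note A = ins[OF B p(1) False]
      obtain W v where W: "openin (X_space n K) W" "x \<in> W" "W \<subseteq> D_set n K (insert (part x) B)"
          "\<And>y. y \<in> W \<Longrightarrow> c (insert (part x) B) y = v"
        using Z2_section_D_setD[OF Z2_cochain_section[OF c A] index_sets_SucD(1,2)[OF A] p(3)] by metis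
      have "f B y = v" if "y \<in> W" "y \<in> Y (part x)" for y
        using W(4)[OF that(1)] part_eq[OF p(1) that(2)] False by (simp add: f_def)
      then show ?thesis
        using W part_clopen(1)[OF B'(1) kB p(1) False] p x
        by (intro exI[of _ "W \<inter> (Y (part x) \<inter> D_set n K B)"] exI[of _ v]) auto
    next
      case True
      \<comment> \<open>Clause (1) for \<open>B\<close> does not address the individual
        \<open>Y i\<close> with \<open>i\<close> in \<open>B\<close>. Removing all other parts still
        leaves an open set, and \<open>f B\<close> is 0 throughout it, so jumps between parts
        indexed by \<open>B\<close> do no harm.\<close>
      let ?W = "D_set n K B \<inter> (\<Inter>i\<in>{..n} - B. D_set n K B - Y i)"
      have "openin (X_space n K) ?W"
      proof (cases "{..n} - B = {}")
        case True
        then show ?thesis using openin_D_set[OF B'(1)] by simp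
      next
        case False
        then have "openin (X_space n K) (\<Inter>i\<in>{..n} - B. D_set n K B - Y i)"
          using part_clopen(2)[OF B'(1) kB] by (intro openin_INT2) auto
        then show ?thesis using openin_D_set[OF B'(1)] by blast
      qed
      moreover have "x \<in> ?W" using x True part_eq by auto
      moreover have "f B y = 0" if "y \<in> ?W" for y
      proof -
        have "part y \<in> B"
        proof (rule ccontr)
          assume "part y \<notin> B"
          moreover have "y \<in> D_set n K B" using that by blast
          ultimately show False using that part(1,2)[OF B] by blast
        qed
        then show ?thesis by (simp add: f_def)
      qed
      ultimately show ?thesis by (intro exI[of _ ?W] exI[of _ 0]) blast
    qed
  qed
  then have b: "b \<in> carrier (Z2_cochains n K (Suc k))"
    unfolding b_def by (rule Z2_cochainI)
  have b_val: "b B x = f B x" if "B \<in> index_sets (Suc n) (Suc k)" "x \<in> D_set n K B" for B x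
    using that by (simp add: b_def)
  have "Z2_diff n K (Suc k) b = c"
  proof (rule Z2_cochain_eqI[OF Z2_diff_closed[OF b] c])
    fix A x assume A: "A \<in> index_sets (Suc n) (Suc (Suc k))" and x: "x \<in> D_set n K A"
    note A' = index_sets_SucD[OF A]
    have rem: "A - {j} \<in> index_sets (Suc n) (Suc k)" "x \<in> D_set n K (A - {j})" if "j \<in> A" for j
      using index_sets_remove[OF A that] x by (auto simp: D_set_def)
    have "Z2_diff n K (Suc k) b A x = (\<Sum>j\<in>A. f (A - {j}) x) mod 2"
      using Z2_diff_value[OF b A x] rem by (simp add: b_val)
    also have "\<dots> = c A x"
    proof (cases "part x \<in> A")
      case True
      \<comment> \<open>For \<open>j\<close> other than \<open>part x\<close> the face
        \<open>A - {j}\<close> still contains \<open>part x\<close>, where \<open>f\<close> is 0 by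
        definition; a single summand survives.\<close>
      have "(\<Sum>j\<in>A. f (A - {j}) x) = (\<Sum>j\<in>A. if j = part x then c A x else 0)"
        using True by (intro sum.cong) (auto simp: f_def insert_absorb)
      also have "\<dots> = c A x" by (simp only: sum.delta[OF A'(3)] True if_True)
      finally show ?thesis using Z2_cochain_value[OF c A x] by auto
    next
      case False
      \<comment> \<open>When \<open>part x\<close> is outside \<open>A\<close>, the cocycle
        condition at \<open>insert (part x) A\<close> expresses \<open>c A x\<close> through the
        faces containing \<open>part x\<close>, and these are the values of
        \<open>f\<close>.\<close>
      obtain j where j: "j \<in> A" using A'(2) by blast
      have p: "part x \<le> n" "x \<in> D_set n K (insert (part x) A)"
        using part(1,3)[OF rem[OF j]] x by (auto simp: D_set_def)
      note I = ins[OF A p(1) False]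
      have "(\<Sum>j\<in>insert (part x) A. c (insert (part x) A - {j}) x) mod 2 = 0"
        using Z2_diff_value[OF c I p(2)] Z2_cochains_one[OF I p(2)] by (simp add: dc)
      moreover have "(\<Sum>j\<in>insert (part x) A. c (insert (part x) A - {j}) x) =
          c A x + (\<Sum>j\<in>A. f (A - {j}) x)"
      proof -
        have "insert (part x) A - {part x} = A" using False by auto
        moreover have "(\<Sum>j\<in>A. c (insert (part x) A - {j}) x) = (\<Sum>j\<in>A. f (A - {j}) x)"
        proof (rule sum.cong[OF refl])
          fix j assume "j \<in> A"
          then have "insert (part x) A - {j} = insert (part x) (A - {j})" using False by auto
          then show "c (insert (part x) A - {j}) x = f (A - {j}) x" using False by (simp add: f_def)
        qed
        ultimately show ?thesis using False A'(3) by simp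
      qed
      ultimately have "(c A x + (\<Sum>j\<in>A. f (A - {j}) x)) mod 2 = 0" by simp
      then show ?thesis using Z2_cochain_value[OF c A x] by (elim disjE; simp) presburger
    qed
    finally show "Z2_diff n K (Suc k) b A x = c A x" .
  qed
  \<comment> \<open>The value of \<open>b\<close> at \<open>x\<close> is either 0 or a value of
    \<open>c\<close> at the same point, so vanishing is inherited pointwise.
    \<open>extend_cocycle\<close> relies on this.\<close>
  moreover have "b B x = 0"
    if B: "B \<in> index_sets (Suc n) (Suc k)" and x: "x \<in> D_set n K B"
      and 0: "\<And>A. \<lbrakk>A \<in> index_sets (Suc n) (Suc (Suc k)); x \<in> D_set n K A\<rbrakk> \<Longrightarrow> c A x = 0" for B x
    using 0[OF ins[OF B part(1)[OF B x]] part(3)[OF B x]] b_val[OF B x] by (auto simp: f_def)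
  ultimately show thesis using that b by blast
qed

end

section \<open>Subproducts\<close>

text \<open>Finite fibres over finite points make preimages of cofinite neighbourhoods of infinity
  cofinite; at all other points continuity is automatic.\<close>

lemma continuous_map_Alexandroff_discrete:
  assumes "h None = None" "\<And>k. k \<in> K \<Longrightarrow> h (Some k) \<in> insert None (Some ` L)"
    and fin: "\<And>l. l \<in> L \<Longrightarrow> finite {k \<in> K. h (Some k) = Some l}"
  shows "continuous_map (\<alpha> K)
    (\<alpha> L) h"
  unfolding continuous_map_def
proof (intro conjI allI impI)
  show "h \<in> topspace (\<alpha> K) \<rightarrow>
      topspace (\<alpha> L)"
    using assms(1,2) by auto
  fix V assume V: "openin (\<alpha> L) V"
  let ?U = "{x \<in> topspace (\<alpha> K). h x \<in> V}"
  have "finite {k \<in> K. Some k \<notin> ?U}" if "None \<in> ?U"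
  proof (rule finite_subset)
    have "None \<in> V" using that assms(1) by simp
    then show "finite (\<Union>l\<in>{l \<in> L. Some l \<notin> V}. {k \<in> K. h (Some k) = Some l})"
      using V fin by (auto simp: openin_Alexandroff_discrete)
    show "{k \<in> K. Some k \<notin> ?U} \<subseteq> (\<Union>l\<in>{l \<in> L. Some l \<notin> V}. {k \<in> K. h (Some k) = Some l})"
      using assms(2) \<open>None \<in> V\<close> by fastforce
  qed
  then show "openin (\<alpha> K) ?U"
    unfolding openin_Alexandroff_discrete by auto
qed

lemma continuous_map_X_space:
  assumes "\<And>i. i \<le> n \<Longrightarrow> continuous_map (\<alpha> (K i))
    (\<alpha> (L i)) (h i)"
  shows "continuous_map (X_space n K) (X_space n L) (\<lambda>x. \<lambda>i\<in>{..n}. h i (x i))"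
  unfolding X_space_def continuous_map_componentwise
proof (intro conjI ballI)
  fix i assume i: "i \<in> {..n}"
  have "continuous_map (product_topology (\<lambda>i. \<alpha> (K i)) {..n})
      (\<alpha> (L i)) (h i \<circ> (\<lambda>x. x i))"
    by (rule continuous_map_compose[OF continuous_map_product_projection[OF i] assms]) (use i in simp)
  then show "continuous_map (product_topology (\<lambda>i. \<alpha> (K i)) {..n})
      (\<alpha> (L i)) (\<lambda>x. (\<lambda>i\<in>{..n}. h i (x i)) i)"
    using i by (simp add: o_def)
qed auto

locale subproduct =
  fixes n :: nat and L :: "nat \<Rightarrow> 'l set" and K :: "nat \<Rightarrow> 'k set" and emb :: "nat \<Rightarrow> 'l \<Rightarrow> 'k"
  assumes emb_inj: "\<And>i. i \<le> n \<Longrightarrow> inj_on (emb i) (L i)"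
    and emb_mem: "\<And>i l. \<lbrakk>i \<le> n; l \<in> L i\<rbrakk> \<Longrightarrow> emb i l \<in> K i"
begin

definition incl :: "(nat \<Rightarrow> 'l option) \<Rightarrow> nat \<Rightarrow> 'k option" where
  "incl x = (\<lambda>i\<in>{..n}. map_option (emb i) (x i))"

text \<open>Points outside the image of \<open>emb\<close> are collapsed to infinity. Each finite
  point keeps at most one preimage, so continuity survives.\<close>

definition coretract :: "nat \<Rightarrow> 'k option \<Rightarrow> 'l option" where
  "coretract i v = (case v of None \<Rightarrow> None
     | Some m \<Rightarrow> if m \<in> emb i ` L i then Some (inv_into (L i) (emb i) m) else None)"

definition retr :: "(nat \<Rightarrow> 'k option) \<Rightarrow> nat \<Rightarrow> 'l option" where
  "retr y = (\<lambda>i\<in>{..n}. coretract i (y i))"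

lemma continuous_incl: "continuous_map (X_space n L) (X_space n K) incl"
  unfolding incl_def
proof (rule continuous_map_X_space, rule continuous_map_Alexandroff_discrete)
  fix i l assume i: "i \<le> n"
  show "finite {l' \<in> L i. map_option (emb i) (Some l') = Some l}"
    by (rule finite_subset[of _ "{inv_into (L i) (emb i) l}"]) (use emb_inj[OF i] in auto)
qed (use emb_mem in auto)

lemma continuous_retr: "continuous_map (X_space n K) (X_space n L) retr"
  unfolding retr_def
proof (rule continuous_map_X_space, rule continuous_map_Alexandroff_discrete)
  fix i l assume i: "i \<le> n"
  show "finite {m \<in> K i. coretract i (Some m) = Some l}"
    by (rule finite_subset[of _ "{emb i l}"]) (auto simp: coretract_def f_inv_into_f split: if_splits)
qed (auto simp: coretract_def inv_into_into)

lemma retr_incl: "x \<in> topspace (X_space n L) \<Longrightarrow> retr (incl x) = x"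
proof
  fix i assume x: "x \<in> topspace (X_space n L)"
  show "retr (incl x) i = x i"
  proof (cases "i \<le> n")
    case True
    then have "x i \<in> insert None (Some ` L i)" using x by (auto simp: topspace_X_space)
    then show ?thesis using True emb_inj[OF True] by (auto simp: retr_def incl_def coretract_def)
  next
    case False
    then show ?thesis using x by (auto simp: retr_def topspace_X_space PiE_iff extensional_def)
  qed
qed

lemma incl_D_set: "\<lbrakk>A \<subseteq> {..n}; x \<in> D_set n L A\<rbrakk> \<Longrightarrow> incl x \<in> D_set n K A"
  using continuous_map_image_subset_topspace[OF continuous_incl] by (auto simp: D_set_def incl_def)

lemma incl_D_set_iff:
  assumes "A \<subseteq> {..n}" "x \<in> topspace (X_space n L)"
  shows "incl x \<in> D_set n K A \<longleftrightarrow> x \<in> D_set n L A"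
  using assms incl_D_set by (auto simp: D_set_def incl_def subset_iff)

definition res :: "nat \<Rightarrow> (nat set \<Rightarrow> (nat \<Rightarrow> 'k option) \<Rightarrow> int) \<Rightarrow> nat set \<Rightarrow> (nat \<Rightarrow> 'l option) \<Rightarrow> int" where
  "res p c = (\<lambda>A\<in>index_sets (Suc n) p. \<lambda>x\<in>D_set n L A. c A (incl x))"

text \<open>Not a cochain map: \<open>retr y\<close> may leave \<open>D_set n L A\<close> through
  one collapsed coordinate while staying in the set of a face of \<open>A\<close>, so the
  differential can be nonzero where the extended differential is 0.\<close>

definition ext_zero :: "nat \<Rightarrow> (nat set \<Rightarrow> (nat \<Rightarrow> 'l option) \<Rightarrow> int) \<Rightarrow> nat set \<Rightarrow> (nat \<Rightarrow> 'k option) \<Rightarrow> int" where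
  "ext_zero p c = (\<lambda>A\<in>index_sets (Suc n) p. \<lambda>y\<in>D_set n K A. if retr y \<in> D_set n L A then c A (retr y) else 0)"

lemma res_closed:
  assumes c: "c \<in> carrier (Z2_cochains n K (Suc p))"
  shows "res (Suc p) c \<in> carrier (Z2_cochains n L (Suc p))"
  unfolding res_def
proof (rule Z2_cochainI, rule Z2_section_D_setI)
  fix A assume A: "A \<in> index_sets (Suc n) (Suc p)"
  note A' = index_sets_SucD[OF A]
  show "A \<subseteq> {..n}" "A \<noteq> {}" by (rule A')+
  fix x assume x: "x \<in> D_set n L A"
  then have ix: "incl x \<in> D_set n K A" by (rule incl_D_set[OF A'(1)])
  then show "c A (incl x) = 0 \<or> c A (incl x) = 1" by (rule Z2_cochain_value[OF c A])
  obtain W v where W: "openin (X_space n K) W" "incl x \<in> W" "\<And>y. y \<in> W \<Longrightarrow> c A y = v"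
    using Z2_section_D_setD[OF Z2_cochain_section[OF c A] A'(1,2) ix] by metis
  let ?V = "{y \<in> topspace (X_space n L). incl y \<in> W} \<inter> D_set n L A"
  have "openin (X_space n L) ?V"
    using openin_continuous_map_preimage[OF continuous_incl W(1)] openin_D_set[OF A'(1)] by blast
  moreover have "x \<in> ?V" using x W(2) by (auto simp: D_set_def)
  ultimately show "\<exists>V v. openin (X_space n L) V \<and> x \<in> V \<and> V \<subseteq> D_set n L A \<and> (\<forall>y\<in>V. c A (incl y) = v)"
    using W(3) by (intro exI[of _ ?V] exI[of _ v]) auto
qed

lemma ext_zero_closed:
  assumes c: "c \<in> carrier (Z2_cochains n L (Suc p))"
  shows "ext_zero (Suc p) c \<in> carrier (Z2_cochains n K (Suc p))"
  unfolding ext_zero_def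
proof (rule Z2_cochainI, rule Z2_section_D_setI)
  fix A assume A: "A \<in> index_sets (Suc n) (Suc p)"
  note A' = index_sets_SucD[OF A]
  show "A \<subseteq> {..n}" "A \<noteq> {}" by (rule A')+
  let ?f = "\<lambda>y. if retr y \<in> D_set n L A then c A (retr y) else 0"
  fix y assume y: "y \<in> D_set n K A"
  show "?f y = 0 \<or> ?f y = 1" using Z2_cochain_value[OF c A] by auto
  show "\<exists>V v. openin (X_space n K) V \<and> y \<in> V \<and> V \<subseteq> D_set n K A \<and> (\<forall>z\<in>V. ?f z = v)"
  proof (cases "retr y \<in> D_set n L A")
    case True
    obtain W v where W: "openin (X_space n L) W" "retr y \<in> W" "W \<subseteq> D_set n L A" "\<And>x. x \<in> W \<Longrightarrow> c A x = v"
      using Z2_section_D_setD[OF Z2_cochain_section[OF c A] A'(1,2) True] by metis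
    let ?V = "{z \<in> topspace (X_space n K). retr z \<in> W} \<inter> D_set n K A"
    have "openin (X_space n K) ?V"
      using openin_continuous_map_preimage[OF continuous_retr W(1)] openin_D_set[OF A'(1)] by blast
    moreover have "y \<in> ?V" using y W(2) by (auto simp: D_set_def)
    ultimately show ?thesis
      using W(3,4) by (intro exI[of _ ?V] exI[of _ v]) auto
  next
    case False
    have yt: "y \<in> topspace (X_space n K)" using y by (simp add: D_set_def)
    have "retr y \<in> topspace (X_space n L)"
      using continuous_map_image_subset_topspace[OF continuous_retr] yt by blast
    then obtain i where i: "i \<in> A" "retr y i = None" using False by (auto simp: D_set_def)
    \<comment> \<open>The coordinate \<open>i\<close> of \<open>y\<close> is finite but collapsed by
      the retraction. Fixing it is an open condition that keeps the extension at 0.\<close>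
    let ?V = "{z \<in> topspace (X_space n K). \<forall>i\<in>{i}. z i = y i} \<inter> D_set n K A"
    have "openin (X_space n K) ?V"
      using fixed_coordinates_clopen(1)[OF yt, of "{i}"] i y A'(1) openin_D_set[OF A'(1)]
      by (intro openin_Int) (auto simp: D_set_def)
    moreover have "?f z = 0" if "z \<in> ?V" for z
    proof -
      have "retr z i = None" using that i A'(1) by (auto simp: retr_def)
      then show ?thesis using i(1) by (auto simp: D_set_def)
    qed
    ultimately show ?thesis using y yt by (intro exI[of _ ?V] exI[of _ 0]) blast
  qed
qed

lemma res_value: "\<lbrakk>A \<in> index_sets (Suc n) p; x \<in> D_set n L A\<rbrakk> \<Longrightarrow> res p c A x = c A (incl x)"
  by (simp add: res_def)

lemma ext_zero_incl:
  "\<lbrakk>A \<in> index_sets (Suc n) (Suc p); x \<in> D_set n L A\<rbrakk> \<Longrightarrow> ext_zero (Suc p) c A (incl x) = c A x"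
  using incl_D_set[of A x] index_sets_SucD(1)[of A n p] retr_incl[of x]
  by (simp add: ext_zero_def) (simp add: D_set_def)

lemma D_set_remove: "x \<in> D_set n L A \<Longrightarrow> x \<in> D_set n L (A - {i})"
  by (auto simp: D_set_def)

lemma res_diff:
  assumes c: "c \<in> carrier (Z2_cochains n K (Suc p))"
  shows "res (Suc (Suc p)) (Z2_diff n K (Suc p) c) = Z2_diff n L (Suc p) (res (Suc p) c)"
proof (rule Z2_cochain_eqI)
  show "res (Suc (Suc p)) (Z2_diff n K (Suc p) c) \<in> carrier (Z2_cochains n L (Suc (Suc p)))"
    by (rule res_closed[OF Z2_diff_closed[OF c]])
  show "Z2_diff n L (Suc p) (res (Suc p) c) \<in> carrier (Z2_cochains n L (Suc (Suc p)))"
    by (rule Z2_diff_closed[OF res_closed[OF c]])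
  fix A x assume A: "A \<in> index_sets (Suc n) (Suc (Suc p))" and x: "x \<in> D_set n L A"
  show "res (Suc (Suc p)) (Z2_diff n K (Suc p) c) A x = Z2_diff n L (Suc p) (res (Suc p) c) A x"
    using Z2_diff_value[OF c A incl_D_set[OF index_sets_SucD(1)[OF A] x]] Z2_diff_value[OF res_closed[OF c] A x]
      index_sets_remove[OF A] D_set_remove[OF x] by (simp add: res_value A x)
qed

lemma res_mult:
  assumes "c \<in> carrier (Z2_cochains n K (Suc p))" "c' \<in> carrier (Z2_cochains n K (Suc p))"
  shows "res (Suc p) (c \<otimes>\<^bsub>Z2_cochains n K (Suc p)\<^esub> c') = res (Suc p) c \<otimes>\<^bsub>Z2_cochains n L (Suc p)\<^esub> res (Suc p) c'"
proof (rule Z2_cochain_eqI)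
  show "res (Suc p) (c \<otimes>\<^bsub>Z2_cochains n K (Suc p)\<^esub> c') \<in> carrier (Z2_cochains n L (Suc p))"
    using assms monoid.m_closed[OF group.is_monoid[OF Z2_group]] by (intro res_closed) blast
  show "res (Suc p) c \<otimes>\<^bsub>Z2_cochains n L (Suc p)\<^esub> res (Suc p) c' \<in> carrier (Z2_cochains n L (Suc p))"
    using assms monoid.m_closed[OF group.is_monoid[OF Z2_group]] res_closed by blast
  fix A x assume A: "A \<in> index_sets (Suc n) (Suc p)" and x: "x \<in> D_set n L A"
  show "res (Suc p) (c \<otimes>\<^bsub>Z2_cochains n K (Suc p)\<^esub> c') A x =
      (res (Suc p) c \<otimes>\<^bsub>Z2_cochains n L (Suc p)\<^esub> res (Suc p) c') A x"
    using incl_D_set[OF index_sets_SucD(1)[OF A] x] by (simp add: Z2_cochains_mult A x res_value)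
qed

lemma res_hom: "res (Suc p) \<in> hom (Z2_cochains n K (Suc p)) (Z2_cochains n L (Suc p))"
  by (intro homI res_closed res_mult)

text \<open>
  Extending a cocycle by zero creates a coboundary that vanishes on the subproduct; subtracting
  the primitive supplied by the Fubini partition repairs this without changing the restriction.
\<close>

lemma extend_cocycle:
  assumes "fubini_partition k n K Y"
    and c: "c \<in> carrier (Z2_cochains n L (Suc k))"
    and dc: "Z2_diff n L (Suc k) c = \<one>\<^bsub>Z2_cochains n L (Suc (Suc k))\<^esub>"
  obtains c' where "c' \<in> carrier (Z2_cochains n K (Suc k))"
    "Z2_diff n K (Suc k) c' = \<one>\<^bsub>Z2_cochains n K (Suc (Suc k))\<^esub>" "res (Suc k) c' = c"
proof -
  interpret fubini_partition k n K Y by (rule assms(1))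
  let ?e = "ext_zero (Suc k) c"
  let ?t = "Z2_diff n K (Suc k) ?e"
  have e: "?e \<in> carrier (Z2_cochains n K (Suc k))" by (rule ext_zero_closed[OF c])
  have t: "?t \<in> carrier (Z2_cochains n K (Suc (Suc k)))" by (rule Z2_diff_closed[OF e])
  obtain b where b: "b \<in> carrier (Z2_cochains n K (Suc k))" "Z2_diff n K (Suc k) b = ?t"
    "\<And>B x. \<lbrakk>B \<in> index_sets (Suc n) (Suc k); x \<in> D_set n K B;
        \<And>A. \<lbrakk>A \<in> index_sets (Suc n) (Suc (Suc k)); x \<in> D_set n K A\<rbrakk> \<Longrightarrow> ?t A x = 0\<rbrakk> \<Longrightarrow> b B x = 0"
    using fubini_primitive[OF t Z2_diff_diff[OF e]] by metis
  interpret G: comm_group "Z2_cochains n K (Suc k)" by (rule Z2_comm_group)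
  \<comment> \<open>Multiplication by \<open>b\<close> is also division, and both factors have
    differential \<open>?t\<close>.\<close>
  let ?c = "?e \<otimes>\<^bsub>Z2_cochains n K (Suc k)\<^esub> b"
  have "Z2_diff n K (Suc k) ?c = ?t \<otimes>\<^bsub>Z2_cochains n K (Suc (Suc k))\<^esub> ?t"
    using hom_mult[OF Z2_diff_hom e b(1)] b(2) by simp
  also have "\<dots> = \<one>\<^bsub>Z2_cochains n K (Suc (Suc k))\<^esub>"
    by (rule Z2_cech_self_inverse[OF open_D_cover openin_topspace t])
  finally have d: "Z2_diff n K (Suc k) ?c = \<one>\<^bsub>Z2_cochains n K (Suc (Suc k))\<^esub>" .
  \<comment> \<open>At points of the subproduct the extension returns \<open>c\<close> on every
    face, so the defect there is the differential of \<open>c\<close>, which is trivial.\<close>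
  have t0: "?t A (incl x) = 0"
    if A: "A \<in> index_sets (Suc n) (Suc (Suc k))" and ix: "incl x \<in> D_set n K A"
      and x: "x \<in> topspace (X_space n L)" for A x
  proof -
    have xA: "x \<in> D_set n L A" using ix incl_D_set_iff[OF index_sets_SucD(1)[OF A] x] by simp
    have "?t A (incl x) = Z2_diff n L (Suc k) c A x"
      unfolding Z2_diff_value[OF e A ix] Z2_diff_value[OF c A xA]
      using index_sets_remove[OF A] D_set_remove[OF xA] by (simp add: ext_zero_incl)
    then show ?thesis by (simp add: dc Z2_cochains_one[OF A xA])
  qed
  have "res (Suc k) ?c = c"
  proof (rule Z2_cochain_eqI[OF res_closed c])
    show "?c \<in> carrier (Z2_cochains n K (Suc k))" using e b(1) by simp
    fix B x assume B: "B \<in> index_sets (Suc n) (Suc k)" and x: "x \<in> D_set n L B"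
    have xt: "x \<in> topspace (X_space n L)" using x by (simp add: D_set_def)
    have ix: "incl x \<in> D_set n K B" by (rule incl_D_set[OF index_sets_SucD(1)[OF B] x])
    have "b B (incl x) = 0" by (rule b(3)[OF B ix t0[OF _ _ xt]])
    then show "res (Suc k) ?c B x = c B x"
      using Z2_cochain_value[OF c B x] by (auto simp: res_value[OF B x] Z2_cochains_mult[OF B ix] ext_zero_incl[OF B x])
  qed
  then show thesis using that[of ?c] d e b(1) by simp
qed

end

section \<open>Homomorphisms between quotient groups\<close>

lemma (in group) r_coset_eq_iff:
  assumes "subgroup N G" "x \<in> carrier G" "y \<in> carrier G"
  shows "N #> x = N #> y \<longleftrightarrow> x \<otimes> inv y \<in> N"
proof
  assume "N #> x = N #> y"
  then have "x \<in> N #> y" using rcos_self[OF assms(2,1)] by simp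
  then obtain h where "h \<in> N" "x = h \<otimes> y" by (auto simp: r_coset_def)
  then show "x \<otimes> inv y \<in> N"
    using assms subgroup.mem_carrier[OF assms(1)] by (simp add: m_assoc)
next
  assume N: "x \<otimes> inv y \<in> N"
  have "x = x \<otimes> inv y \<otimes> y" using assms by (simp add: m_assoc)
  then have "x \<in> N #> y" using N by (auto simp: r_coset_def)
  then show "N #> x = N #> y" using repr_independence assms by metis
qed

text \<open>If two left members agree modulo \<open>M\<close>, their quotient is in \<open>M\<close>
  and is related to the quotient of the right members, which therefore lies in \<open>N\<close>. So
  any choice of related element is well defined modulo \<open>N\<close>; totality on the right gives
  surjectivity.\<close>

lemma quotient_epi_from_relation:
  assumes G: "comm_group G" and H: "comm_group H" and M: "subgroup M G" and N: "subgroup N H"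
    and closed: "\<And>x y. R x y \<Longrightarrow> x \<in> carrier G \<and> y \<in> carrier H"
    and mult: "\<And>x y x' y'. \<lbrakk>R x y; R x' y'\<rbrakk> \<Longrightarrow> R (x \<otimes>\<^bsub>G\<^esub> x') (y \<otimes>\<^bsub>H\<^esub> y')"
    and inv: "\<And>x y. R x y \<Longrightarrow> R (inv\<^bsub>G\<^esub> x) (inv\<^bsub>H\<^esub> y)"
    and left: "\<And>x. x \<in> carrier G \<Longrightarrow> \<exists>y. R x y" and right: "\<And>y. y \<in> carrier H \<Longrightarrow> \<exists>x. R x y"
    and MN: "\<And>x y. \<lbrakk>R x y; x \<in> M\<rbrakk> \<Longrightarrow> y \<in> N"
  obtains f where "f \<in> hom (G Mod M) (H Mod N)" "f ` carrier (G Mod M) = carrier (H Mod N)"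
proof -
  interpret G: comm_group G by (rule G)
  interpret H: comm_group H by (rule H)
  interpret N: normal N H by (rule H.subgroup_imp_normal[OF N])
  have indep: "N #>\<^bsub>H\<^esub> y = N #>\<^bsub>H\<^esub> y'"
    if "R x y" "R x' y'" "M #>\<^bsub>G\<^esub> x = M #>\<^bsub>G\<^esub> x'" for x x' y y'
  proof -
    have "x \<otimes>\<^bsub>G\<^esub> inv\<^bsub>G\<^esub> x' \<in> M" using that closed G.r_coset_eq_iff[OF M] by blast
    then have "y \<otimes>\<^bsub>H\<^esub> inv\<^bsub>H\<^esub> y' \<in> N" using MN mult inv that by blast
    then show ?thesis using that closed H.r_coset_eq_iff[OF N] by blast
  qed
  define r where "r x = (SOME y. R x y)" for x
  have r: "R x (r x)" if "x \<in> carrier G" for x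
    unfolding r_def using left[OF that] by (rule someI_ex)
  define h where "h x = N #>\<^bsub>H\<^esub> r x" for x
  have h: "h x = N #>\<^bsub>H\<^esub> y" if "R x y" for x y
    unfolding h_def using indep[OF r that refl] closed[OF that] by blast
  have "h \<in> hom G (H Mod N)"
  proof (rule homI)
    fix x assume "x \<in> carrier G"
    then show "h x \<in> carrier (H Mod N)"
      using r closed by (auto simp: h_def carrier_FactGroup)
  next
    fix x x' assume x: "x \<in> carrier G" "x' \<in> carrier G"
    have "h (x \<otimes>\<^bsub>G\<^esub> x') = N #>\<^bsub>H\<^esub> (r x \<otimes>\<^bsub>H\<^esub> r x')"
      by (rule h[OF mult[OF r[OF x(1)] r[OF x(2)]]])
    also have "\<dots> = h x \<otimes>\<^bsub>H Mod N\<^esub> h x'"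
      using closed[OF r[OF x(1)]] closed[OF r[OF x(2)]] by (simp add: h_def N.rcos_sum)
    finally show "h (x \<otimes>\<^bsub>G\<^esub> x') = h x \<otimes>\<^bsub>H Mod N\<^esub> h x'" .
  qed
  moreover have "h x = h x'"
    if "x \<in> carrier G" "x' \<in> carrier G" "M #>\<^bsub>G\<^esub> x = M #>\<^bsub>G\<^esub> x'" for x x'
    unfolding h_def using indep[OF r[OF that(1)] r[OF that(2)] that(3)] .
  ultimately obtain f where f: "f \<in> hom (G Mod M) (H Mod N)"
      "\<And>x. x \<in> carrier G \<Longrightarrow> f (M #>\<^bsub>G\<^esub> x) = h x"
    using FactGroup_universal[OF _ G.subgroup_imp_normal[OF M]] by metis
  have "carrier (H Mod N) \<subseteq> f ` carrier (G Mod M)"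
  proof
    fix C assume "C \<in> carrier (H Mod N)"
    then obtain y where y: "y \<in> carrier H" "C = N #>\<^bsub>H\<^esub> y" by (auto simp: carrier_FactGroup)
    obtain x where x: "R x y" using right[OF y(1)] by blast
    then have "f (M #>\<^bsub>G\<^esub> x) = C" using f(2) closed h y(2) by metis
    then show "C \<in> f ` carrier (G Mod M)"
      using closed[OF x] by (auto simp: carrier_FactGroup)
  qed
  moreover have "f ` carrier (G Mod M) \<subseteq> carrier (H Mod N)" using f(1) by (auto simp: hom_def)
  ultimately show thesis using that f(1) by blast
qed

text \<open>By Zorn's lemma, the kernel has a complement.\<close>

lemma epi_splits_exponent_2:
  assumes G: "comm_group G" and H: "group H" and f: "f \<in> hom G H" and surj: "f ` carrier G = carrier H"
    and two: "\<And>x. x \<in> carrier G \<Longrightarrow> x \<otimes>\<^bsub>G\<^esub> x = \<one>\<^bsub>G\<^esub>"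
  shows "\<exists>\<phi>. \<phi> \<in> mon H G"
proof -
  interpret G: comm_group G by (rule G)
  interpret H: group H by (rule H)
  interpret f: group_hom G H f by (simp add: group_hom_def group_hom_axioms_def f G.group_axioms H)
  \<comment> \<open>Candidates for a complement: the subgroups meeting the kernel of
    \<open>f\<close> trivially.\<close>
  define \<A> where "\<A> = {C. subgroup C G \<and> (\<forall>x\<in>C. f x = \<one>\<^bsub>H\<^esub> \<longrightarrow> x = \<one>\<^bsub>G\<^esub>)}"
  have inv_self: "inv\<^bsub>G\<^esub> x = x" if "x \<in> carrier G" for x
    by (rule G.inv_equality) (use that two in auto)
  have "{\<one>\<^bsub>G\<^esub>} \<in> \<A>" using G.triv_subgroup by (auto simp: \<A>_def)
  moreover have "\<Union>\<C> \<in> \<A>" if ne: "\<C> \<noteq> {}" and ch: "subset.chain \<A> \<C>" for \<C>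
  proof -
    have sub: "subgroup C G" if "C \<in> \<C>" for C using ch that by (auto simp: \<A>_def subset_chain_def)
    have "subgroup (\<Union>\<C>) G"
    proof (rule G.subgroupI)
      show "\<Union>\<C> \<subseteq> carrier G" using sub subgroup.subset by blast
      obtain C where "C \<in> \<C>" using ne by blast
      then show "\<Union>\<C> \<noteq> {}" using subgroup.one_closed[OF sub] by blast
      show "inv\<^bsub>G\<^esub> a \<in> \<Union>\<C>" if "a \<in> \<Union>\<C>" for a using that sub subgroup.m_inv_closed by fastforce
      fix a b assume "a \<in> \<Union>\<C>" "b \<in> \<Union>\<C>"
      then obtain A B where AB: "A \<in> \<C>" "B \<in> \<C>" "a \<in> A" "b \<in> B" by blast
      then have "A \<subseteq> B \<or> B \<subseteq> A" using ch by (auto simp: subset_chain_def)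
      then show "a \<otimes>\<^bsub>G\<^esub> b \<in> \<Union>\<C>" using AB sub subgroup.m_closed by (metis UnionI subsetD)
    qed
    then show ?thesis using ch by (auto simp: \<A>_def subset_chain_def)
  qed
  ultimately obtain C where C: "C \<in> \<A>" and max: "\<And>B. \<lbrakk>B \<in> \<A>; C \<subseteq> B\<rbrakk> \<Longrightarrow> B = C"
    using subset_Zorn_nonempty[of \<A>] by (metis empty_iff)
  have CG: "subgroup C G" and ker: "\<And>x. \<lbrakk>x \<in> C; f x = \<one>\<^bsub>H\<^esub>\<rbrakk> \<Longrightarrow> x = \<one>\<^bsub>G\<^esub>"
    using C by (auto simp: \<A>_def)
  have Cc: "x \<in> carrier G" if "x \<in> C" for x using subgroup.mem_carrier[OF CG that] .
  have inj: "inj_on f C"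
  proof (rule inj_onI)
    fix x y assume xy: "x \<in> C" "y \<in> C" "f x = f y"
    then have "f (x \<otimes>\<^bsub>G\<^esub> inv\<^bsub>G\<^esub> y) = \<one>\<^bsub>H\<^esub>" using Cc by simp
    then have "x \<otimes>\<^bsub>G\<^esub> inv\<^bsub>G\<^esub> y = \<one>\<^bsub>G\<^esub>"
      using ker subgroup.m_closed[OF CG] subgroup.m_inv_closed[OF CG] xy by metis
    then show "x = y" using Cc xy by (simp add: G.inv_solve_right')
  qed
  have "carrier H \<subseteq> f ` C"
  proof
    fix y assume "y \<in> carrier H"
    then obtain x where x: "x \<in> carrier G" "f x = y" unfolding surj[symmetric] by blast
    show "y \<in> f ` C"
    proof (rule ccontr)
      assume y: "y \<notin> f ` C"
      \<comment> \<open>Two cosets suffice for a subgroup containing \<open>x\<close>, because the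
        square of \<open>x\<close> is trivial.\<close>
      let ?B = "C \<union> (\<lambda>c. x \<otimes>\<^bsub>G\<^esub> c) ` C"
      have "subgroup ?B G"
      proof (rule G.subgroupI)
        show "?B \<subseteq> carrier G" using Cc x by auto
        show "?B \<noteq> {}" using subgroup.one_closed[OF CG] by blast
        show "inv\<^bsub>G\<^esub> a \<in> ?B" if "a \<in> ?B" for a using that Cc x inv_self by auto
        have "\<exists>c\<in>C. a = c \<or> a = x \<otimes>\<^bsub>G\<^esub> c" if "a \<in> ?B" for a using that by auto
        moreover fix a b assume "a \<in> ?B" "b \<in> ?B"
        ultimately obtain c d where cd: "c \<in> C" "d \<in> C" "a = c \<or> a = x \<otimes>\<^bsub>G\<^esub> c" "b = d \<or> b = x \<otimes>\<^bsub>G\<^esub> d"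
          by meson
        have "c \<otimes>\<^bsub>G\<^esub> (x \<otimes>\<^bsub>G\<^esub> d) = x \<otimes>\<^bsub>G\<^esub> (c \<otimes>\<^bsub>G\<^esub> d)" "x \<otimes>\<^bsub>G\<^esub> c \<otimes>\<^bsub>G\<^esub> d = x \<otimes>\<^bsub>G\<^esub> (c \<otimes>\<^bsub>G\<^esub> d)"
          using Cc cd(1,2) x(1) by (simp_all add: G.m_ac)
        moreover have "(x \<otimes>\<^bsub>G\<^esub> c) \<otimes>\<^bsub>G\<^esub> (x \<otimes>\<^bsub>G\<^esub> d) = c \<otimes>\<^bsub>G\<^esub> d"
        proof -
          have "(x \<otimes>\<^bsub>G\<^esub> c) \<otimes>\<^bsub>G\<^esub> (x \<otimes>\<^bsub>G\<^esub> d) = (x \<otimes>\<^bsub>G\<^esub> x) \<otimes>\<^bsub>G\<^esub> (c \<otimes>\<^bsub>G\<^esub> d)"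
            using Cc cd(1,2) x(1) by (simp add: G.m_ac)
          then show ?thesis using Cc cd(1,2) x(1) two by simp
        qed
        ultimately show "a \<otimes>\<^bsub>G\<^esub> b \<in> ?B" using cd subgroup.m_closed[OF CG cd(1,2)] by auto
      qed
      moreover have "z = \<one>\<^bsub>G\<^esub>" if "z \<in> ?B" "f z = \<one>\<^bsub>H\<^esub>" for z
      proof (cases "z \<in> C")
        case False
        then obtain c where c: "c \<in> C" "z = x \<otimes>\<^bsub>G\<^esub> c" using \<open>z \<in> ?B\<close> by blast
        \<comment> \<open>A kernel element in the new coset would make \<open>y\<close> the inverse
          of \<open>f c\<close>, hence equal to \<open>f c\<close> by exponent 2, although
          \<open>y\<close> is not in the image of \<open>C\<close>.\<close>
        have "y \<otimes>\<^bsub>H\<^esub> f c = \<one>\<^bsub>H\<^esub>" using that(2) c x Cc by simp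
        then have "y = inv\<^bsub>H\<^esub> f c" using Cc[OF c(1)] x by (metis H.inv_equality f.hom_closed)
        also have "\<dots> = f c" using Cc[OF c(1)] inv_self f.hom_inv by metis
        finally show ?thesis using y c(1) by blast
      qed (use ker that in blast)
      ultimately have "?B \<in> \<A>" by (simp add: \<A>_def)
      then have "?B = C" by (rule max) blast
      moreover have "x \<in> ?B" using x subgroup.one_closed[OF CG] by (auto intro!: image_eqI[of _ _ "\<one>\<^bsub>G\<^esub>"])
      ultimately show False using y x by blast
    qed
  qed
  moreover have "f ` C \<subseteq> carrier H" using Cc by auto
  ultimately have bij: "bij_betw f C (carrier H)" using inj by (auto simp: bij_betw_def)
  define \<phi> where "\<phi> = inv_into C f"
  have \<phi>: "\<phi> y \<in> C" "f (\<phi> y) = y" if "y \<in> carrier H" for y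
    using bij that by (auto simp: \<phi>_def bij_betw_def f_inv_into_f inv_into_into)
  have "\<phi> \<in> hom H G"
  proof (rule homI)
    fix y z assume yz: "y \<in> carrier H" "z \<in> carrier H"
    show "\<phi> (y \<otimes>\<^bsub>H\<^esub> z) = \<phi> y \<otimes>\<^bsub>G\<^esub> \<phi> z"
      by (rule inj_onD[OF inj]) (use \<phi> yz Cc subgroup.m_closed[OF CG] in auto)
  qed (use \<phi> Cc in blast)
  moreover have "inj_on \<phi> (carrier H)" by (rule inj_onI) (metis \<phi>(2))
  ultimately show ?thesis by (auto simp: mon_def)
qed

section \<open>From Cech cochains to cohomology groups\<close>

context cech_resolution
begin

lemma cohomology_trivial:
  assumes "\<And>c. cocycle m c \<Longrightarrow> c \<in> C.coboundaries m"
  shows "trivial_group (global_cohomology T I d (int m))"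
proof -
  let ?B = "global_coboundaries T I d m"
  interpret Z: comm_group "cycles m" by (rule comm_group_cycles)
  have "?B #>\<^bsub>cycles m\<^esub> z = ?B" if "z \<in> carrier (cycles m)" for z
  proof -
    obtain c where "represents m c z" "cocycle m c"
      using cycle_represented[OF \<open>z \<in> carrier (cycles m)\<close>] by metis
    then have "z \<in> ?B" using assms represents_boundary_iff by blast
    then show ?thesis using Z.coset_join2 that global_coboundaries_subgroup by blast
  qed
  then have "carrier (cycles m Mod ?B) = {\<one>\<^bsub>cycles m Mod ?B\<^esub>}"
    unfolding carrier_FactGroup using Z.one_closed by auto
  moreover have "group (cycles m Mod ?B)"
    using Z.abelian_FactGroup[OF global_coboundaries_subgroup] comm_group.axioms(2) by blast
  ultimately show ?thesis by (simp add: trivial_group_def global_cohomology_eq)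
qed

text \<open>Sections of an injective sheaf need not have exponent 2, so the property is transferred
  from Cech cochains: the square of a representing cocycle is trivial, hence a coboundary, and it
  represents the square of the cycle.\<close>

lemma cohomology_exponent_2:
  assumes "\<And>c. c \<in> carrier (CF (Suc m)) \<Longrightarrow>
      c \<otimes>\<^bsub>CF (Suc m)\<^esub> c = \<one>\<^bsub>CF (Suc m)\<^esub>"
    and x: "x \<in> carrier (global_cohomology T I d (int m))"
  shows "x \<otimes>\<^bsub>global_cohomology T I d (int m)\<^esub> x = \<one>\<^bsub>global_cohomology T I d (int m)\<^esub>"
proof -
  let ?B = "global_coboundaries T I d m"
  interpret Z: comm_group "cycles m" by (rule comm_group_cycles)
  interpret B: normal ?B "cycles m" by (rule Z.subgroup_imp_normal[OF global_coboundaries_subgroup])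
  obtain z where z: "z \<in> carrier (cycles m)" "x = ?B #>\<^bsub>cycles m\<^esub> z"
    using x by (auto simp: global_cohomology_eq carrier_FactGroup)
  obtain c where c: "represents m c z" "cocycle m c" using cycle_represented[OF z(1)] by metis
  have "\<one>\<^bsub>CF (Suc m)\<^esub> \<in> C.coboundaries m"
    unfolding C.coboundaries_def by (cases m) (auto intro!: image_eqI[of _ _ "\<one>\<^bsub>CF m\<^esub>"]
      simp: group_hom.hom_one[OF C.dF_group_hom])
  moreover have "represents m \<one>\<^bsub>CF (Suc m)\<^esub> (z \<otimes>\<^bsub>cycles m\<^esub> z)"
    using represents_mult[OF c(1) c(1)] assms(1) c(2) by simp
  ultimately have "z \<otimes>\<^bsub>cycles m\<^esub> z \<in> ?B" using represents_boundary_iff by blast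
  then have "?B #>\<^bsub>cycles m\<^esub> (z \<otimes>\<^bsub>cycles m\<^esub> z) = ?B"
    using Z.coset_join2 z(1) global_coboundaries_subgroup by blast
  then show ?thesis using z by (simp add: global_cohomology_eq B.rcos_sum)
qed

lemma group_cohomology: "comm_group (global_cohomology T I d (int m))"
  unfolding global_cohomology_eq
  by (rule comm_group.abelian_FactGroup[OF comm_group_cycles global_coboundaries_subgroup])

end

text \<open>Cech degree \<open>Suc k\<close> sits at index \<open>Suc (Suc k)\<close>, where
  \<open>fubini_primitive\<close> provides primitives of cocycles.\<close>

lemma cohomology_Suc_trivial:
  assumes "fubini_partition k n K Y"
    and I: "injective_resolution (X_minus n K) (Z2_sheaf (X_minus n K)) I \<epsilon> d"
  shows "trivial_group (global_cohomology (X_minus n K) I d (int (Suc k)))"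
proof -
  interpret fubini_partition k n K Y by (rule assms(1))
  interpret cech_resolution "X_minus n K" "Z2_sheaf (X_minus n K)" I \<epsilon> d "D_cover n K" "Suc n"
    by (rule cech_resolution_X_minus[OF I])
  show ?thesis
  proof (rule cohomology_trivial)
    fix c assume c: "cocycle (Suc k) c"
    then obtain b where "b \<in> carrier (Z2_cochains n K (Suc k))" "Z2_diff n K (Suc k) b = c"
      using fubini_primitive[of c] by metis
    then show "c \<in> C.coboundaries (Suc k)" unfolding C.coboundaries_def by auto
  qed
qed

text \<open>The relation \<open>R\<close> leads from a cycle of \<open>J\<close> to a Cech cocycle
  on the large product, by \<open>res\<close> to one on the subproduct, and from there to a cycle of
  \<open>I\<close>. \<open>extend_cocycle\<close> makes it total on the right; a homomorphic section
  of the resulting epimorphism is the injection.\<close>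

lemma cohomology_subproduct_mono:
  assumes fubini: "fubini_partition m n K Y" and sub: "subproduct n L K emb"
    and I: "injective_resolution (X_minus n L) (Z2_sheaf (X_minus n L)) I \<epsilon> d"
    and J: "injective_resolution (X_minus n K) (Z2_sheaf (X_minus n K)) J \<eta> d'"
  shows "\<exists>\<phi>. \<phi> \<in> mon (global_cohomology (X_minus n L) I d (int m)) (global_cohomology (X_minus n K) J d' (int m))"
proof -
  let ?HK = "global_cohomology (X_minus n K) J d' (int m)" and ?HL = "global_cohomology (X_minus n L) I d (int m)"
  let ?BK = "global_coboundaries (X_minus n K) J d' m" and ?BL = "global_coboundaries (X_minus n L) I d m"
  let ?CK = "Z2_cochains n K (Suc m)"
  interpret subproduct n L K emb by (rule sub)
  interpret L: cech_resolution "X_minus n L" "Z2_sheaf (X_minus n L)" I \<epsilon> d "D_cover n L" "Suc n"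
    by (rule cech_resolution_X_minus[OF I])
  interpret K: cech_resolution "X_minus n K" "Z2_sheaf (X_minus n K)" J \<eta> d' "D_cover n K" "Suc n"
    by (rule cech_resolution_X_minus[OF J])
  have res_group_hom: "group_hom (Z2_cochains n K (Suc p)) (Z2_cochains n L (Suc p)) (res (Suc p))" for p
    by (simp add: group_hom_def group_hom_axioms_def Z2_group res_hom)
  have diff_group_hom: "group_hom (Z2_cochains n K p) (Z2_cochains n K (Suc p)) (Z2_diff n K p)" for p
    by (simp add: group_hom_def group_hom_axioms_def Z2_group Z2_diff_hom)
  interpret M: comm_group "?CK" by (rule Z2_comm_group)
  have one_one: "\<one>\<^bsub>Z2_cochains n K p\<^esub> \<otimes>\<^bsub>Z2_cochains n K p\<^esub> \<one>\<^bsub>Z2_cochains n K p\<^esub> = \<one>\<^bsub>Z2_cochains n K p\<^esub>" for p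
    by (simp add: monoid.l_one[OF group.is_monoid[OF Z2_group]] Z2_one_closed)
  define R where "R z w \<longleftrightarrow> z \<in> carrier (K.cycles m) \<and> w \<in> carrier (L.cycles m) \<and>
      (\<exists>c. K.cocycle m c \<and> K.represents m c z \<and> L.represents m (res (Suc m) c) w)" for z w
  have RI: "R z w" if "z \<in> carrier (K.cycles m)" "w \<in> carrier (L.cycles m)" "K.cocycle m c"
      "K.represents m c z" "L.represents m (res (Suc m) c) w" for z w c
    unfolding R_def using that by blast
  have res_cocycle: "L.cocycle m (res (Suc m) c)" if "K.cocycle m c" for c
    using that res_closed res_diff[of c m] group_hom.hom_one[OF res_group_hom] by simp
  obtain f where f: "f \<in> hom (K.cycles m Mod ?BK)
        (L.cycles m Mod ?BL)"
      "f ` carrier (K.cycles m Mod ?BK) =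
        carrier (L.cycles m Mod ?BL)"
  proof (rule quotient_epi_from_relation[OF K.comm_group_cycles L.comm_group_cycles
        K.global_coboundaries_subgroup L.global_coboundaries_subgroup, of R])
    show "z \<in> carrier (K.cycles m) \<and> w \<in> carrier (L.cycles m)" if "R z w" for z w
      using that by (simp add: R_def)
  next
    fix z w z' w' assume "R z w" "R z' w'"
    then obtain c c' where
        c: "z \<in> carrier (K.cycles m)" "w \<in> carrier (L.cycles m)"
          "K.cocycle m c" "K.represents m c z" "L.represents m (res (Suc m) c) w" and
        c': "z' \<in> carrier (K.cycles m)" "w' \<in> carrier (L.cycles m)"
          "K.cocycle m c'" "K.represents m c' z'" "L.represents m (res (Suc m) c') w'"
      unfolding R_def by metis
    have "L.represents m (res (Suc m) (c \<otimes>\<^bsub>?CK\<^esub> c')) (w \<otimes>\<^bsub>L.cycles m\<^esub> w')"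
      using L.represents_mult[OF c(5) c'(5)] res_mult[of c m c'] c(3) c'(3) by simp
    moreover have "K.cocycle m (c \<otimes>\<^bsub>?CK\<^esub> c')"
      using c(3) c'(3) hom_mult[OF Z2_diff_hom c(3)[THEN conjunct1] c'(3)[THEN conjunct1]] one_one by simp
    ultimately show "R (z \<otimes>\<^bsub>K.cycles m\<^esub> z') (w \<otimes>\<^bsub>L.cycles m\<^esub> w')"
      using RI K.represents_mult[OF c(4) c'(4)] monoid.m_closed[OF group.is_monoid[OF K.group_cycles] c(1) c'(1)]
        monoid.m_closed[OF group.is_monoid[OF L.group_cycles] c(2) c'(2)] by metis
  next
    fix z w assume "R z w"
    then obtain c where c: "z \<in> carrier (K.cycles m)" "w \<in> carrier (L.cycles m)"
          "K.cocycle m c" "K.represents m c z" "L.represents m (res (Suc m) c) w"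
      unfolding R_def by metis
    have "L.represents m (res (Suc m) (inv\<^bsub>?CK\<^esub> c)) (inv\<^bsub>L.cycles m\<^esub> w)"
      using L.represents_inv[OF c(5,2)] group_hom.hom_inv[OF res_group_hom, of c] c(3) by simp
    moreover have "K.cocycle m (inv\<^bsub>?CK\<^esub> c)"
      using c(3) group_hom.hom_inv[OF diff_group_hom, of c] monoid.inv_one[OF group.is_monoid[OF Z2_group]]
      by simp
    ultimately show "R (inv\<^bsub>K.cycles m\<^esub> z) (inv\<^bsub>L.cycles m\<^esub> w)"
      using RI K.represents_inv[OF c(4,1)] group.inv_closed[OF K.group_cycles c(1)]
        group.inv_closed[OF L.group_cycles c(2)] by metis
  next
    fix z assume z: "z \<in> carrier (K.cycles m)"
    then obtain c where c: "K.represents m c z" "K.cocycle m c" using K.cycle_represented by metis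
    obtain w where "L.represents m (res (Suc m) c) w" "w \<in> carrier (L.cycles m)"
      using L.cocycle_represents[OF res_cocycle[OF c(2)]] by metis
    then show "\<exists>w. R z w" using RI z c by metis
  next
    fix w assume w: "w \<in> carrier (L.cycles m)"
    then obtain c where c: "L.represents m c w" "L.cocycle m c" using L.cycle_represented by metis
    obtain c' where c': "K.cocycle m c'" "res (Suc m) c' = c"
      using extend_cocycle[OF fubini, of c] c(2) by metis
    obtain z where "K.represents m c' z" "z \<in> carrier (K.cycles m)"
      using K.cocycle_represents[OF c'(1)] by metis
    then show "\<exists>z. R z w" using RI w c c' by metis
  next
    fix z w assume "R z w" and z: "z \<in> ?BK"
    then obtain c where c: "K.cocycle m c" "K.represents m c z" "L.represents m (res (Suc m) c) w"
      unfolding R_def by metis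
    have "c \<in> K.C.coboundaries m" using K.represents_boundary_iff[OF c(2)] z by blast
    then have "res (Suc m) c \<in> L.C.coboundaries m"
    proof (cases m)
      case 0
      then show ?thesis
        using \<open>c \<in> K.C.coboundaries m\<close> group_hom.hom_one[OF res_group_hom]
        unfolding K.C.coboundaries_def L.C.coboundaries_def by simp
    next
      case (Suc q)
      then obtain b where b: "b \<in> carrier (Z2_cochains n K (Suc q))" "c = Z2_diff n K (Suc q) b"
        using \<open>c \<in> K.C.coboundaries m\<close> unfolding K.C.coboundaries_def by auto
      then have "res (Suc m) c = Z2_diff n L (Suc q) (res (Suc q) b)" using res_diff Suc by simp
      then show ?thesis
        using res_closed[OF b(1)] Suc unfolding L.C.coboundaries_def by auto
    qed
    then show "w \<in> ?BL"
      using L.represents_boundary_iff[OF c(3)] by blast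
  qed
  show ?thesis
  proof (rule epi_splits_exponent_2)
    show "f \<in> hom ?HK ?HL"
      "f ` carrier ?HK =
        carrier ?HL"
      using f by (simp_all add: K.global_cohomology_eq L.global_cohomology_eq)
    show "comm_group ?HK" by (rule K.group_cohomology)
    show "group ?HL"
      using L.group_cohomology comm_group.axioms(2) by blast
    show "x \<otimes>\<^bsub>?HK\<^esub> x = \<one>\<^bsub>?HK\<^esub>"
      if "x \<in> carrier ?HK" for x
      using K.cohomology_exponent_2[OF Z2_cech_self_inverse[OF open_D_cover openin_topspace] that] .
  qed
qed

theorem theorem2:
  fixes n :: nat and k :: int and K :: "nat \<Rightarrow> 'k set"
  assumes "weakly_increasing n K"
    and "- 1 \<le> k" and "k \<le> int n"
    and "\<exists>Y. Fubini_partition k n K Y"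
  shows "(\<forall>H :: 'b set monoid.
            is_sheaf_cohomology (X_minus n K)
              (constant_sheaf (X_minus n K) (integer_mod_group 2)) (k + 1) H \<longrightarrow>
            trivial_group H) \<and>
         (\<forall>L :: nat \<Rightarrow> 'l set. weakly_increasing n L \<and> (\<forall>i\<le>n. L i \<lesssim> K i) \<longrightarrow>
            (\<forall>(H\<^sub>L :: 'c set monoid) (H\<^sub>K :: 'd set monoid).
               is_sheaf_cohomology (X_minus n L)
                 (constant_sheaf (X_minus n L) (integer_mod_group 2)) k H\<^sub>L \<and>
               is_sheaf_cohomology (X_minus n K)
                 (constant_sheaf (X_minus n K) (integer_mod_group 2)) k H\<^sub>K \<longrightarrow>
               (\<exists>\<phi>. \<phi> \<in> mon H\<^sub>L H\<^sub>K)))"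
proof -
  obtain Y where Y: "Fubini_partition k n K Y" using assms(4) by blast
  have "k \<noteq> - 1"
  proof
    assume k: "k = - 1"
    have "\<forall>x\<in>facet n K {}. \<exists>E. N_set n K {} x E \<subseteq> {}"
      using Y[unfolded Fubini_partition_def, THEN conjunct2, THEN conjunct2, rule_format, of "{}"] k
      by fastforce
    moreover have "(\<lambda>i\<in>{..n}. None) \<in> facet n K {}" by (auto simp: facet_def topspace_X_space)
    ultimately obtain E where "N_set n K {} (\<lambda>i\<in>{..n}. None) E \<subseteq> {}" by blast
    moreover have "(\<lambda>i\<in>{..n}. None) \<in> N_set n K {} (\<lambda>i\<in>{..n}. None) E"
      by (auto simp: N_set_def topspace_X_space)
    ultimately show False by blast
  qed
  then obtain m where k: "k = int m" using assms(2) nonneg_int_cases[of k] by force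
  then have fubini: "fubini_partition m n K Y" using Y by unfold_locales simp
  show ?thesis
  proof (intro conjI allI impI)
    fix H :: "'b set monoid"
    assume "is_sheaf_cohomology (X_minus n K) (Z2_sheaf (X_minus n K)) (k + 1) H"
    then obtain I \<epsilon> d where I: "injective_resolution (X_minus n K) (Z2_sheaf (X_minus n K)) I \<epsilon> d"
        and H: "H = global_cohomology (X_minus n K) I d (int (Suc m))"
      unfolding is_sheaf_cohomology_def k by (metis of_nat_Suc add.commute)
    show "trivial_group H"
      unfolding H by (rule cohomology_Suc_trivial[OF fubini I])
  next
    fix L :: "nat \<Rightarrow> 'l set" and H\<^sub>L :: "'c set monoid" and H\<^sub>K :: "'d set monoid"
    assume "weakly_increasing n L \<and> (\<forall>i\<le>n. L i \<lesssim> K i)"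
    \<comment> \<open>The comparison of cardinals is used one coordinate at a time; the chosen
      injections need not be related across coordinates.\<close>
    then have "\<forall>i\<in>{..n}. \<exists>f. inj_on f (L i) \<and> f ` L i \<subseteq> K i" by (auto simp: lepoll_def)
    then obtain emb where emb: "\<forall>i\<in>{..n}. inj_on (emb i) (L i) \<and> emb i ` L i \<subseteq> K i" by metis
    then have sub: "subproduct n L K emb" by unfold_locales auto
    assume "is_sheaf_cohomology (X_minus n L) (Z2_sheaf (X_minus n L)) k H\<^sub>L \<and>
        is_sheaf_cohomology (X_minus n K) (Z2_sheaf (X_minus n K)) k H\<^sub>K"
    then obtain I \<epsilon> d J \<eta> d' where
        I: "injective_resolution (X_minus n L) (Z2_sheaf (X_minus n L)) I \<epsilon> d" "H\<^sub>L = global_cohomology (X_minus n L) I d (int m)"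
        and J: "injective_resolution (X_minus n K) (Z2_sheaf (X_minus n K)) J \<eta> d'" "H\<^sub>K = global_cohomology (X_minus n K) J d' (int m)"
      unfolding is_sheaf_cohomology_def k by metis
    show "\<exists>\<phi>. \<phi> \<in> mon H\<^sub>L H\<^sub>K"
      unfolding I(2) J(2) by (rule cohomology_subproduct_mono[OF fubini sub I(1) J(1)])
  qed
qed

end
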